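(* Let $T$ be the generator of a $C_0$-semigroup $\mathrm{e}^{-Tt}$ on a Hilbert space $\mathcal{H}$ such that $\mathrm{e}^{-Tt}\in\mathcal{C}_1$ for all $t>0$. Let $A$ be a closed operator on $\mathcal{H}$ such that $$\operatorname{D}(A)\supset \bigcup_{t>0}\mathrm{e}^{-Tt}(\mathcal{H})\qquad\text{and}\qquad \int_0^1\|A\mathrm{e}^{-Tt}\|_q\,\mathrm{d}t<\infty$$ for some $1\le q<\infty$. Then $T+A$ with domain $\operatorname{D}(T)$ is also the generator of a $C_0$-semigroup $\mathrm{e}^{-(T+A)t}$ such that $\mathrm{e}^{-(T+A)t}\in\mathcal{C}_1$ for all $t>0$. Moreover, $$\|\mathrm{e}^{-(T+A)t}\|_q=O\left(\|\mathrm{e}^{-Tt}\|_q\right)\qquad\text{as } t\to0^+.$$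
   Context: An operator $T$ on $\mathcal{H}$ is called the generator of a $C_0$-semigroup $\mathrm{e}^{-Tt}$, $t>0$, if $-T$ is its infinitesimal generator in the usual sense. For $1\le q<\infty$, $\mathcal{C}_q$ denotes the $q$ Schatten-von Neumann ideal on $\mathcal{H}$ with norm $\|\cdot\|_q$ (so $\mathcal{C}_1$ is the trace class). $\operatorname{D}(A)$ denotes the domain of $A$. Finiteness of the integral includes that $A\mathrm{e}^{-Tt}$ has finite $\mathcal{C}_q$ norm for the relevant $t$. *)

theory Defs
  imports "HOL-Analysis.Analysis"
begin

text \<open>The real inner product, and with it the norm and the topology, is the real part of the
  complex one.  The complex inner product is antilinear in its first argument.\<close>

class chilbert_space = real_inner + complete_space +
  fixes scaleC :: "complex \<Rightarrow> 'a \<Rightarrow> 'a" (infixr "*\<^sub>C" 75)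
    and cinner :: "'a \<Rightarrow> 'a \<Rightarrow> complex"
  assumes scaleC_add_right: "c *\<^sub>C (x + y) = c *\<^sub>C x + c *\<^sub>C y"
    and scaleC_add_left: "(c + d) *\<^sub>C x = c *\<^sub>C x + d *\<^sub>C x"
    and scaleC_scaleC: "c *\<^sub>C d *\<^sub>C x = (c * d) *\<^sub>C x"
    and scaleR_eq_scaleC: "r *\<^sub>R x = complex_of_real r *\<^sub>C x"
    and cinner_add_right: "cinner x (y + z) = cinner x y + cinner x z"
    and cinner_scaleC_right: "cinner x (c *\<^sub>C y) = c * cinner x y"
    and cinner_commute: "cinner x y = cnj (cinner y x)"
    and inner_eq_Re_cinner: "inner x y = Re (cinner x y)"

instantiation complex :: chilbert_space
begin

definition scaleC_complex :: "complex \<Rightarrow> complex \<Rightarrow> complex"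
  where "scaleC_complex c x = c * x"

definition cinner_complex :: "complex \<Rightarrow> complex \<Rightarrow> complex"
  where "cinner_complex x y = cnj x * y"

instance
  by standard
    (simp_all add: scaleC_complex_def cinner_complex_def inner_complex_def scaleR_conv_of_real
      algebra_simps)

end

global_interpretation complex_vector:
  vector_space "scaleC :: complex \<Rightarrow> 'a \<Rightarrow> 'a::chilbert_space"
  defines csubspace = complex_vector.subspace
    and cdim = complex_vector.dim
proof
  fix x :: 'a
  have "1 *\<^sub>R x = complex_of_real 1 *\<^sub>C x"
    by (rule scaleR_eq_scaleC)
  then show "1 *\<^sub>C x = x"
    by simp
qed (simp_all add: scaleC_add_right scaleC_add_left scaleC_scaleC)

definition bounded_clinear :: "('a::chilbert_space \<Rightarrow> 'a) \<Rightarrow> bool"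
  where "bounded_clinear K \<longleftrightarrow>
    Vector_Spaces.linear scaleC scaleC K \<and> (\<exists>M. \<forall>x. norm (K x) \<le> M * norm x)"

definition compact_operator :: "('a::chilbert_space \<Rightarrow> 'a) \<Rightarrow> bool"
  where "compact_operator K \<longleftrightarrow> bounded_clinear K \<and> compact (closure (K ` cball 0 1))"

definition cadjoint :: "('a::chilbert_space \<Rightarrow> 'a) \<Rightarrow> 'a \<Rightarrow> 'a"
  where "cadjoint K = (THE L. \<forall>x y. cinner (K x) y = cinner x (L y))"

text \<open>An unbounded operator is given by its domain and a function whose values outside the
  domain are irrelevant.\<close>

definition linear_operator_on :: "'a::chilbert_space set \<Rightarrow> ('a \<Rightarrow> 'a) \<Rightarrow> bool"
  where "linear_operator_on D A \<longleftrightarrow> csubspace D \<and>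
    (\<forall>x\<in>D. \<forall>y\<in>D. A (x + y) = A x + A y) \<and> (\<forall>c. \<forall>x\<in>D. A (c *\<^sub>C x) = c *\<^sub>C A x)"

definition closed_operator :: "'a::chilbert_space set \<Rightarrow> ('a \<Rightarrow> 'a) \<Rightarrow> bool"
  where "closed_operator D A \<longleftrightarrow> linear_operator_on D A \<and> closed {(x, A x) |x. x \<in> D}"

text \<open>A singular value of a compact operator \<open>K\<close> is a number \<open>s > 0\<close> such that \<open>s\<^sup>2\<close> is an
  eigenvalue of \<open>K\<^sup>*K\<close>, and it is repeated according to the dimension of the eigenspace.  Summing
  over the distinct singular values with their multiplicities avoids enumerating them.\<close>

definition sv_eigenspace :: "('a::chilbert_space \<Rightarrow> 'a) \<Rightarrow> real \<Rightarrow> 'a set"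
  where "sv_eigenspace K s = {x. cadjoint K (K x) = complex_of_real (s\<^sup>2) *\<^sub>C x}"

definition singular_values :: "('a::chilbert_space \<Rightarrow> 'a) \<Rightarrow> real set"
  where "singular_values K = {s. s > 0 \<and> sv_eigenspace K s \<noteq> {0}}"

definition sv_multiplicity :: "('a::chilbert_space \<Rightarrow> 'a) \<Rightarrow> real \<Rightarrow> nat"
  where "sv_multiplicity K s = cdim (sv_eigenspace K s)"

definition schatten_class :: "real \<Rightarrow> ('a::chilbert_space \<Rightarrow> 'a) set"
  where "schatten_class q = {K. compact_operator K \<and>
    (\<lambda>s. real (sv_multiplicity K s) * s powr q) summable_on singular_values K}"

text \<open>This is meaningful only for members of \<^term>\<open>schatten_class q\<close>.\<close>

definition schatten_norm :: "real \<Rightarrow> ('a::chilbert_space \<Rightarrow> 'a) \<Rightarrow> real"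
  where "schatten_norm q K =
    (\<Sum>\<^sub>\<infinity>s\<in>singular_values K. real (sv_multiplicity K s) * s powr q) powr (1 / q)"

text \<open>Only the values at times \<open>t \<ge> 0\<close> matter.\<close>

definition C0_semigroup :: "(real \<Rightarrow> 'a::chilbert_space \<Rightarrow> 'a) \<Rightarrow> bool"
  where "C0_semigroup S \<longleftrightarrow>
    (\<forall>t\<ge>0. bounded_clinear (S t)) \<and> S 0 = id \<and>
    (\<forall>s\<ge>0. \<forall>t\<ge>0. S (s + t) = S s \<circ> S t) \<and>
    (\<forall>x. ((\<lambda>t. S t x) \<longlongrightarrow> x) (at_right 0))"

definition has_infinitesimal_generator ::
    "(real \<Rightarrow> 'a::chilbert_space \<Rightarrow> 'a) \<Rightarrow> 'a set \<Rightarrow> ('a \<Rightarrow> 'a) \<Rightarrow> bool"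
  where "has_infinitesimal_generator S D G \<longleftrightarrow>
    D = {x. \<exists>y. ((\<lambda>t. (S t x - x) /\<^sub>R t) \<longlongrightarrow> y) (at_right 0)} \<and>
    (\<forall>x\<in>D. ((\<lambda>t. (S t x - x) /\<^sub>R t) \<longlongrightarrow> G x) (at_right 0))"

text \<open>Sign convention: \<open>T\<close> with domain \<open>D\<close> generates \<open>S t = exp (- T t)\<close>.  The semigroup is
  determined on \<open>t \<ge> 0\<close> by \<open>T\<close>.\<close>

definition generates_C0_semigroup ::
    "'a::chilbert_space set \<Rightarrow> ('a \<Rightarrow> 'a) \<Rightarrow> (real \<Rightarrow> 'a \<Rightarrow> 'a) \<Rightarrow> bool"
  where "generates_C0_semigroup D T S \<longleftrightarrow>
    C0_semigroup S \<and> has_infinitesimal_generator S D (\<lambda>x. - T x)"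

end

theory Submission
  imports Defs
begin

text \<open>
  Put \<open>B(s) = A e\<^bsup>-Ts\<^esup>\<close>. The perturbed semigroup \<open>U\<close> has to solve
  Duhamel's equation \<open>U(t) = e\<^bsup>-Tt\<^esup> - \<integral>\<^sub>0\<^sup>t U(t - s) B(s)
  ds\<close>, in which \<open>A\<close> meets only the smoothing factor \<open>e\<^bsup>-Ts\<^esup>\<close>.
  The function \<open>s \<mapsto> \<parallel>B(s)\<parallel>\<^sub>q\<close> decreases on \<open>(0,
  1]\<close> up to the factor \<open>M = sup\<^bsub>t \<le> 1\<^esub>
  \<parallel>e\<^bsup>-Tt\<^esup>\<parallel>\<close>, so it has a decreasing integrable majorant
  \<open>g\<close> (\<open>decreasing_majorant\<close>). On an interval \<open>[0, \<tau>]\<close> with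
  \<open>\<integral>\<^sub>0\<^sup>\<tau> g \<le> 1/4\<close> the equation is solved by the Dyson series, the
  solution is unique, and uniqueness gives the semigroup law there (\<open>perturbed_add\<close>); the
  semigroup is then extended to all times by \<open>U(t) = U(t/n)\<^sup>n\<close>
  (\<open>C0_semigroup_extend\<close>).

  For \<open>x\<close> in \<open>D(T)\<close> the vectors \<open>B(s) x\<close> converge as \<open>s
  \<rightarrow> 0\<close>, because \<open>B(b) x - B(a) x\<close> is the integral of \<open>- B(r) T x\<close>
  over \<open>[a, b]\<close>; closedness of \<open>A\<close> gives \<open>x \<in> D(A)\<close> and the limit
  \<open>A x\<close>, and Duhamel's equation then shows that the generator of \<open>U\<close> extends
  \<open>- (T + A)\<close> on \<open>D(T)\<close>. It is not larger, since for large \<open>\<omega>\<close>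
  the operator \<open>\<omega> + T + A\<close> already maps \<open>D(T)\<close> onto the whole space
  (\<open>perturbed_generator\<close>).

  Duhamel's equation also yields the Schatten norm estimates. As \<open>\<parallel>U(t - s)
  B(s)\<parallel>\<^sub>q \<le> 2 M g(s)\<close>, the difference \<open>U(t) - e\<^bsup>-Tt\<^esup>\<close> is
  bounded in \<open>\<C>\<^sub>q\<close> for \<open>0 < t \<le> \<tau>\<close>. Unless the space is trivial,
  \<open>\<parallel>e\<^bsup>-Tt\<^esup>\<parallel>\<^sub>q\<close> is at least the operator norm and hence
  bounded away from 0 as \<open>t \<rightarrow> 0\<close>, so that the bounded error is absorbed into
  \<open>O(\<parallel>e\<^bsup>-Tt\<^esup>\<parallel>\<^sub>q)\<close>. Finally \<open>U(t) =
  U(t/n)\<^sup>n\<close> is the \<open>n\<close>-th power of an operator in \<open>\<C>\<^sub>q\<close>, which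
  is of trace class if \<open>n > q\<close> (\<open>schatten_bound_funpow\<close>).

  All of this uses Schatten norms only through the numbers \<open>sup (\<Sum>\<^sub>i
  \<bar>\<langle>f\<^sub>i, K e\<^sub>i\<rangle>\<bar>\<^sup>q)\<^bsup>1/q\<^esup>\<close>, the supremum being
  over finite systems satisfying Bessel's inequality. In this form the ideal property and the norm estimate
  for operator-valued integrals are elementary. That for \<open>q \<ge> 1\<close> the supremum is finite
  exactly on \<open>\<C>\<^sub>q\<close>, and is then the Schatten norm, is the content of
  \<open>schatten_class_imp_schatten_bound\<close> and \<open>schatten_bound_imp_schatten_class\<close>.
\<close>

instance chilbert_space \<subseteq> banach ..

section \<open>Complex Hilbert spaces and the adjoint\<close>

lemma cinner_add_left: "cinner (x + y) z = cinner x z + cinner y (z::'a::chilbert_space)"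
  by (metis cinner_add_right cinner_commute complex_cnj_add)

lemma cinner_scaleC_left: "cinner (c *\<^sub>C x) y = cnj c * cinner x (y::'a::chilbert_space)"
  by (metis cinner_scaleC_right cinner_commute complex_cnj_mult)

lemma cinner_scaleR_right: "cinner x (r *\<^sub>R y) = r *\<^sub>R cinner x (y::'a::chilbert_space)"
  by (simp add: scaleR_eq_scaleC [where 'a='a] cinner_scaleC_right scaleR_conv_of_real)

lemma cinner_scaleR_left: "cinner (r *\<^sub>R x) y = r *\<^sub>R cinner x (y::'a::chilbert_space)"
  by (simp add: scaleR_eq_scaleC [where 'a='a] cinner_scaleC_left scaleR_conv_of_real)

lemma cinner_self: "cinner x x = complex_of_real ((norm (x::'a::chilbert_space))\<^sup>2)"
proof -
  have "Im (cinner x x) = 0"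
    using arg_cong [OF cinner_commute [of x x], of Im] by simp
  moreover have "Re (cinner x x) = (norm x)\<^sup>2"
    by (simp add: dot_square_norm flip: inner_eq_Re_cinner)
  ultimately show ?thesis
    by (simp add: complex_eq_iff)
qed

lemma norm_scaleC: "norm (c *\<^sub>C x) = cmod c * norm (x::'a::chilbert_space)"
proof -
  have "complex_of_real ((norm (c *\<^sub>C x))\<^sup>2) = complex_of_real ((cmod c * norm x)\<^sup>2)"
    unfolding power_mult_distrib of_real_mult cinner_self [where 'a='a, symmetric]
    by (simp add: complex_norm_square [of c] cinner_scaleC_left cinner_scaleC_right
        del: of_real_power)
  then have "(norm (c *\<^sub>C x))\<^sup>2 = (cmod c * norm x)\<^sup>2"
    using of_real_eq_iff by blast
  then show ?thesis
    by (metis mult_nonneg_nonneg norm_ge_zero power2_eq_imp_eq)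
qed

text \<open>Multiplying one argument by a phase makes the complex inner product real and nonnegative, which
  carries the Cauchy--Schwarz inequality over from the real inner product.\<close>

lemma cmod_cinner_le: "cmod (cinner x y) \<le> norm x * norm (y::'a::chilbert_space)"
proof (cases "cinner x y = 0")
  case False
  define c where "c = cnj (sgn (cinner x y))"
  have c: "cmod c = 1" "c * cinner x y = cmod (cinner x y)"
    using False complex_norm_square [of "cinner x y"]
    by (simp_all add: c_def norm_sgn, simp add: sgn_eq mult.commute power2_eq_square divide_simps)
  have "cmod (cinner x y) = inner x (c *\<^sub>C y)"
    using c(2) by (simp add: inner_eq_Re_cinner cinner_scaleC_right)
  also have "\<dots> \<le> norm x * norm (c *\<^sub>C y)"
    by (rule norm_cauchy_schwarz)
  finally show ?thesis
    by (simp add: norm_scaleC c)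
qed simp

lemma bounded_bilinear_cinner: "bounded_bilinear (cinner :: 'a::chilbert_space \<Rightarrow> 'a \<Rightarrow> complex)"
proof
  show "\<exists>K. \<forall>a b. norm (cinner (a::'a) b) \<le> norm a * norm b * K"
    by (rule exI [of _ 1]) (simp add: cmod_cinner_le)
qed (simp_all add: cinner_add_left cinner_add_right cinner_scaleR_left cinner_scaleR_right)

global_interpretation cinner: bounded_bilinear "cinner :: 'a::chilbert_space \<Rightarrow> 'a \<Rightarrow> complex"
  by (rule bounded_bilinear_cinner)

lemma bounded_bilinear_scaleC: "bounded_bilinear (scaleC :: complex \<Rightarrow> 'a::chilbert_space \<Rightarrow> 'a)"
proof
  show "\<exists>K. \<forall>a b. norm (a *\<^sub>C (b::'a)) \<le> norm a * norm b * K"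
    by (rule exI [of _ 1]) (simp add: norm_scaleC)
  show "(r *\<^sub>R a) *\<^sub>C b = r *\<^sub>R (a *\<^sub>C b)" "a *\<^sub>C (r *\<^sub>R b) = r *\<^sub>R (a *\<^sub>C b)" for r a and b :: 'a
    by (simp_all add: scaleR_eq_scaleC [where 'a='a] scaleC_scaleC scaleR_conv_of_real mult.commute)
qed (simp_all add: scaleC_add_left scaleC_add_right)

global_interpretation scaleC: bounded_bilinear "scaleC :: complex \<Rightarrow> 'a::chilbert_space \<Rightarrow> 'a"
  by (rule bounded_bilinear_scaleC)

lemma cinner_eq_0_commute: "cinner x y = 0 \<longleftrightarrow> cinner y (x::'a::chilbert_space) = 0"
  by (metis cinner_commute complex_cnj_zero)

lemma cmod_cinner_commute: "cmod (cinner x y) = cmod (cinner y (x::'a::chilbert_space))"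
  by (metis cinner_commute complex_mod_cnj)

lemma cinner_eqI:
  assumes "\<And>x. cinner x y = cinner x z"
  shows "y = (z::'a::chilbert_space)"
proof -
  have "cinner (y - z) (y - z) = 0"
    by (simp add: cinner.diff_right assms)
  then show ?thesis
    by (simp add: cinner_self)
qed

subsection \<open>Bounded complex-linear operators\<close>

lemma bounded_clinearI:
  assumes "\<And>x y. K (x + y) = K x + K y" and "\<And>c x. K (c *\<^sub>C x) = c *\<^sub>C K x"
    and "\<And>x. norm (K x) \<le> M * norm (x::'a::chilbert_space)"
  shows "bounded_clinear K"
  unfolding bounded_clinear_def Vector_Spaces.linear_iff using assms
  by (auto intro: complex_vector.vector_space_axioms)

lemma bounded_clinear_add: "bounded_clinear K \<Longrightarrow> K (x + y) = K x + K y"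
  and bounded_clinear_scaleC: "bounded_clinear K \<Longrightarrow> K (c *\<^sub>C x) = c *\<^sub>C K x"
  unfolding bounded_clinear_def Vector_Spaces.linear_iff by auto

lemma bounded_clinear_imp_bounded_linear:
  assumes "bounded_clinear K"
  shows "bounded_linear K"
proof -
  obtain M where "\<And>x. norm (K x) \<le> M * norm x"
    using assms unfolding bounded_clinear_def by blast
  then show ?thesis
    by (intro bounded_linear_intro [where K = M])
      (simp_all add: assms bounded_clinear_add bounded_clinear_scaleC scaleR_eq_scaleC mult.commute)
qed

lemmas bounded_clinear_0 =
    linear_0 [OF bounded_linear.linear, OF bounded_clinear_imp_bounded_linear]
  and bounded_clinear_diff =
    linear_diff [OF bounded_linear.linear, OF bounded_clinear_imp_bounded_linear]
  and bounded_clinear_scaleR =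
    linear_cmul [OF bounded_linear.linear, OF bounded_clinear_imp_bounded_linear]
  and bounded_clinear_sum =
    linear_sum [OF bounded_linear.linear, OF bounded_clinear_imp_bounded_linear]
  and bounded_clinear_continuous_on =
    linear_continuous_on [OF bounded_clinear_imp_bounded_linear]
  and bounded_clinear_tendsto =
    bounded_linear.tendsto [OF bounded_clinear_imp_bounded_linear]

lemma bounded_clinear_bound:
  assumes "bounded_clinear K"
  obtains M where "M > 0" "\<And>x. norm (K x) \<le> M * norm x"
  using bounded_linear.pos_bounded [OF bounded_clinear_imp_bounded_linear [OF assms]]
  by (metis mult.commute)

lemma bounded_clinear_compose:
  assumes "bounded_clinear K" "bounded_clinear L"
  shows "bounded_clinear (\<lambda>x. K (L x))"
proof -
  obtain M N where "M > 0" "\<And>x. norm (K x) \<le> M * norm x" "\<And>x. norm (L x) \<le> N * norm x"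
    using assms by (metis bounded_clinear_bound)
  then have "norm (K (L x)) \<le> M * N * norm x" for x
    by (metis (no_types, opaque_lifting) mult.assoc mult_le_cancel_left_pos order_trans)
  then show ?thesis
    by (intro bounded_clinearI) (simp_all add: assms bounded_clinear_add bounded_clinear_scaleC)
qed

lemma bounded_clinear_ident: "bounded_clinear (\<lambda>x. x)"
  by (rule bounded_clinearI [where M = 1]) auto

lemma bounded_clinear_funpow: "bounded_clinear K \<Longrightarrow> bounded_clinear (K ^^ m)"
proof (induction m)
  case 0
  then show ?case by (simp add: id_def bounded_clinear_ident)
next
  case (Suc m)
  then show ?case by (simp add: comp_def bounded_clinear_compose)
qed

lemma bounded_clinear_plus:
  assumes "bounded_clinear K" "bounded_clinear L"
  shows "bounded_clinear (\<lambda>x. K x + L x)"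
proof -
  obtain M N where MN: "\<And>x. norm (K x) \<le> M * norm x" "\<And>x. norm (L x) \<le> N * norm x"
    using assms by (metis bounded_clinear_bound)
  have "norm (K x + L x) \<le> (M + N) * norm x" for x
    using norm_triangle_le [OF add_mono [OF MN]] by (simp add: distrib_right)
  then show ?thesis
    by (intro bounded_clinearI) (simp_all add: assms bounded_clinear_add bounded_clinear_scaleC
        scaleC_add_right add_ac)
qed

lemma bounded_clinear_cscale:
  assumes "bounded_clinear K"
  shows "bounded_clinear (\<lambda>x. c *\<^sub>C K x)"
proof -
  obtain M where M: "\<And>x. norm (K x) \<le> M * norm x"
    using assms by (metis bounded_clinear_bound)
  have "norm (c *\<^sub>C K x) \<le> (cmod c * M) * norm x" for x
    using mult_left_mono [OF M, of "cmod c"] by (simp add: norm_scaleC mult.assoc)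
  then show ?thesis
    by (intro bounded_clinearI [where M = "cmod c * M"]) (simp_all add: assms bounded_clinear_add
        bounded_clinear_scaleC scaleC_add_right scaleC_scaleC mult.commute [of _ c])
qed

lemma bounded_clinear_minus:
  assumes "bounded_clinear K" "bounded_clinear L"
  shows "bounded_clinear (\<lambda>x. K x - L x)"
proof -
  have "(\<lambda>x. K x - L x) = (\<lambda>x. K x + (-1) *\<^sub>C L x)"
    by (simp add: fun_eq_iff)
  then show ?thesis
    by (metis assms bounded_clinear_cscale bounded_clinear_plus)
qed

subsection \<open>The Riesz representation theorem and the adjoint\<close>

text \<open>The representing vector of a bounded functional \<open>\<phi>\<close> is the minimiser of
  \<open>\<parallel>x\<parallel>\<^sup>2 - 2 \<phi>(x)\<close>: by the parallelogram law every minimising sequence is Cauchy, and the first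
  variation at the minimum is the representation.\<close>

lemma riesz_representation:
  fixes \<phi> :: "'a::{real_inner, banach} \<Rightarrow> real"
  assumes "bounded_linear \<phi>"
  obtains y where "\<And>x. \<phi> x = inner y x"
proof -
  interpret \<phi>: bounded_linear \<phi> by fact
  obtain M where M: "M > 0" "\<And>x. norm (\<phi> x) \<le> norm x * M"
    using \<phi>.pos_bounded by blast
  define J where "J x = inner x x - 2 * \<phi> x" for x
  have J_bound: "J x \<ge> - M\<^sup>2" for x
  proof -
    have "\<phi> x \<le> M * norm x"
      using M(2) [of x] by (simp add: abs_le_iff mult.commute)
    moreover have "0 \<le> (norm x - M)\<^sup>2"
      by simp
    ultimately show ?thesis
      by (simp add: J_def dot_square_norm power2_diff mult_ac)
  qed
  define m where "m = (INF x. J x)"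
  have bdd: "bdd_below (range J)"
    using J_bound by (meson bdd_belowI2)
  have m: "m \<le> J x" for x
    unfolding m_def by (rule cINF_lower [OF bdd]) simp
  have "\<exists>x. J x < m + inverse (real (Suc n))" for n
    using cINF_less_iff [OF _ bdd, of "m + inverse (real (Suc n))"] by (simp add: m_def)
  then obtain x where x: "\<And>n. J (x n) < m + inverse (real (Suc n))"
    by metis
  have par: "(norm (u - v))\<^sup>2 = 2 * J u + 2 * J v - 4 * J ((1/2) *\<^sub>R (u + v))" for u v
    by (simp add: J_def \<phi>.add \<phi>.scaleR inner_add_left inner_add_right inner_diff_left
        inner_diff_right power2_norm_eq_inner inner_commute [of v u]) (simp add: field_simps)
  have close: "(norm (x i - x j))\<^sup>2 \<le> 4 * inverse (real (Suc N))" if "i \<ge> N" "j \<ge> N" for i j N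
  proof -
    have "inverse (real (Suc i)) \<le> inverse (real (Suc N))" "inverse (real (Suc j)) \<le> inverse (real (Suc N))"
      using that by (auto intro!: le_imp_inverse_le)
    then show ?thesis
      using par [of "x i" "x j"] x [of i] x [of j] m [of "(1/2) *\<^sub>R (x i + x j)"] by linarith
  qed
  have "Cauchy x"
  proof (rule metric_CauchyI)
    fix e :: real
    assume "e > 0"
    then obtain N where N: "inverse (real (Suc N)) < e\<^sup>2 / 4"
      using reals_Archimedean [of "e\<^sup>2 / 4"] by auto
    have "dist (x i) (x j) < e" if "i \<ge> N" "j \<ge> N" for i j
    proof -
      have "(norm (x i - x j))\<^sup>2 < e\<^sup>2"
        using close [OF that] N by linarith
      then show ?thesis
        using \<open>e > 0\<close> by (simp add: dist_norm power_less_imp_less_base)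
    qed
    then show "\<exists>N. \<forall>i\<ge>N. \<forall>j\<ge>N. dist (x i) (x j) < e"
      by blast
  qed
  then obtain y where y: "x \<longlonglongrightarrow> y"
    using convergent_eq_Cauchy [of x] by blast
  have "(\<lambda>n. J (x n)) \<longlonglongrightarrow> J y"
    unfolding J_def by (intro tendsto_intros y \<phi>.tendsto)
  moreover have "(\<lambda>n. m + inverse (real (Suc n))) \<longlonglongrightarrow> m + 0"
    by (intro tendsto_intros LIMSEQ_inverse_real_of_nat)
  ultimately have "J y \<le> m"
    using x by (intro LIMSEQ_le [of _ _ _ "m + 0", simplified]) (auto intro: less_imp_le)
  then have min: "J y \<le> J (y + r *\<^sub>R h)" for r h
    using m order_trans by blast
  have "\<phi> h = inner y h" for h
  proof -
    define a b where "a = inner y h - \<phi> h" and "b = inner h h"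
    have "J (y + r *\<^sub>R h) = J y + 2 * r * a + r\<^sup>2 * b" for r
      by (simp add: J_def a_def b_def \<phi>.add \<phi>.scaleR inner_add_left inner_add_right algebra_simps
          inner_commute [of h y] power2_eq_square)
    then have *: "0 \<le> 2 * r * a + r\<^sup>2 * b" for r
      using min [of r h] by simp
    have "b \<ge> 0"
      by (simp add: b_def)
    have "a = 0"
    proof (rule ccontr)
      assume "a \<noteq> 0"
      have "0 \<le> 2 * (- a / (b + 1)) * a + (- a / (b + 1))\<^sup>2 * b"
        by (rule *)
      also have "\<dots> = - (a\<^sup>2 * (b + 2)) / (b + 1)\<^sup>2"
        using \<open>b \<ge> 0\<close>
        by (simp add: divide_simps power2_eq_square add_nonneg_eq_0_iff) algebra
      also have "\<dots> < 0"
        using \<open>a \<noteq> 0\<close> \<open>b \<ge> 0\<close> by (intro divide_neg_pos) auto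
      finally show False by simp
    qed
    then show ?thesis by (simp add: a_def)
  qed
  then show thesis using that by blast
qed

lemma cinner_functional:
  assumes "bounded_linear \<phi>" "\<And>c x. \<phi> (c *\<^sub>C x) = c * \<phi> x"
  obtains y where "\<And>x::'a::chilbert_space. \<phi> x = cinner y x"
proof -
  have "bounded_linear (\<lambda>x. Re (\<phi> x))"
    using assms(1) bounded_linear_Re bounded_linear_compose by blast
  then obtain y where y: "\<And>x. Re (\<phi> x) = inner y x"
    using riesz_representation by blast
  have "\<phi> x = cinner y x" for x
  proof (rule complex_eqI)
    show "Re (\<phi> x) = Re (cinner y x)"
      using y inner_eq_Re_cinner by metis
    have "Re (\<phi> (\<i> *\<^sub>C x)) = Re (cinner y (\<i> *\<^sub>C x))"
      using y inner_eq_Re_cinner by metis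
    then show "Im (\<phi> x) = Im (cinner y x)"
      by (simp add: assms(2) cinner_scaleC_right)
  qed
  then show thesis using that by blast
qed

text \<open>The adjoint is given by a definite description, so existence (Riesz) and uniqueness have to be
  known before it can be used.\<close>

lemma cinner_cadjoint:
  assumes K: "bounded_clinear K"
  shows "cinner (K x) y = cinner x (cadjoint K y)"
proof -
  have "\<exists>z. \<forall>x. cinner y (K x) = cinner z x" for y
  proof (rule cinner_functional)
    show "bounded_linear (\<lambda>x. cinner y (K x))"
      using bounded_linear_compose [OF cinner.bounded_linear_right
          bounded_clinear_imp_bounded_linear [OF K]] .
  qed (auto simp: K bounded_clinear_scaleC cinner_scaleC_right)
  then obtain L where "\<And>x y. cinner y (K x) = cinner (L y) x"
    by metis
  then have L: "\<forall>x y. cinner (K x) y = cinner x (L y)"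
    by (metis cinner_commute)
  have "\<forall>x y. cinner (K x) y = cinner x (cadjoint K y)"
    unfolding cadjoint_def
  proof (rule theI [of _ L])
    show "L' = L" if "\<forall>x y. cinner (K x) y = cinner x (L' y)" for L'
    proof
      show "L' y = L y" for y
        by (rule cinner_eqI) (metis L that)
    qed
  qed (rule L)
  then show ?thesis by simp
qed

lemma cinner_cadjoint': "bounded_clinear K \<Longrightarrow> cinner (cadjoint K x) y = cinner x (K y)"
  by (metis cinner_cadjoint cinner_commute)

text \<open>Test \<open>\<parallel>K\<^sup>* y\<parallel>\<^sup>2 = \<langle>K K\<^sup>* y, y\<rangle>\<close>.\<close>

lemma norm_cadjoint_le:
  assumes "bounded_clinear K" "M \<ge> 0" "\<And>x. norm (K x) \<le> M * norm x"
  shows "norm (cadjoint K y) \<le> M * norm y"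
proof (cases "cadjoint K y = 0")
  case False
  have "norm (cadjoint K y) * norm (cadjoint K y) = cmod (cinner (K (cadjoint K y)) y)"
    by (simp add: cinner_cadjoint assms(1) cinner_self power2_eq_square norm_mult)
  also have "\<dots> \<le> norm (K (cadjoint K y)) * norm y"
    by (rule cmod_cinner_le)
  also have "\<dots> \<le> (M * norm (cadjoint K y)) * norm y"
    by (intro mult_right_mono assms) auto
  finally show ?thesis
    using False by (simp add: mult.commute mult.left_commute)
qed (use assms in simp)

lemma bounded_clinear_cadjoint:
  assumes "bounded_clinear K"
  shows "bounded_clinear (cadjoint K)"
proof -
  obtain M where M: "M > 0" "\<And>x. norm (K x) \<le> M * norm x"
    using bounded_clinear_bound [OF assms] by blast
  show ?thesis
  proof (rule bounded_clinearI [where M = M])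
    show "norm (cadjoint K x) \<le> M * norm x" for x
      using norm_cadjoint_le [OF assms] M by simp
    show "cadjoint K (x + y) = cadjoint K x + cadjoint K y" for x y
      by (rule cinner_eqI) (simp add: cinner_cadjoint [OF assms, symmetric] cinner_add_right)
    show "cadjoint K (c *\<^sub>C x) = c *\<^sub>C cadjoint K x" for c x
      by (rule cinner_eqI) (simp add: cinner_cadjoint [OF assms, symmetric] cinner_scaleC_right)
  qed
qed

section \<open>Orthonormal sets and operators of finite rank\<close>

declare cinner.zero_left [simp] cinner.zero_right [simp]
  scaleC.zero_left [simp] scaleC.zero_right [simp]

definition orthonormal :: "'a::chilbert_space set \<Rightarrow> bool"
  where "orthonormal B \<longleftrightarrow> (\<forall>u\<in>B. \<forall>v\<in>B. cinner u v = (if u = v then 1 else 0))"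

definition oproj :: "'a::chilbert_space set \<Rightarrow> 'a \<Rightarrow> 'a"
  where "oproj B x = (\<Sum>b\<in>B. cinner b x *\<^sub>C b)"

lemma orthonormal_norm: "orthonormal B \<Longrightarrow> b \<in> B \<Longrightarrow> norm b = 1"
proof -
  assume "orthonormal B" "b \<in> B"
  then have "complex_of_real ((norm b)\<^sup>2) = 1"
    unfolding cinner_self [symmetric] by (simp add: orthonormal_def)
  then have "(norm b)\<^sup>2 = 1"
    using of_real_eq_1_iff by blast
  then show "norm b = 1"
    by (simp add: abs_square_eq_1)
qed

lemma orthonormal_insert:
  assumes "orthonormal B" "norm a = 1" "\<And>b. b \<in> B \<Longrightarrow> cinner b a = 0"
  shows "orthonormal (insert a B)"
  using assms unfolding orthonormal_def
  by (force simp: cinner_self cinner_eq_0_commute [of a])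

lemma orthonormal_image:
  assumes "\<And>i j. i \<in> I \<Longrightarrow> j \<in> I \<Longrightarrow> cinner (f i) (f j) = (if i = j then 1 else 0)"
  shows "orthonormal (f ` I)" "inj_on f I"
proof -
  show "inj_on f I"
    using assms by (intro inj_onI) (metis zero_neq_one)
  then show "orthonormal (f ` I)"
    using assms unfolding orthonormal_def by (auto simp: inj_on_def)
qed

lemma pythagoras:
  assumes "cinner u v = 0"
  shows "(norm (u + v))\<^sup>2 = (norm u)\<^sup>2 + (norm (v::'a::chilbert_space))\<^sup>2"
proof -
  have "inner u v = 0"
    by (simp add: inner_eq_Re_cinner assms)
  then show ?thesis
    by (simp add: power2_norm_eq_inner inner_add_left inner_add_right inner_commute [of v u])
qed

context
  fixes B :: "'a::chilbert_space set"
  assumes fin: "finite B" and on: "orthonormal B"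
begin

lemma cinner_oproj: "cinner (oproj B x) y = (\<Sum>b\<in>B. cnj (cinner b x) * cinner b y)"
  by (simp add: oproj_def cinner.sum_left cinner_scaleC_left)

lemma cinner_basis_oproj:
  assumes "b \<in> B"
  shows "cinner b (oproj B x) = cinner b x"
proof -
  have "cinner b (oproj B x) = (\<Sum>c\<in>B. cinner c x * cinner b c)"
    by (simp add: oproj_def cinner.sum_right cinner_scaleC_right)
  also have "\<dots> = (\<Sum>c\<in>B. if c = b then cinner b x else 0)"
    using on assms by (intro sum.cong) (auto simp: orthonormal_def)
  also have "\<dots> = cinner b x"
    using assms fin by simp
  finally show ?thesis .
qed

lemma oproj_residual_orthogonal: "b \<in> B \<Longrightarrow> cinner b (x - oproj B x) = 0"
  by (simp add: cinner.diff_right cinner_basis_oproj)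

lemma oproj_in_span: "oproj B x \<in> complex_vector.span B"
  unfolding oproj_def
  by (intro complex_vector.span_sum complex_vector.span_scale complex_vector.span_base)

lemma norm_oproj_residual: "(norm x)\<^sup>2 = (\<Sum>b\<in>B. (cmod (cinner b x))\<^sup>2) + (norm (x - oproj B x))\<^sup>2"
proof -
  have "cinner (oproj B x) (oproj B x) = (\<Sum>b\<in>B. complex_of_real ((cmod (cinner b x))\<^sup>2))"
    unfolding cinner_oproj
    by (intro sum.cong refl)
      (simp add: cinner_basis_oproj complex_norm_square mult.commute del: of_real_power)
  then have "complex_of_real ((norm (oproj B x))\<^sup>2) = of_real (\<Sum>b\<in>B. (cmod (cinner b x))\<^sup>2)"
    by (simp add: cinner_self)
  then have "(norm (oproj B x))\<^sup>2 = (\<Sum>b\<in>B. (cmod (cinner b x))\<^sup>2)"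
    using of_real_eq_iff by blast
  moreover have "cinner (oproj B x) (x - oproj B x) = 0"
    by (simp add: cinner_oproj oproj_residual_orthogonal)
  ultimately show ?thesis
    using pythagoras [of "oproj B x" "x - oproj B x"] by simp
qed

lemma bessel_inequality: "(\<Sum>b\<in>B. (cmod (cinner b x))\<^sup>2) \<le> (norm x)\<^sup>2"
proof -
  have "0 \<le> (norm (x - oproj B x))\<^sup>2"
    by simp
  then show ?thesis
    using norm_oproj_residual [of x] by linarith
qed

lemma norm_oproj_residual_le: "norm (x - oproj B x) \<le> norm x"
proof (rule power2_le_imp_le)
  have "0 \<le> (\<Sum>b\<in>B. (cmod (cinner b x))\<^sup>2)"
    by (intro sum_nonneg) simp
  then show "(norm (x - oproj B x))\<^sup>2 \<le> (norm x)\<^sup>2"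
    using norm_oproj_residual [of x] by linarith
qed simp

lemma bounded_clinear_oproj: "bounded_clinear (oproj B)"
proof (rule bounded_clinearI [where M = 2])
  show "norm (oproj B x) \<le> 2 * norm x" for x
    using norm_oproj_residual_le [of x] norm_triangle_ineq2 [of "oproj B x" x]
    by (simp add: norm_minus_commute)
qed (simp_all add: oproj_def cinner_add_right cinner_scaleC_right scaleC_add_left sum.distrib
    scaleC_scaleC scaleC.sum_right)

end

lemma orthogonal_span:
  assumes "\<And>b. b \<in> B \<Longrightarrow> cinner b x = 0" "v \<in> complex_vector.span B"
  shows "cinner v (x::'a::chilbert_space) = 0"
  using assms(2)
  by (induction rule: complex_vector.span_induct_alt)
    (auto simp: cinner_add_left cinner_scaleC_left assms(1))

lemma oproj_eq_self:
  assumes "finite B" "orthonormal B" "v \<in> complex_vector.span B"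
  shows "oproj B v = v"
proof -
  have "cinner (v - oproj B v) (v - oproj B v) = 0"
  proof (rule orthogonal_span [of B])
    show "cinner b (v - oproj B v) = 0" if "b \<in> B" for b
      using assms that by (intro oproj_residual_orthogonal)
    show "v - oproj B v \<in> complex_vector.span B"
      using assms by (intro complex_vector.span_diff oproj_in_span)
  qed
  then show ?thesis
    by (simp add: cinner_self)
qed

lemma orthonormal_independent:
  assumes "orthonormal B"
  shows "complex_vector.independent B"
proof
  assume "complex_vector.dependent B"
  then obtain a where a: "a \<in> B" "a \<in> complex_vector.span (B - {a})"
    unfolding complex_vector.dependent_def by blast
  have "cinner a a = 0"
  proof (rule orthogonal_span)
    show "a \<in> complex_vector.span (B - {a})"
      by (fact a)
    show "cinner b a = 0" if "b \<in> B - {a}" for b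
      using that a assms by (auto simp: orthonormal_def)
  qed
  then show False
    using a assms by (simp add: orthonormal_def)
qed

text \<open>The cardinality is only bounded, because vectors depending on their predecessors are dropped.\<close>

lemma gram_schmidt:
  assumes "finite (S :: 'a::chilbert_space set)"
  obtains B where "finite B" "orthonormal B" "card B \<le> card S"
    "complex_vector.span B = complex_vector.span S"
proof -
  have "\<exists>B. finite B \<and> orthonormal B \<and> card B \<le> card S \<and>
      complex_vector.span B = complex_vector.span S"
    using assms
  proof (induction S rule: finite_induct)
    case empty
    then show ?case by (intro exI [of _ "{}"]) (simp add: orthonormal_def)
  next
    case (insert a S)
    then obtain B where B: "finite B" "orthonormal B" "card B \<le> card S"
        "complex_vector.span B = complex_vector.span S"
      by blast
    define r where "r = a - oproj B a"
    have span: "complex_vector.span (insert r B) = complex_vector.span (insert a S)"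
      using complex_vector.eq_span_insert_eq [of a r B] oproj_in_span [OF B(1,2)]
        complex_vector.span_Un [of "{a}" B] complex_vector.span_Un [of "{a}" S] B(4)
      by (simp add: r_def)
    show ?case
    proof (cases "r = 0")
      case True
      then have "complex_vector.span B = complex_vector.span (insert a S)"
        using span by simp
      then show ?thesis
        using B insert.hyps by (intro exI [of _ B]) auto
    next
      case False
      define u where "u = complex_of_real (inverse (norm r)) *\<^sub>C r"
      have "norm u = 1" "\<And>b. b \<in> B \<Longrightarrow> cinner b u = 0"
        using False B oproj_residual_orthogonal [OF B(1,2)]
        by (simp_all add: u_def norm_scaleC norm_inverse cinner_scaleC_right r_def)
      then have "orthonormal (insert u B)"
        using B by (intro orthonormal_insert)
      moreover have "complex_vector.span (insert u B) = complex_vector.span (insert r B)"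
      proof -
        have "u \<in> complex_vector.span (insert r B)"
          by (simp add: u_def complex_vector.span_scale complex_vector.span_base)
        moreover have "r = complex_of_real (norm r) *\<^sub>C u"
          using False by (simp add: u_def scaleC_scaleC flip: of_real_mult)
        then have "r \<in> complex_vector.span (insert u B)"
          by (metis complex_vector.span_scale complex_vector.span_base insertI1)
        ultimately show ?thesis
          unfolding complex_vector.span_eq
          by (auto intro: complex_vector.span_base)
      qed
      moreover have "card (insert u B) \<le> card (insert a S)"
        using B insert.hyps by (simp add: card_insert_if)
      ultimately show ?thesis
        using B span by (intro exI [of _ "insert u B"]) auto
    qed
  qed
  then show thesis using that by blast
qed

text \<open>Bessel systems, unlike orthonormal systems, are mapped to Bessel systems by contractions; this
  is what makes the ideal property of the Schatten classes immediate below.\<close>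

definition bessel :: "nat \<Rightarrow> (nat \<Rightarrow> 'a::chilbert_space) \<Rightarrow> bool"
  where "bessel n e \<longleftrightarrow> (\<forall>x. (\<Sum>i<n. (cmod (cinner (e i) x))\<^sup>2) \<le> (norm x)\<^sup>2)"

lemma bessel_sum_le: "bessel n e \<Longrightarrow> (\<Sum>i<n. (cmod (cinner (e i) x))\<^sup>2) \<le> (norm x)\<^sup>2"
  by (simp add: bessel_def)

lemma bessel_norm_le:
  assumes "bessel n e" "i < n"
  shows "norm (e i) \<le> 1"
proof (cases "e i = 0")
  case False
  have "(cmod (cinner (e i) (e i)))\<^sup>2 \<le> (\<Sum>j<n. (cmod (cinner (e j) (e i)))\<^sup>2)"
    using assms(2) by (intro member_le_sum) auto
  also have "\<dots> \<le> (norm (e i))\<^sup>2"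
    by (rule bessel_sum_le [OF assms(1)])
  finally have "(cmod (cinner (e i) (e i)))\<^sup>2 \<le> (norm (e i))\<^sup>2" .
  moreover have "cmod (cinner (e i) (e i)) = (norm (e i))\<^sup>2"
    unfolding cinner_self norm_of_real by simp
  ultimately have "(norm (e i))\<^sup>2 * (norm (e i))\<^sup>2 \<le> (norm (e i))\<^sup>2 * 1"
    by (metis mult.right_neutral power2_eq_square)
  moreover have "(norm (e i))\<^sup>2 > 0"
    using False by simp
  ultimately have "(norm (e i))\<^sup>2 \<le> 1\<^sup>2"
    unfolding one_power2 by (rule mult_left_le_imp_le)
  then show ?thesis
    by (rule power2_le_imp_le) simp
qed simp

lemma bessel_orthonormal:
  assumes "orthonormal B" "finite B" "inj_on e {..<n}" "e ` {..<n} \<subseteq> B"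
  shows "bessel n e"
  unfolding bessel_def
proof
  fix x
  have "(\<Sum>i<n. (cmod (cinner (e i) x))\<^sup>2) = (\<Sum>b\<in>e ` {..<n}. (cmod (cinner b x))\<^sup>2)"
    by (simp add: sum.reindex assms(3))
  also have "\<dots> \<le> (\<Sum>b\<in>B. (cmod (cinner b x))\<^sup>2)"
    using assms by (intro sum_mono2) auto
  also have "\<dots> \<le> (norm x)\<^sup>2"
    using assms by (intro bessel_inequality)
  finally show "(\<Sum>i<n. (cmod (cinner (e i) x))\<^sup>2) \<le> (norm x)\<^sup>2" .
qed

text \<open>Spanning sets rather than dimensions make the rank subadditive for free.\<close>

definition rank_le :: "nat \<Rightarrow> ('a::chilbert_space \<Rightarrow> 'a) \<Rightarrow> bool"
  where "rank_le N L \<longleftrightarrow> (\<exists>B. finite B \<and> card B \<le> N \<and> range L \<subseteq> complex_vector.span B)"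

lemma rank_le_orthonormal:
  assumes "rank_le N L"
  obtains B where "finite B" "orthonormal B" "card B \<le> N" "\<And>x. oproj B (L x) = L x"
proof -
  obtain S where S: "finite S" "card S \<le> N" "range L \<subseteq> complex_vector.span S"
    using assms unfolding rank_le_def by blast
  obtain B where B: "finite B" "orthonormal B" "card B \<le> card S"
      "complex_vector.span B = complex_vector.span S"
    using gram_schmidt [OF S(1)] by blast
  show thesis
  proof (rule that)
    show "oproj B (L x) = L x" for x
      using B S(3) by (intro oproj_eq_self) auto
  qed (use B S in auto)
qed

lemma rank_le_plus:
  assumes "rank_le M K" "rank_le N L"
  shows "rank_le (M + N) (\<lambda>x. K x + L x)"
proof -
  obtain B C where B: "finite B" "card B \<le> M" "range K \<subseteq> complex_vector.span B"
    and C: "finite C" "card C \<le> N" "range L \<subseteq> complex_vector.span C"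
    using assms unfolding rank_le_def by blast
  have "K x + L x \<in> complex_vector.span (B \<union> C)" for x
    using B(3) C(3) complex_vector.span_mono [of B "B \<union> C"] complex_vector.span_mono [of C "B \<union> C"]
    by (intro complex_vector.span_add) auto
  then show ?thesis
    unfolding rank_le_def using B C card_Un_le [of B C] by (intro exI [of _ "B \<union> C"]) auto
qed

lemma rank_le_compose_left:
  assumes "rank_le N L" "bounded_clinear K"
  shows "rank_le N (\<lambda>x. K (L x))"
proof -
  obtain B where B: "finite B" "card B \<le> N" "range L \<subseteq> complex_vector.span B"
    using assms unfolding rank_le_def by blast
  have "K v \<in> complex_vector.span (K ` B)" if "v \<in> complex_vector.span B" for v
    using that
  proof (induction rule: complex_vector.span_induct_alt)
    case base
    then show ?case by (simp add: bounded_clinear_0 assms complex_vector.span_zero)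
  next
    case (step c x y)
    then show ?case
      by (simp add: bounded_clinear_add bounded_clinear_scaleC assms complex_vector.span_add
          complex_vector.span_scale complex_vector.span_base)
  qed
  then show ?thesis
    unfolding rank_le_def using B card_image_le [of B K] by (intro exI [of _ "K ` B"]) auto
qed

lemma rank_le_compose_right: "rank_le N L \<Longrightarrow> rank_le N (\<lambda>x. L (K x))"
  unfolding rank_le_def by blast

lemma rank_le_mono: "rank_le M L \<Longrightarrow> M \<le> N \<Longrightarrow> rank_le N L"
  unfolding rank_le_def by (meson le_trans)

lemma rank_le_minus:
  assumes "rank_le M K" "rank_le N L"
  shows "rank_le (M + N) (\<lambda>x. K x - L x)"
proof -
  have "rank_le N (\<lambda>x. (-1) *\<^sub>C L x)"
    using rank_le_compose_left [OF assms(2) bounded_clinear_cscale [OF bounded_clinear_ident]] .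
  then have "rank_le (M + N) (\<lambda>x. K x + (-1) *\<^sub>C L x)"
    by (rule rank_le_plus [OF assms(1)])
  then show ?thesis by simp
qed

section \<open>Schatten bounds on Bessel systems\<close>

text \<open>For \<open>q \<ge> 1\<close> and \<open>C \<ge> 0\<close> this turns out to mean \<open>\<parallel>K\<parallel>\<^sub>q \<le> C\<close>.\<close>

definition schatten_bound :: "real \<Rightarrow> real \<Rightarrow> ('a::chilbert_space \<Rightarrow> 'a) \<Rightarrow> bool"
  where "schatten_bound q C K \<longleftrightarrow>
    (\<forall>n e f. bessel n e \<longrightarrow> bessel n f \<longrightarrow>
      (\<Sum>i<n. cmod (cinner (f i) (K (e i))) powr q) \<le> C powr q)"

lemma schatten_boundD:
  "schatten_bound q C K \<Longrightarrow> bessel n e \<Longrightarrow> bessel n f \<Longrightarrow>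
    (\<Sum>i<n. cmod (cinner (f i) (K (e i))) powr q) \<le> C powr q"
  by (simp add: schatten_bound_def)

lemma schatten_bound_mono:
  assumes "schatten_bound q C K" "0 \<le> C" "C \<le> D" "q > 0"
  shows "schatten_bound q D K"
  using assms powr_mono2 [of q C D] unfolding schatten_bound_def by (meson less_imp_le order_trans)

lemma bessel_single: "norm u \<le> 1 \<Longrightarrow> bessel 1 (\<lambda>_. u)"
  unfolding bessel_def
proof
  fix x
  assume u: "norm u \<le> 1"
  have "cmod (cinner u x) \<le> norm u * norm x"
    by (rule cmod_cinner_le)
  also have "\<dots> \<le> norm x"
    using mult_right_mono [OF u, of "norm x"] by simp
  finally show "(\<Sum>i<(1::nat). (cmod (cinner u x))\<^sup>2) \<le> (norm x)\<^sup>2"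
    by (simp add: power_mono)
qed

text \<open>Systems of a single pair of unit vectors, namely \<open>x\<close> and \<open>K x\<close> normalised.\<close>

lemma schatten_bound_norm_le:
  assumes "schatten_bound q C K" "bounded_clinear K" "0 \<le> C" "q > 0"
  shows "norm (K x) \<le> C * norm x"
proof (cases "K x = 0")
  case False
  then have x: "x \<noteq> 0"
    using bounded_clinear_0 [OF assms(2)] by blast
  define u where "u = inverse (norm x) *\<^sub>R x"
  define v where "v = inverse (norm (K x)) *\<^sub>R K x"
  have "norm u \<le> 1" "norm v \<le> 1"
    using x False by (simp_all add: u_def v_def)
  then have "bessel 1 (\<lambda>_. u)" "bessel 1 (\<lambda>_. v)"
    by (auto intro!: bessel_single simp del: One_nat_def)
  then have *: "(\<Sum>i<(1::nat). cmod (cinner v (K u)) powr q) \<le> C powr q"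
    by (rule schatten_boundD [OF assms(1)])
  have "cinner v (K u) =
      complex_of_real (inverse (norm (K x)) * inverse (norm x) * (norm (K x))\<^sup>2)"
    by (simp add: u_def v_def bounded_clinear_scaleR [OF assms(2)] cinner_scaleR_left
        cinner_scaleR_right cinner_self scaleR_conv_of_real [where 'a=complex])
  also have "\<dots> = complex_of_real (norm (K x) / norm x)"
    using False by (simp add: power2_eq_square divide_inverse)
  finally have "cmod (cinner v (K u)) = norm (K x) / norm x"
    by (metis norm_of_real abs_of_nonneg divide_nonneg_nonneg norm_ge_zero)
  then have "(norm (K x) / norm x) powr q \<le> C powr q"
    using * by simp
  then have "norm (K x) / norm x \<le> C"
    using powr_less_mono2 [OF assms(4,3), of "norm (K x) / norm x"] by linarith
  then show ?thesis
    using x by (simp add: divide_le_eq)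
qed (use assms in simp)

text \<open>Moving \<open>L\<close> to the other side, \<open>\<Sum> \<bar>\<langle>L e\<^sub>i, x\<rangle>\<bar>\<^sup>2 = \<Sum> \<bar>\<langle>e\<^sub>i, L\<^sup>* x\<rangle>\<bar>\<^sup>2\<close>.\<close>

lemma bessel_contraction:
  assumes "bessel n e" "bounded_clinear L" "M > 0" "\<And>x. norm (L x) \<le> M * norm x"
  shows "bessel n (\<lambda>i. inverse M *\<^sub>R L (e i))"
  unfolding bessel_def
proof
  fix x
  have "cinner (inverse M *\<^sub>R L (e i)) x = cinner (e i) (inverse M *\<^sub>R cadjoint L x)" for i
    by (simp add: cinner_scaleR_left cinner_scaleR_right cinner_cadjoint assms(2))
  then have "(\<Sum>i<n. (cmod (cinner (inverse M *\<^sub>R L (e i)) x))\<^sup>2)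
      \<le> (norm (inverse M *\<^sub>R cadjoint L x))\<^sup>2"
    using bessel_sum_le [OF assms(1)] by presburger
  also have "norm (inverse M *\<^sub>R cadjoint L x) \<le> norm x"
    using norm_cadjoint_le [OF assms(2) _ assms(4), of x] assms(3)
    by (simp add: field_simps)
  then have "(norm (inverse M *\<^sub>R cadjoint L x))\<^sup>2 \<le> (norm x)\<^sup>2"
    by (intro power_mono) auto
  finally show "(\<Sum>i<n. (cmod (cinner (inverse M *\<^sub>R L (e i)) x))\<^sup>2) \<le> (norm x)\<^sup>2" .
qed

text \<open>The ideal property: the adjoint of the bounded factor is absorbed into the Bessel system \<open>f\<close>, or
  in the following lemma the factor itself into \<open>e\<close>.\<close>

lemma schatten_bound_compose_left:
  assumes K: "schatten_bound q C K" and L: "bounded_clinear L"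
    and M: "M > 0" "\<And>x. norm (L x) \<le> M * norm x" and "0 \<le> C"
  shows "schatten_bound q (M * C) (\<lambda>x. L (K x))"
  unfolding schatten_bound_def
proof (intro allI impI)
  fix n and e f :: "nat \<Rightarrow> 'a"
  assume e: "bessel n e" and f: "bessel n f"
  define f' where "f' i = inverse M *\<^sub>R cadjoint L (f i)" for i
  have f': "bessel n f'"
    unfolding f'_def
    using norm_cadjoint_le [OF L _ M(2)] M(1)
    by (intro bessel_contraction [OF f bounded_clinear_cadjoint [OF L]]) auto
  have "cinner (f i) (L (K (e i))) = M *\<^sub>R cinner (f' i) (K (e i))" for i
    using M(1) by (simp add: f'_def cinner_scaleR_left cinner_cadjoint' [OF L])
  then have "cmod (cinner (f i) (L (K (e i)))) powr q = M powr q * cmod (cinner (f' i) (K (e i))) powr q" for i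
    using M(1) by (simp add: powr_mult)
  then have "(\<Sum>i<n. cmod (cinner (f i) (L (K (e i)))) powr q) =
      M powr q * (\<Sum>i<n. cmod (cinner (f' i) (K (e i))) powr q)"
    by (simp add: sum_distrib_left)
  also have "\<dots> \<le> M powr q * C powr q"
    by (intro mult_left_mono schatten_boundD [OF K e f']) simp
  also have "\<dots> = (M * C) powr q"
    using M assms by (simp add: powr_mult)
  finally show "(\<Sum>i<n. cmod (cinner (f i) (L (K (e i)))) powr q) \<le> (M * C) powr q" .
qed

lemma schatten_bound_compose_right:
  assumes K: "schatten_bound q C K" "bounded_clinear K" and L: "bounded_clinear L"
    and M: "M > 0" "\<And>x. norm (L x) \<le> M * norm x" and "0 \<le> C"
  shows "schatten_bound q (M * C) (\<lambda>x. K (L x))"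
  unfolding schatten_bound_def
proof (intro allI impI)
  fix n and e f :: "nat \<Rightarrow> 'a"
  assume e: "bessel n e" and f: "bessel n f"
  define e' where "e' i = inverse M *\<^sub>R L (e i)" for i
  have e': "bessel n e'"
    unfolding e'_def by (rule bessel_contraction [OF e L M])
  have "cinner (f i) (K (L (e i))) = M *\<^sub>R cinner (f i) (K (e' i))" for i
    using M(1) by (simp add: e'_def bounded_clinear_scaleR [OF K(2)] cinner_scaleR_right)
  then have "cmod (cinner (f i) (K (L (e i)))) powr q = M powr q * cmod (cinner (f i) (K (e' i))) powr q" for i
    using M(1) by (simp add: powr_mult)
  then have "(\<Sum>i<n. cmod (cinner (f i) (K (L (e i)))) powr q) =
      M powr q * (\<Sum>i<n. cmod (cinner (f i) (K (e' i))) powr q)"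
    by (simp add: sum_distrib_left)
  also have "\<dots> \<le> M powr q * C powr q"
    by (intro mult_left_mono schatten_boundD [OF K(1) e' f]) simp
  also have "\<dots> = (M * C) powr q"
    using M assms by (simp add: powr_mult)
  finally show "(\<Sum>i<n. cmod (cinner (f i) (K (L (e i)))) powr q) \<le> (M * C) powr q" .
qed

text \<open>A quasi-triangle inequality with a crude constant; Minkowski's inequality would give
  \<open>C + D\<close>.\<close>

lemma schatten_bound_plus:
  assumes K: "schatten_bound q C K" and L: "schatten_bound q D L" and "q \<ge> 1" "0 \<le> C" "0 \<le> D"
  shows "schatten_bound q (4 * (C + D)) (\<lambda>x. K x + L x)"
  unfolding schatten_bound_def
proof (intro allI impI)
  fix n and e f :: "nat \<Rightarrow> 'a"
  assume ef: "bessel n e" "bessel n f"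
  have quasi: "cmod (a + b) powr q \<le> 2 powr q * (cmod a powr q + cmod b powr q)" for a b
  proof -
    have "cmod (a + b) \<le> 2 * max (cmod a) (cmod b)"
      using norm_triangle_ineq [of a b] by (simp add: max_def)
    then have "cmod (a + b) powr q \<le> 2 powr q * max (cmod a) (cmod b) powr q"
      using \<open>q \<ge> 1\<close> powr_mono2 [of q "cmod (a + b)"] by (simp flip: powr_mult)
    also have "max (cmod a) (cmod b) powr q \<le> cmod a powr q + cmod b powr q"
      by (simp add: max_def)
    finally show ?thesis by simp
  qed
  have "(\<Sum>i<n. cmod (cinner (f i) (K (e i) + L (e i))) powr q)
      \<le> (\<Sum>i<n. 2 powr q * (cmod (cinner (f i) (K (e i))) powr q + cmod (cinner (f i) (L (e i))) powr q))"
    by (intro sum_mono) (simp add: cinner_add_right quasi)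
  also have "\<dots> = 2 powr q * ((\<Sum>i<n. cmod (cinner (f i) (K (e i))) powr q)
      + (\<Sum>i<n. cmod (cinner (f i) (L (e i))) powr q))"
    by (simp add: sum_distrib_left sum.distrib distrib_left)
  also have "\<dots> \<le> 2 powr q * (C powr q + D powr q)"
    by (intro mult_left_mono add_mono schatten_boundD [OF K ef] schatten_boundD [OF L ef]) simp
  also have "\<dots> \<le> 2 powr q * (2 * (C + D) powr q)"
    using assms powr_mono2 [of q C "C + D"] powr_mono2 [of q D "C + D"] by simp
  also have "\<dots> \<le> 2 powr q * (2 powr q * (C + D) powr q)"
    using powr_mono [of 1 q 2] \<open>q \<ge> 1\<close> by (intro mult_left_mono mult_right_mono) auto
  also have "\<dots> = (4 * (C + D)) powr q"
  proof -
    have "4 * (C + D) = 2 * (2 * (C + D))"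
      by simp
    then show ?thesis
      using assms by (simp only: powr_mult mult_nonneg_nonneg add_nonneg_nonneg zero_le_numeral)
  qed
  finally show "(\<Sum>i<n. cmod (cinner (f i) (K (e i) + L (e i))) powr q) \<le> (4 * (C + D)) powr q" .
qed

lemma powr_minus_one_mult: "(a::real) \<ge> 0 \<Longrightarrow> a powr q = a powr (q - 1) * a"
  by (cases "a = 0") (simp_all add: powr_diff)

text \<open>The inclusion \<open>\<C>\<^sub>1 \<subseteq> \<C>\<^sub>q\<close>: each term is at most \<open>C\<close>, and \<open>a\<^sup>q \<le> C\<^bsup>q-1\<^esup> a\<close> for \<open>0 \<le> a \<le> C\<close>.\<close>

lemma schatten_bound_exponent_mono:
  assumes K: "schatten_bound 1 C K" "bounded_clinear K" and "q \<ge> 1" "0 \<le> C"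
  shows "schatten_bound q C K"
  unfolding schatten_bound_def
proof (intro allI impI)
  fix n and e f :: "nat \<Rightarrow> 'a"
  assume e: "bessel n e" and f: "bessel n f"
  have le: "cmod (cinner (f i) (K (e i))) \<le> C" if "i < n" for i
  proof -
    have "cmod (cinner (f i) (K (e i))) \<le> norm (f i) * norm (K (e i))"
      by (rule cmod_cinner_le)
    also have "\<dots> \<le> 1 * (C * 1)"
      using schatten_bound_norm_le [OF K \<open>0 \<le> C\<close>, of "e i"] bessel_norm_le [OF e that]
        bessel_norm_le [OF f that] \<open>0 \<le> C\<close> mult_left_mono [of "norm (e i)" 1 C]
      by (intro mult_mono) auto
    finally show ?thesis by simp
  qed
  have "(\<Sum>i<n. cmod (cinner (f i) (K (e i))) powr q)
      \<le> (\<Sum>i<n. C powr (q - 1) * cmod (cinner (f i) (K (e i))))"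
    using le \<open>q \<ge> 1\<close> by (intro sum_mono) (auto simp: powr_minus_one_mult [of _ q] intro!: mult_right_mono powr_mono2)
  also have "\<dots> = C powr (q - 1) * (\<Sum>i<n. cmod (cinner (f i) (K (e i))) powr 1)"
    by (simp add: sum_distrib_left)
  also have "\<dots> \<le> C powr (q - 1) * C powr 1"
    by (intro mult_left_mono schatten_boundD [OF K(1) e f]) simp
  also have "\<dots> = C powr q"
    using \<open>0 \<le> C\<close> by (simp add: powr_minus_one_mult [of _ q])
  finally show "(\<Sum>i<n. cmod (cinner (f i) (K (e i))) powr q) \<le> C powr q" .
qed

text \<open>The graph of a convex function lies above its tangents; for powers this is Young's inequality.\<close>

lemma powr_tangent:
  assumes "q \<ge> 1" "a \<ge> 0" "b \<ge> (0::real)"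
  shows "b powr q + q * b powr (q - 1) * (a - b) \<le> a powr q"
proof -
  consider "a = 0" | "b = 0" | "a > 0" "b > 0"
    using assms by linarith
  then show ?thesis
  proof cases
    case 1
    then show ?thesis
      using assms powr_minus_one_mult [of b q] mult_right_mono [of 1 q "b powr q"] by (simp add: algebra_simps)
  next
    case 2
    then show ?thesis by simp
  next
    case 3
    have "(a powr q) powr (1/q) * (b powr q) powr (1 - 1/q) \<le> (1/q) * a powr q + (1 - 1/q) * b powr q"
      using 3 assms by (intro Youngs_inequality_0) auto
    also have "(a powr q) powr (1/q) * (b powr q) powr (1 - 1/q) = a * b powr (q - 1)"
      using 3 assms by (simp add: powr_powr right_diff_distrib)
    finally have "q * (a * b powr (q - 1)) \<le> q * ((1/q) * a powr q + (1 - 1/q) * b powr q)"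
      using assms by (intro mult_left_mono) auto
    also have "\<dots> = a powr q + (q - 1) * b powr q"
      using assms by (simp add: field_simps)
    finally show ?thesis
      using powr_minus_one_mult [of b q] 3 by (simp add: algebra_simps)
  qed
qed

text \<open>The integral form of the triangle inequality, \<open>\<parallel>\<integral> P\<parallel>\<^sub>q \<le> \<integral> \<parallel>P\<parallel>\<^sub>q\<close>.  With \<open>z\<^sub>i = \<integral> \<phi>\<^sub>i\<close> denoting the
  pairings of the integral, the \<open>q\<close>-th powers of \<open>\<bar>\<phi>\<^sub>i\<bar> / g\<close> are replaced by their tangents at
  \<open>\<bar>z\<^sub>i\<bar> / G\<close>.  The resulting pointwise inequality is linear in \<open>\<phi>\<close> and \<open>g\<close>, so it can be integrated.\<close>

lemma schatten_bound_integral: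
  fixes P :: "real \<Rightarrow> 'a::chilbert_space \<Rightarrow> 'a"
  assumes q: "q \<ge> 1"
    and P: "\<And>s. 0 < s \<Longrightarrow> s \<le> t \<Longrightarrow> schatten_bound q (g s) (P s)"
    and g: "\<And>s. 0 < s \<Longrightarrow> s \<le> t \<Longrightarrow> 0 \<le> g s" "(g has_integral I) {0..t}" "I \<le> G" "0 < G"
    and K: "\<And>x. ((\<lambda>s. P s x) has_integral K x) {0..t}"
  shows "schatten_bound q G K"
  unfolding schatten_bound_def
proof (intro allI impI)
  fix n and e f :: "nat \<Rightarrow> 'a"
  assume e: "bessel n e" and f: "bessel n f"
  define z where "z i = cinner (f i) (K (e i))" for i
  \<comment> \<open>The phases that make \<open>c\<^sub>i z\<^sub>i\<close> equal to \<open>\<bar>z\<^sub>i\<bar>\<close>.\<close>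
  define c where "c i = cnj (sgn (z i))" for i
  define \<phi> where "\<phi> s i = cinner (f i) (P s (e i))" for s i
  define b where "b i = cmod (z i) / G" for i
  define \<beta> where "\<beta> = (\<Sum>i<n. b i powr q)"
  have b: "b i \<ge> 0" for i
    using \<open>0 < G\<close> by (simp add: b_def)
  have c: "cmod (c i) \<le> 1" "Re (c i * z i) = cmod (z i)" for i
  proof -
    show "cmod (c i) \<le> 1"
      by (simp add: c_def norm_sgn)
    have "c i * z i = complex_of_real (cmod (z i))"
      using complex_norm_square [of "z i"]
      by (cases "z i = 0") (simp_all add: c_def sgn_eq mult.commute power2_eq_square divide_simps)
    then show "Re (c i * z i) = cmod (z i)"
      by simp
  qed
  have pointwise: "g s * \<beta> + q * (\<Sum>i<n. b i powr (q - 1) * (Re (c i * \<phi> s i) - b i * g s)) \<le> g s"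
    if s: "0 < s" "s \<le> t" for s
  proof -
    have sum_le: "(\<Sum>i<n. cmod (\<phi> s i) powr q) \<le> g s powr q"
      unfolding \<phi>_def by (rule schatten_boundD [OF P [OF s] e f])
    have Re_le: "Re (c i * \<phi> s i) \<le> cmod (\<phi> s i)" for i
      using complex_Re_le_cmod [of "c i * \<phi> s i"] mult_right_mono [OF c(1) [of i], of "cmod (\<phi> s i)"]
      by (simp add: norm_mult)
    show ?thesis
    proof (cases "g s = 0")
      case True
      then have "(\<Sum>i<n. cmod (\<phi> s i) powr q) = 0"
        using sum_le by (intro antisym sum_nonneg) auto
      then have "\<And>i. i < n \<Longrightarrow> \<phi> s i = 0"
        by (subst (asm) sum_nonneg_eq_0_iff) auto
      then show ?thesis
        using True by simp
    next
      case False
      then have gs: "g s > 0"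
        using g(1) [OF s] by simp
      have "(\<Sum>i<n. (cmod (\<phi> s i) / g s) powr q) = (\<Sum>i<n. cmod (\<phi> s i) powr q) / g s powr q"
        using gs by (simp add: powr_divide sum_divide_distrib)
      also have "\<dots> \<le> 1"
        using sum_le gs by simp
      finally have 1: "(\<Sum>i<n. (cmod (\<phi> s i) / g s) powr q) \<le> 1" .
      have Re_sum_le: "(\<Sum>i<n. b i powr (q - 1) * (Re (c i * \<phi> s i) - b i * g s))
          \<le> (\<Sum>i<n. b i powr (q - 1) * (cmod (\<phi> s i) - b i * g s))"
        using Re_le by (intro sum_mono mult_left_mono) auto
      have "\<beta> + q * (\<Sum>i<n. b i powr (q - 1) * (cmod (\<phi> s i) / g s - b i))
          = (\<Sum>i<n. b i powr q + q * b i powr (q - 1) * (cmod (\<phi> s i) / g s - b i))"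
        by (simp add: \<beta>_def sum.distrib sum_distrib_left mult.assoc)
      also have "\<dots> \<le> (\<Sum>i<n. (cmod (\<phi> s i) / g s) powr q)"
        using gs b q by (intro sum_mono powr_tangent) auto
      finally have "g s * (\<beta> + q * (\<Sum>i<n. b i powr (q - 1) * (cmod (\<phi> s i) / g s - b i))) \<le> g s * 1"
        using 1 gs by (intro mult_left_mono) auto
      moreover have "g s * (\<Sum>i<n. b i powr (q - 1) * (cmod (\<phi> s i) / g s - b i))
          = (\<Sum>i<n. b i powr (q - 1) * (cmod (\<phi> s i) - b i * g s))"
        unfolding sum_distrib_left using gs by (intro sum.cong) (auto simp: field_simps)
      ultimately have "g s * \<beta> + q * (\<Sum>i<n. b i powr (q - 1) * (cmod (\<phi> s i) - b i * g s)) \<le> g s"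
        by (simp only: distrib_left mult.left_commute [of "g s" q] mult_1_right)
      moreover have "q * (\<Sum>i<n. b i powr (q - 1) * (Re (c i * \<phi> s i) - b i * g s))
          \<le> q * (\<Sum>i<n. b i powr (q - 1) * (cmod (\<phi> s i) - b i * g s))"
        using q by (intro mult_left_mono [OF Re_sum_le]) auto
      ultimately show ?thesis
        by linarith
    qed
  qed
  let ?h = "\<lambda>s. g s * \<beta> + q * (\<Sum>i<n. b i powr (q - 1) * (Re (c i * \<phi> s i) - b i * g s))"
  have z: "((\<lambda>s. \<phi> s i) has_integral z i) {0..t}" for i
    using has_integral_linear [OF K cinner.bounded_linear_right]
    unfolding \<phi>_def z_def comp_def by blast
  have "((\<lambda>s. Re (c i * \<phi> s i)) has_integral cmod (z i)) {0..t}" for i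
  proof -
    have "bounded_linear (\<lambda>w. Re (c i * w))"
      using bounded_linear_compose [OF bounded_linear_Re bounded_linear_mult_right] .
    from has_integral_linear [OF z [of i] this] show ?thesis
      unfolding comp_def c(2) .
  qed
  then have h: "(?h has_integral I * \<beta> + q * (\<Sum>i<n. b i powr (q - 1) * (cmod (z i) - b i * I))) {0..t}"
    by (intro has_integral_add has_integral_mult_left has_integral_mult_right has_integral_sum
        has_integral_diff g(2)) auto
  \<comment> \<open>The pointwise inequality may fail at \<open>s = 0\<close>, where nothing is known about \<open>g\<close> and \<open>P\<close>.\<close>
  have "I * \<beta> + q * (\<Sum>i<n. b i powr (q - 1) * (cmod (z i) - b i * I)) \<le> I"
  proof (rule has_integral_le [OF h])
    show "((\<lambda>s. if s = 0 then ?h 0 else g s) has_integral I) {0..t}"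
      by (rule has_integral_spike [OF negligible_sing [of 0] _ g(2)]) auto
    show "?h s \<le> (if s = 0 then ?h 0 else g s)" if "s \<in> {0..t}" for s
      using pointwise [of s] that by (cases "s = 0") auto
  qed
  moreover have "(\<Sum>i<n. b i powr (q - 1) * (cmod (z i) - b i * I)) = (G - I) * \<beta>"
    unfolding \<beta>_def sum_distrib_left
  proof (intro sum.cong refl)
    show "b i powr (q - 1) * (cmod (z i) - b i * I) = (G - I) * b i powr q" for i
    proof -
      have "cmod (z i) = G * b i"
        using \<open>0 < G\<close> by (simp add: b_def)
      then show ?thesis
        by (simp only: powr_minus_one_mult [OF b, of _ q]) (simp add: algebra_simps)
    qed
  qed
  moreover have "\<beta> \<ge> 0"
    by (simp add: \<beta>_def sum_nonneg)
  then have "(G - I) * \<beta> \<le> q * ((G - I) * \<beta>)"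
    using g q mult_right_mono [of 1 q "(G - I) * \<beta>"] by simp
  moreover have "G * \<beta> = I * \<beta> + (G - I) * \<beta>"
    by (simp add: left_diff_distrib)
  ultimately have "G * \<beta> \<le> G * 1"
    using g(3) by simp
  then have "\<beta> \<le> 1"
    using \<open>0 < G\<close> by simp
  have "(\<Sum>i<n. cmod (cinner (f i) (K (e i))) powr q) = G powr q * \<beta>"
    using \<open>0 < G\<close> by (simp add: \<beta>_def b_def z_def powr_divide sum_distrib_left)
  also have "\<dots> \<le> G powr q"
    using mult_left_mono [OF \<open>\<beta> \<le> 1\<close>, of "G powr q"] by simp
  finally show "(\<Sum>i<n. cmod (cinner (f i) (K (e i))) powr q) \<le> G powr q" .
qed

section \<open>Approximation by operators of finite rank\<close>

lemma rank_le_oproj: "finite B \<Longrightarrow> orthonormal B \<Longrightarrow> rank_le (card B) (oproj B)"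
  unfolding rank_le_def using oproj_in_span [of B] by blast

text \<open>Choose greedily orthonormal vectors \<open>e\<^sub>1, e\<^sub>2, \<dots>\<close> and \<open>f\<^sub>1, f\<^sub>2, \<dots>\<close> with
  \<open>\<bar>\<langle>f\<^sub>i, K e\<^sub>i\<rangle>\<bar> > \<epsilon>\<close>.  The bound stops this after \<open>N\<close> steps with \<open>N \<epsilon>\<^sup>q \<le> C\<^sup>q\<close>, and then the
  compression of \<open>K\<close> to the orthogonal complements of the two systems has norm at most \<open>\<epsilon>\<close>; it
  differs from \<open>K\<close> by an operator of rank at most \<open>2 N\<close>.\<close>

lemma finite_rank_approximation:
  assumes K: "schatten_bound q C K" "bounded_clinear K" and "0 \<le> C" "q > 0" "\<epsilon> > 0"
  obtains N L where "bounded_clinear L" "rank_le (2 * N) L" "real N * \<epsilon> powr q \<le> C powr q"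
    "\<And>x. norm (K x - L x) \<le> \<epsilon> * norm x"
proof -
  define ons where "ons n e \<longleftrightarrow> (\<forall>i<n. \<forall>j<n. cinner (e i) (e j) = (if i = j then 1 else 0))"
    for n :: nat and e :: "nat \<Rightarrow> 'a"
  define P where "P n \<longleftrightarrow> (\<exists>e f. ons n e \<and> ons n f \<and> (\<forall>i<n. cmod (cinner (f i) (K (e i))) > \<epsilon>))"
    for n
  have ons: "orthonormal (e ` {..<n})" "inj_on e {..<n}" if "ons n e" for n e
    using orthonormal_image [of "{..<n}" e] that by (simp_all add: ons_def)
  have bound: "real n * \<epsilon> powr q \<le> C powr q" if "P n" for n
  proof -
    obtain e f where ef: "ons n e" "ons n f" "\<And>i. i < n \<Longrightarrow> cmod (cinner (f i) (K (e i))) > \<epsilon>"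
      using \<open>P n\<close> unfolding P_def by blast
    have "real n * \<epsilon> powr q = (\<Sum>i<n. \<epsilon> powr q)"
      by simp
    also have "\<dots> \<le> (\<Sum>i<n. cmod (cinner (f i) (K (e i))) powr q)"
      using ef(3) assms by (intro sum_mono powr_mono2) (auto intro: less_imp_le)
    also have "\<dots> \<le> C powr q"
      using ons [OF ef(1)] ons [OF ef(2)]
      by (intro schatten_boundD [OF K(1)] bessel_orthonormal [of "e ` {..<n}"]
          bessel_orthonormal [of "f ` {..<n}"]) auto
    finally show ?thesis .
  qed
  have "P 0"
    unfolding P_def ons_def by simp
  moreover have "\<forall>n. P n \<longrightarrow> n \<le> nat \<lfloor>C powr q / \<epsilon> powr q\<rfloor>"
    using bound \<open>\<epsilon> > 0\<close> by (simp add: le_nat_floor pos_le_divide_eq)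
  ultimately obtain N where N: "P N" "\<And>n. P n \<Longrightarrow> n \<le> N"
    by (metis (no_types, lifting) GreatestI_nat Greatest_le_nat)
  obtain e f where ef: "ons N e" "ons N f" "\<And>i. i < N \<Longrightarrow> cmod (cinner (f i) (K (e i))) > \<epsilon>"
    using \<open>P N\<close> unfolding P_def by blast
  define E F where "E = e ` {..<N}" and "F = f ` {..<N}"
  have E: "finite E" "orthonormal E" "card E \<le> N" and F: "finite F" "orthonormal F" "card F \<le> N"
    using ons [OF ef(1)] ons [OF ef(2)] card_image_le [of "{..<N}" e] card_image_le [of "{..<N}" f]
    by (auto simp: E_def F_def)
  define L where "L x = oproj F (K (x - oproj E x)) + K (oproj E x)" for x
  note linE = bounded_clinear_oproj [OF E(1,2)] and linF = bounded_clinear_oproj [OF F(1,2)]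
  show thesis
  proof (rule that [of L N])
    show "bounded_clinear L"
      unfolding L_def
      by (intro bounded_clinear_plus bounded_clinear_compose [OF linF] bounded_clinear_compose [OF K(2)]
          bounded_clinear_minus bounded_clinear_ident linE)
    have "rank_le (card F + card E) L"
      unfolding L_def
      by (intro rank_le_plus rank_le_compose_right [OF rank_le_oproj [OF F(1,2)]]
          rank_le_compose_left [OF rank_le_oproj [OF E(1,2)] K(2)])
    then show "rank_le (2 * N) L"
      by (rule rank_le_mono) (use E F in simp)
    show "real N * \<epsilon> powr q \<le> C powr q"
      by (rule bound [OF N(1)])
    show "norm (K x - L x) \<le> \<epsilon> * norm x" for x
    proof (rule ccontr)
      define x' where "x' = x - oproj E x"
      define y where "y = K x' - oproj F (K x')"
      have "K x = K x' + K (oproj E x)"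
        by (simp add: x'_def bounded_clinear_diff [OF K(2)])
      then have y_eq: "K x - L x = y"
        by (simp add: L_def y_def flip: x'_def)
      assume "\<not> norm (K x - L x) \<le> \<epsilon> * norm x"
      then have y_gt: "norm y > \<epsilon> * norm x"
        by (simp add: y_eq)
      moreover have x'_le: "norm x' \<le> norm x"
        unfolding x'_def by (rule norm_oproj_residual_le [OF E(1,2)])
      ultimately have y_x': "norm y > \<epsilon> * norm x'"
        using mult_left_mono [OF x'_le, of \<epsilon>] \<open>\<epsilon> > 0\<close> by linarith
      have "norm y > 0"
        using y_gt \<open>\<epsilon> > 0\<close> by (meson le_less_trans mult_nonneg_nonneg norm_ge_zero less_imp_le)
      then have "y \<noteq> 0" "x' \<noteq> 0"
        using bounded_clinear_0 [OF K(2)] bounded_clinear_0 [OF linF] by (auto simp: y_def)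
      have orth_x': "cinner a x' = 0" if "a \<in> E" for a
        unfolding x'_def by (rule oproj_residual_orthogonal [OF E(1,2) that])
      have orth_y: "cinner a y = 0" if "a \<in> F" for a
        unfolding y_def by (rule oproj_residual_orthogonal [OF F(1,2) that])
      have "cinner (oproj F (K x')) y = 0"
        using orth_y oproj_in_span [OF F(1,2)] by (rule orthogonal_span)
      then have "cinner y (oproj F (K x')) = 0"
        by (simp add: cinner_eq_0_commute [of y])
      then have "cinner y (K x') = cinner y y"
        by (simp add: y_def cinner.diff_right)
      then have y_K: "cinner y (K x') = complex_of_real ((norm y)\<^sup>2)"
        by (simp only: cinner_self)
      define e' where "e' = e (N := inverse (norm x') *\<^sub>R x')"
      define f' where "f' = f (N := inverse (norm y) *\<^sub>R y)"
      have self: "cinner (inverse (norm v) *\<^sub>R v) (inverse (norm v) *\<^sub>R v) = 1" if "v \<noteq> 0" for v :: 'a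
        using that by (simp add: cinner_self)
      have "ons (Suc N) e'"
        using ef(1) orth_x' self [OF \<open>x' \<noteq> 0\<close>] unfolding ons_def e'_def E_def less_Suc_eq
        by (auto simp: cinner_scaleR_right cinner_scaleR_left cinner_eq_0_commute [of x'])
      moreover have "ons (Suc N) f'"
        using ef(2) orth_y self [OF \<open>y \<noteq> 0\<close>] unfolding ons_def f'_def F_def less_Suc_eq
        by (auto simp: cinner_scaleR_right cinner_scaleR_left cinner_eq_0_commute [of y])
      moreover have "cmod (cinner (f' i) (K (e' i))) > \<epsilon>" if "i < Suc N" for i
      proof (cases "i = N")
        case True
        have "cinner (f' N) (K (e' N)) =
            complex_of_real (inverse (norm x') * inverse (norm y) * (norm y)\<^sup>2)"
          by (simp add: e'_def f'_def bounded_clinear_scaleR [OF K(2)] cinner_scaleR_left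
              cinner_scaleR_right y_K scaleR_conv_of_real [where 'a=complex] mult.assoc)
        also have "\<dots> = complex_of_real (norm y / norm x')"
          using \<open>y \<noteq> 0\<close> by (simp add: power2_eq_square divide_inverse)
        finally have "cmod (cinner (f' N) (K (e' N))) = norm y / norm x'"
          by (metis norm_of_real abs_of_nonneg divide_nonneg_nonneg norm_ge_zero)
        also have "\<dots> > \<epsilon>"
          using y_x' \<open>x' \<noteq> 0\<close> by (simp add: pos_less_divide_eq)
        finally show ?thesis using True by simp
      next
        case False
        then show ?thesis
          using that ef(3) by (simp add: e'_def f'_def)
      qed
      ultimately have "P (Suc N)"
        unfolding P_def by blast
      then show False
        using N(2) by fastforce
    qed
  qed
qed

text \<open>This is the inequality between the trace norm and the operator norm of an operator of
  rank at most \<open>N\<close>.\<close>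

lemma bessel_sum_le_rank:
  assumes D: "rank_le N D" "bounded_clinear D" "d \<ge> 0" "\<And>x. norm (D x) \<le> d * norm x"
    and e: "bessel n e" and f: "bessel n f"
  shows "(\<Sum>i<n. cmod (cinner (f i) (D (e i)))) \<le> real N * d"
proof -
  obtain B where B: "finite B" "orthonormal B" "card B \<le> N" "\<And>x. oproj B (D x) = D x"
    using rank_le_orthonormal [OF D(1)] by blast
  have term_le: "cmod (cinner (f i) (D (e i)))
      \<le> (\<Sum>b\<in>B. cmod (cinner (e i) (cadjoint D b)) * cmod (cinner (f i) b))" for i
  proof -
    have "cinner (f i) (D (e i)) = cinner (f i) (oproj B (D (e i)))"
      by (simp add: B)
    also have "\<dots> = (\<Sum>b\<in>B. cinner b (D (e i)) * cinner (f i) b)"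
      by (simp add: oproj_def cinner.sum_right cinner_scaleC_right)
    finally have "cmod (cinner (f i) (D (e i))) \<le> (\<Sum>b\<in>B. cmod (cinner b (D (e i)) * cinner (f i) b))"
      by (simp add: norm_sum)
    also have "\<dots> = (\<Sum>b\<in>B. cmod (cinner (e i) (cadjoint D b)) * cmod (cinner (f i) b))"
      by (simp add: norm_mult cmod_cinner_commute [of _ "D (e i)"] cinner_cadjoint [OF D(2)])
    finally show ?thesis .
  qed
  have column_le: "(\<Sum>i<n. cmod (cinner (e i) (cadjoint D b)) * cmod (cinner (f i) b)) \<le> d"
    if "b \<in> B" for b
  proof -
    have b: "norm b = 1"
      by (rule orthonormal_norm [OF B(2) that])
    have "(\<Sum>i<n. \<bar>cmod (cinner (e i) (cadjoint D b))\<bar> * \<bar>cmod (cinner (f i) b)\<bar>)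
        \<le> L2_set (\<lambda>i. cmod (cinner (e i) (cadjoint D b))) {..<n} * L2_set (\<lambda>i. cmod (cinner (f i) b)) {..<n}"
      by (rule L2_set_mult_ineq)
    also have "\<dots> \<le> norm (cadjoint D b) * norm b"
      unfolding L2_set_def
      by (intro mult_mono real_le_lsqrt bessel_sum_le [OF e] bessel_sum_le [OF f]) (auto intro: sum_nonneg)
    also have "\<dots> \<le> d"
      using norm_cadjoint_le [OF D(2,3,4), of b] by (simp add: b)
    finally show ?thesis by simp
  qed
  have "(\<Sum>i<n. cmod (cinner (f i) (D (e i))))
      \<le> (\<Sum>i<n. \<Sum>b\<in>B. cmod (cinner (e i) (cadjoint D b)) * cmod (cinner (f i) b))"
    by (intro sum_mono term_le)
  also have "\<dots> = (\<Sum>b\<in>B. \<Sum>i<n. cmod (cinner (e i) (cadjoint D b)) * cmod (cinner (f i) b))"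
    by (rule sum.swap)
  also have "\<dots> \<le> (\<Sum>b\<in>B. d)"
    by (intro sum_mono column_le)
  also have "\<dots> \<le> real N * d"
    using B(3) D(3) by (simp add: mult_right_mono)
  finally show ?thesis .
qed

text \<open>Telescoping: \<open>K\<^bsup>m+1\<^esup> - R\<^bsup>m+1\<^esup> = K (K\<^sup>m - R\<^sup>m) + (K - R) R\<^sup>m\<close>.\<close>

lemma rank_le_funpow_diff:
  assumes "bounded_clinear K" "bounded_clinear R" "rank_le N (\<lambda>x. K x - R x)"
  shows "rank_le (m * N) (\<lambda>x. (K ^^ m) x - (R ^^ m) x)"
proof (induction m)
  case 0
  have "range (\<lambda>x::'a. 0::'a) \<subseteq> complex_vector.span {}"
    by auto
  then show ?case
    unfolding rank_le_def by (intro exI [of _ "{}"]) simp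
next
  case (Suc m)
  have "rank_le (m * N + N) (\<lambda>x. K ((K ^^ m) x - (R ^^ m) x) + (K ((R ^^ m) x) - R ((R ^^ m) x)))"
    by (intro rank_le_plus rank_le_compose_left [OF Suc assms(1)]
        rank_le_compose_right [OF assms(3)])
  then show ?case
    by (simp add: bounded_clinear_diff [OF assms(1)] add.commute)
qed

lemma norm_funpow_le:
  fixes R :: "'a::real_normed_vector \<Rightarrow> 'a"
  assumes "\<And>x. norm (R x) \<le> d * norm x" "d \<ge> 0"
  shows "norm ((R ^^ m) x) \<le> d ^ m * norm x"
proof (induction m)
  case (Suc m)
  have "norm ((R ^^ Suc m) x) \<le> d * norm ((R ^^ m) x)"
    using assms(1) [of "(R ^^ m) x"] by simp
  also have "\<dots> \<le> d * (d ^ m * norm x)"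
    by (intro mult_left_mono Suc assms)
  finally show ?case by (simp add: mult.assoc)
qed simp

text \<open>Powers of an operator of Schatten class \<open>q\<close> become trace class.  With \<open>K - R\<^sub>k\<close> of
  rank \<open>O(2\<^bsup>k q\<^esup>)\<close> and \<open>\<parallel>R\<^sub>k\<parallel> \<le> 2\<^bsup>-k\<^esup>\<close>, the power \<open>K\<^sup>m\<close> is the sum of \<open>K\<^sup>m - R\<^sub>0\<^sup>m\<close>
  and of the telescoping differences \<open>R\<^sub>k\<^sup>m - R\<^bsub>k+1\<^esub>\<^sup>m\<close>, whose rank is \<open>O(2\<^bsup>k q\<^esup>)\<close> and whose norm is
  \<open>O(2\<^bsup>-k m\<^esup>)\<close>; so their trace norms are summable as soon as \<open>m > q\<close>.\<close>

lemma schatten_bound_funpow: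
  assumes K: "schatten_bound q C K" "bounded_clinear K" and "0 \<le> C" "q > 0" "real m > q"
  obtains C' where "0 \<le> C'" "schatten_bound 1 C' (K ^^ m)"
proof -
  have "\<forall>k. \<exists>N L. bounded_clinear L \<and> rank_le (2 * N) L \<and>
      real N * ((1/2) ^ k) powr q \<le> C powr q \<and> (\<forall>x. norm (K x - L x) \<le> (1/2) ^ k * norm x)"
  proof
    fix k :: nat
    show "\<exists>N L. bounded_clinear L \<and> rank_le (2 * N) L \<and>
      real N * ((1/2) ^ k) powr q \<le> C powr q \<and> (\<forall>x. norm (K x - L x) \<le> (1/2) ^ k * norm x)"
      using finite_rank_approximation [OF K assms(3,4), of "(1/2) ^ k"] by (metis zero_less_power
          half_gt_zero_iff zero_less_one)
  qed
  then obtain N L where L: "\<And>k. bounded_clinear (L k)" "\<And>k. rank_le (2 * N k) (L k)"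
      "\<And>k. real (N k) * ((1/2) ^ k) powr q \<le> C powr q"
      "\<And>k x. norm (K x - L k x) \<le> (1/2) ^ k * norm x"
    by metis
  define R where "R k x = K x - L k x" for k x
  define r where "r = 2 powr q * (1/2) ^ m"
  have R: "bounded_clinear (R k)" "norm ((R k ^^ m) x) \<le> ((1/2) ^ m) ^ k * norm x" for k x
  proof -
    show "bounded_clinear (R k)"
      unfolding R_def by (intro bounded_clinear_minus K L)
    show "norm ((R k ^^ m) x) \<le> ((1/2) ^ m) ^ k * norm x"
      using norm_funpow_le [of "R k" "(1/2) ^ k" m x] L(4)
      by (simp add: R_def power_mult [symmetric] mult.commute)
  qed
  have rank0: "rank_le (m * (2 * N k)) (\<lambda>x. (K ^^ m) x - (R k ^^ m) x)" for k
    using L(2) by (intro rank_le_funpow_diff K R) (simp add: R_def)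
  have N_le: "real (N k) \<le> C powr q * (2 powr q) ^ k" for k
  proof -
    have "((1/2) ^ k) powr q * (2 powr q) ^ k = (1::real)"
      by (simp add: powr_power powr_mult [symmetric] powr_realpow [symmetric] powr_powr mult.commute
          power_divide powr_divide)
    then have "real (N k) = real (N k) * ((1/2) ^ k) powr q * (2 powr q) ^ k"
      by (simp add: mult.assoc)
    also have "\<dots> \<le> C powr q * (2 powr q) ^ k"
      by (intro mult_right_mono L) simp
    finally show ?thesis .
  qed
  have r: "0 \<le> r" "r < 1"
  proof -
    have "r = 2 powr (q - real m)"
      by (simp add: r_def powr_diff powr_realpow power_divide)
    then show "0 \<le> r" "r < 1"
      using assms(5) powr_less_one [of 2 "q - real m"] by auto
  qed
  define c where "c = 4 * real m * C powr q * (1 + 2 powr q)"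
  have "c \<ge> 0"
    by (simp add: c_def)
  obtain M where M: "M > 0" "\<And>x. norm ((K ^^ m) x) \<le> M * norm x"
    using bounded_clinear_bound [OF bounded_clinear_funpow [OF K(2)]] by blast
  \<comment> \<open>\<open>a\<close> bounds the contribution of \<open>K\<^sup>m - R\<^sub>0\<^sup>m\<close>, and \<open>c r\<^sup>k\<close> that of the \<open>k\<close>-th difference.\<close>
  define a where "a = real (m * (2 * N 0)) * (M + 1)"
  have step: "(\<Sum>i<n. cmod (cinner (f i) ((R k ^^ m) (e i) - (R (Suc k) ^^ m) (e i)))) \<le> c * r ^ k"
    if e: "bessel n e" and f: "bessel n f" for n e f k
  proof -
    define D where "D x = (R k ^^ m) x - (R (Suc k) ^^ m) x" for x
    have D_alt: "D x = ((K ^^ m) x - (R (Suc k) ^^ m) x) - ((K ^^ m) x - (R k ^^ m) x)" for x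
      by (simp add: D_def)
    have "rank_le (m * (2 * N (Suc k)) + m * (2 * N k)) D"
      unfolding D_alt [abs_def] by (intro rank_le_minus rank0)
    moreover have "bounded_clinear D"
      unfolding D_def [abs_def] by (intro bounded_clinear_minus bounded_clinear_funpow R)
    moreover have "norm (D x) \<le> (2 * ((1/2) ^ m) ^ k) * norm x" for x
    proof -
      have "norm (D x) \<le> ((1/2) ^ m) ^ k * norm x + ((1/2) ^ m) ^ Suc k * norm x"
        unfolding D_def by (intro order_trans [OF norm_triangle_ineq4] add_mono R)
      moreover have "((1/2::real) ^ m) ^ Suc k \<le> ((1/2) ^ m) ^ k"
        by (intro power_decreasing) (auto intro: power_le_one)
      then have "((1/2::real) ^ m) ^ Suc k * norm x \<le> ((1/2) ^ m) ^ k * norm x"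
        by (rule mult_right_mono) simp
      ultimately show ?thesis
        by linarith
    qed
    ultimately have "(\<Sum>i<n. cmod (cinner (f i) (D (e i))))
        \<le> real (m * (2 * N (Suc k)) + m * (2 * N k)) * (2 * ((1/2) ^ m) ^ k)"
      by (intro bessel_sum_le_rank e f) auto
    also have "\<dots> = 4 * real m * (real (N (Suc k)) + real (N k)) * ((1/2) ^ m) ^ k"
      by (simp add: algebra_simps)
    also have "\<dots> \<le> 4 * real m * (C powr q * (2 powr q) ^ Suc k + C powr q * (2 powr q) ^ k) * ((1/2) ^ m) ^ k"
      by (intro mult_right_mono mult_left_mono add_mono N_le) auto
    also have "\<dots> = c * r ^ k"
      by (simp add: c_def r_def power_mult_distrib algebra_simps)
    finally show ?thesis by (simp add: D_def)
  qed
  have "schatten_bound 1 (a + c / (1 - r)) (K ^^ m)"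
    unfolding schatten_bound_def
  proof (intro allI impI)
    fix n and e f :: "nat \<Rightarrow> 'a"
    assume e: "bessel n e" and f: "bessel n f"
    have partial: "(\<Sum>i<n. cmod (cinner (f i) ((K ^^ m) (e i) - (R j ^^ m) (e i))))
        \<le> a + c * (\<Sum>k<j. r ^ k)" for j
    proof (induction j)
      case 0
      have "norm ((K ^^ m) x - (R 0 ^^ m) x) \<le> (M + 1) * norm x" for x
        using norm_triangle_ineq4 [of "(K ^^ m) x" "(R 0 ^^ m) x"] M(2) [of x] R(2) [of 0 x]
        by (simp add: distrib_right)
      then have "(\<Sum>i<n. cmod (cinner (f i) ((K ^^ m) (e i) - (R 0 ^^ m) (e i)))) \<le> a"
        unfolding a_def using M
        by (intro bessel_sum_le_rank [OF rank0] bounded_clinear_minus bounded_clinear_funpow K R e f) auto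
      then show ?case by simp
    next
      case (Suc j)
      have "(\<Sum>i<n. cmod (cinner (f i) ((K ^^ m) (e i) - (R (Suc j) ^^ m) (e i))))
          \<le> (\<Sum>i<n. cmod (cinner (f i) ((K ^^ m) (e i) - (R j ^^ m) (e i)))
            + cmod (cinner (f i) ((R j ^^ m) (e i) - (R (Suc j) ^^ m) (e i))))"
        by (intro sum_mono order_trans [OF _ norm_triangle_ineq])
          (simp flip: cinner_add_right)
      also have "\<dots> \<le> (a + c * (\<Sum>k<j. r ^ k)) + c * r ^ j"
        unfolding sum.distrib by (intro add_mono Suc step e f)
      finally show ?case by (simp add: algebra_simps)
    qed
    have geometric: "c * (\<Sum>k<j. r ^ k) \<le> c / (1 - r)" for j
      using r \<open>c \<ge> 0\<close> by (simp add: sum_gp_strict divide_inverse mult_left_mono mult_right_mono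
          mult_left_le_one_le)
    have limit: "(\<lambda>j. \<Sum>i<n. cmod (cinner (f i) ((K ^^ m) (e i) - (R j ^^ m) (e i))))
        \<longlonglongrightarrow> (\<Sum>i<n. cmod (cinner (f i) ((K ^^ m) (e i) - 0)))"
    proof (intro tendsto_intros cinner.tendsto)
      have "m > 0"
        using assms by (metis of_nat_0_less_iff less_trans)
      then have "(\<lambda>j. ((1/2::real) ^ m) ^ j) \<longlonglongrightarrow> 0"
        by (intro LIMSEQ_realpow_zero) (auto simp: power_less_one_iff)
      then have null: "(\<lambda>j. ((1/2::real) ^ m) ^ j * norm (e i)) \<longlonglongrightarrow> 0" for i
        by (rule tendsto_mult_left_zero)
      show "(\<lambda>j. (R j ^^ m) (e i)) \<longlonglongrightarrow> 0" for i
        by (rule Lim_null_comparison [OF always_eventually null [of i]]) (intro allI R(2))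
    qed
    have "(\<Sum>i<n. cmod (cinner (f i) ((K ^^ m) (e i) - 0))) \<le> a + c / (1 - r)"
      using partial geometric by (intro LIMSEQ_le_const2 [OF limit]) (meson add_left_mono order_trans)
    moreover have "a + c / (1 - r) \<ge> 0"
      using M r \<open>c \<ge> 0\<close> by (simp add: a_def)
    ultimately show "(\<Sum>i<n. cmod (cinner (f i) ((K ^^ m) (e i))) powr 1) \<le> (a + c / (1 - r)) powr 1"
      by simp
  qed
  moreover have "a + c / (1 - r) \<ge> 0"
    using M r \<open>c \<ge> 0\<close> by (simp add: a_def)
  ultimately show thesis using that by blast
qed

section \<open>Singular values\<close>

lemma sv_eigenspace_iff: "u \<in> sv_eigenspace K s \<longleftrightarrow> cadjoint K (K u) = complex_of_real (s\<^sup>2) *\<^sub>C u"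
  by (simp add: sv_eigenspace_def)

lemma csubspace_sv_eigenspace:
  assumes "bounded_clinear K"
  shows "csubspace (sv_eigenspace K s)"
proof (rule complex_vector.subspaceI)
  note lin = assms bounded_clinear_cadjoint [OF assms]
  show "0 \<in> sv_eigenspace K s"
    by (simp add: sv_eigenspace_iff bounded_clinear_0 lin)
  show "x + y \<in> sv_eigenspace K s" if "x \<in> sv_eigenspace K s" "y \<in> sv_eigenspace K s" for x y
    using that by (simp add: sv_eigenspace_iff bounded_clinear_add lin scaleC_add_right)
  show "c *\<^sub>C x \<in> sv_eigenspace K s" if "x \<in> sv_eigenspace K s" for c x
    using that by (simp add: sv_eigenspace_iff bounded_clinear_scaleC lin scaleC_scaleC mult.commute)
qed

context
  fixes K :: "'a::chilbert_space \<Rightarrow> 'a"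
  assumes K: "bounded_clinear K"
begin

lemma cinner_sv_eigenspace:
  "v \<in> sv_eigenspace K s \<Longrightarrow> cinner (K u) (K v) = complex_of_real (s\<^sup>2) * cinner u v"
  by (simp only: cinner_cadjoint [OF K] sv_eigenspace_iff cinner_scaleC_right)

lemma norm_sv_eigenspace:
  assumes "u \<in> sv_eigenspace K s" "s \<ge> 0"
  shows "norm (K u) = s * norm u"
proof -
  have "complex_of_real ((norm (K u))\<^sup>2) = complex_of_real ((s * norm u)\<^sup>2)"
    unfolding cinner_self [symmetric] cinner_sv_eigenspace [OF assms(1)]
    unfolding cinner_self by (simp add: power_mult_distrib)
  then have "(norm (K u))\<^sup>2 = (s * norm u)\<^sup>2"
    using of_real_eq_iff by blast
  then show ?thesis
    using assms by (simp add: power2_eq_iff_nonneg)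
qed

lemma sv_eigenspace_orthogonal:
  assumes u: "u \<in> sv_eigenspace K s" and v: "v \<in> sv_eigenspace K t" and st: "s \<noteq> t" "s \<ge> 0" "t \<ge> 0"
  shows "cinner u v = 0"
proof -
  have "complex_of_real (t\<^sup>2) * cinner u v = cinner (K u) (K v)"
    by (rule cinner_sv_eigenspace [OF v, symmetric])
  also have "\<dots> = cnj (complex_of_real (s\<^sup>2) * cinner v u)"
    using cinner_sv_eigenspace [OF u, of v] by (metis cinner_commute)
  also have "\<dots> = complex_of_real (s\<^sup>2) * cinner u v"
    by (metis cinner_commute complex_cnj_complex_of_real complex_cnj_mult)
  finally have "complex_of_real (t\<^sup>2) = complex_of_real (s\<^sup>2) \<or> cinner u v = 0"
    by auto
  moreover have "complex_of_real (t\<^sup>2) \<noteq> complex_of_real (s\<^sup>2)"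
    using st by (metis of_real_eq_iff power2_eq_iff_nonneg)
  ultimately show ?thesis by blast
qed

end

subsection \<open>Operators obeying a bound belong to the Schatten class\<close>

text \<open>A norm limit of operators of finite rank maps the unit ball to a totally bounded set.\<close>

lemma compact_operatorI:
  assumes K: "bounded_clinear K"
    and approx: "\<And>\<epsilon>. \<epsilon> > 0 \<Longrightarrow> \<exists>N L. bounded_clinear L \<and> rank_le N L \<and> (\<forall>x. norm (K x - L x) \<le> \<epsilon> * norm x)"
  shows "compact_operator K"
proof -
  have ball: "\<exists>S. compact S \<and> (\<forall>c. (\<forall>b\<in>B. cmod (c b) \<le> r) \<longrightarrow> (\<Sum>b\<in>B. c b *\<^sub>C b) \<in> S)"
    if "finite B" for B :: "'a set" and r
    using that
  proof (induction B rule: finite_induct)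
    case empty
    show ?case by (intro exI [of _ "{0}"]) simp
  next
    case (insert a B)
    then obtain S where S: "compact S"
        "\<And>c. (\<forall>b\<in>B. cmod (c b) \<le> r) \<Longrightarrow> (\<Sum>b\<in>B. c b *\<^sub>C b) \<in> S"
      by blast
    let ?S = "(\<lambda>p. fst p *\<^sub>C a + snd p) ` (cball 0 r \<times> S)"
    have "compact ?S"
      by (intro compact_continuous_image compact_Times S compact_cball continuous_intros
          scaleC.continuous_on)
    moreover have "(\<Sum>b\<in>insert a B. c b *\<^sub>C b) \<in> ?S" if "\<forall>b\<in>insert a B. cmod (c b) \<le> r" for c
      using that insert.hyps S(2) [of c]
      by (intro image_eqI [of _ _ "(c a, \<Sum>b\<in>B. c b *\<^sub>C b)"]) auto
    ultimately show ?case by blast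
  qed
  have "\<exists>k. finite k \<and> closure (K ` cball 0 1) \<subseteq> (\<Union>x\<in>k. ball x \<epsilon>)" if "\<epsilon> > 0" for \<epsilon>
  proof -
    obtain N L where L: "bounded_clinear L" "rank_le N L" "\<And>x. norm (K x - L x) \<le> \<epsilon>/4 * norm x"
      using approx [of "\<epsilon>/4"] \<open>\<epsilon> > 0\<close> by auto
    obtain B where B: "finite B" "orthonormal B" "card B \<le> N" "\<And>x. oproj B (L x) = L x"
      by (metis rank_le_orthonormal [OF L(2)])
    obtain M where M: "M > 0" "\<And>x. norm (L x) \<le> M * norm x"
      using bounded_clinear_bound [OF L(1)] by blast
    obtain S where S: "compact S" "\<And>c. (\<forall>b\<in>B. cmod (c b) \<le> M) \<Longrightarrow> (\<Sum>b\<in>B. c b *\<^sub>C b) \<in> S"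
      using ball [OF B(1)] by blast
    have "L x \<in> S" if "norm x \<le> 1" for x
    proof -
      have "cmod (cinner b (L x)) \<le> M" if "b \<in> B" for b
      proof -
        have "cmod (cinner b (L x)) \<le> norm (L x)"
          using cmod_cinner_le [of b "L x"] by (simp add: orthonormal_norm [OF B(2) \<open>b \<in> B\<close>])
        also have "\<dots> \<le> M"
          using M(2) [of x] mult_left_mono [OF \<open>norm x \<le> 1\<close>, of M] M(1) by linarith
        finally show ?thesis .
      qed
      then have "oproj B (L x) \<in> S"
        unfolding oproj_def by (intro S(2)) blast
      then show ?thesis by (simp add: B)
    qed
    note L_S = this
    obtain k where k: "finite k" "S \<subseteq> (\<Union>x\<in>k. ball x (\<epsilon>/4))"
      using S(1) \<open>\<epsilon> > 0\<close> unfolding compact_eq_totally_bounded by (metis divide_pos_pos zero_less_numeral)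
    have "K ` cball 0 1 \<subseteq> (\<Union>x\<in>k. cball x (\<epsilon>/2))"
    proof
      fix y assume "y \<in> K ` cball 0 1"
      then obtain x where x: "y = K x" "norm x \<le> 1" by auto
      obtain z where z: "z \<in> k" "dist z (L x) < \<epsilon>/4"
        using L_S [OF x(2)] k(2) by fastforce
      have "dist (L x) (K x) \<le> \<epsilon>/4"
      proof -
        have "\<epsilon>/4 * norm x \<le> \<epsilon>/4 * 1"
          using x(2) \<open>\<epsilon> > 0\<close> by (intro mult_left_mono) auto
        then show ?thesis
          using L(3) [of x] by (simp add: dist_norm norm_minus_commute)
      qed
      then have "dist z y \<le> \<epsilon>/2"
        using z(2) dist_triangle [of z y "L x"] x(1) by simp
      then show "y \<in> (\<Union>x\<in>k. cball x (\<epsilon>/2))"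
        using z(1) by auto
    qed
    then have "closure (K ` cball 0 1) \<subseteq> (\<Union>x\<in>k. cball x (\<epsilon>/2))"
      using k(1) by (intro closure_minimal closed_UN) auto
    also have "\<dots> \<subseteq> (\<Union>x\<in>k. ball x \<epsilon>)"
      using \<open>\<epsilon> > 0\<close> by (intro UN_mono) auto
    finally show ?thesis
      using k(1) by blast
  qed
  then show ?thesis
    unfolding compact_operator_def compact_eq_totally_bounded using K
    by (simp add: complete_eq_closed)
qed

text \<open>In an infinite-dimensional eigenspace the dimension, and with it the multiplicity, has the default
  value 0, and the empty system will do.\<close>

lemma orthonormal_basis_sv_eigenspace:
  assumes "bounded_clinear K"
  obtains B where "finite B" "orthonormal B" "B \<subseteq> sv_eigenspace K s" "sv_multiplicity K s \<le> card B"
proof -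
  let ?E = "sv_eigenspace K s"
  obtain S where S: "S \<subseteq> ?E" "complex_vector.independent S" "?E \<subseteq> complex_vector.span S"
      "card S = cdim ?E"
    by (rule complex_vector.basis_exists)
  show thesis
  proof (cases "finite S")
    case True
    obtain B where B: "finite B" "orthonormal B"
        "complex_vector.span B = complex_vector.span S"
      by (metis gram_schmidt [OF True])
    have "complex_vector.span S \<subseteq> ?E"
      by (rule complex_vector.span_minimal [OF S(1) csubspace_sv_eigenspace [OF assms]])
    then have "B \<subseteq> ?E"
      using B(3) complex_vector.span_superset by blast
    moreover have "cdim ?E \<le> card B"
      using S(3) B by (intro complex_vector.dim_le_card) simp_all
    ultimately show thesis
      using that B by (simp add: sv_multiplicity_def)
  next
    case False
    then have "sv_multiplicity K s \<le> card {}"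
      using S(4) by (simp add: sv_multiplicity_def)
    then show thesis
      using that [of "{}"] by (simp add: orthonormal_def)
  qed
qed

text \<open>Evaluate the bound on orthonormal systems of singular vectors \<open>u\<close> and on their normalised images
  \<open>K u / s\<close>, which are orthonormal as well: each pair contributes \<open>s\<^sup>q\<close>.\<close>

lemma schatten_bound_sum_singular_values:
  assumes K: "schatten_bound q C K" "bounded_clinear K"
    and F: "finite F" "F \<subseteq> singular_values K"
  shows "(\<Sum>s\<in>F. real (sv_multiplicity K s) * s powr q) \<le> C powr q"
proof -
  have "\<forall>s. \<exists>B. finite B \<and> orthonormal B \<and> B \<subseteq> sv_eigenspace K s \<and> sv_multiplicity K s \<le> card B"
    using orthonormal_basis_sv_eigenspace [OF K(2)] by metis
  then obtain B where B: "\<And>s. finite (B s)" "\<And>s. orthonormal (B s)" "\<And>s. B s \<subseteq> sv_eigenspace K s"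
      "\<And>s. sv_multiplicity K s \<le> card (B s)"
    by metis
  define W where "W = (\<Union>s\<in>F. B s)"
  have pos: "s > 0" if "s \<in> F" for s
    using that F by (auto simp: singular_values_def)
  have orth: "cinner u v = 0" if "s \<in> F" "t \<in> F" "s \<noteq> t" "u \<in> B s" "v \<in> B t" for s t u v
    using that B(3) pos [of s] pos [of t] by (intro sv_eigenspace_orthogonal [OF K(2), of u s v t]) auto
  have norm_K: "norm (K u) = s" if "s \<in> F" "u \<in> B s" for s u
    using norm_sv_eigenspace [OF K(2), of u s] that B(3) pos [of s] orthonormal_norm [OF B(2)] by force
  have W: "finite W" "orthonormal W"
  proof -
    show "finite W"
      using F B by (simp add: W_def)
    show "orthonormal W"
      unfolding orthonormal_def
    proof (intro ballI)
      fix u v assume "u \<in> W" "v \<in> W"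
      then obtain s t where st: "s \<in> F" "t \<in> F" "u \<in> B s" "v \<in> B t"
        unfolding W_def by blast
      show "cinner u v = (if u = v then 1 else 0)"
      proof (cases "s = t")
        case True
        then show ?thesis
          using B(2) [of s] st by (simp add: orthonormal_def)
      next
        case False
        then have "cinner u v = 0"
          using orth st by blast
        moreover have "cinner u u = 1"
          using B(2) [of s] st by (simp add: orthonormal_def)
        ultimately show ?thesis by auto
      qed
    qed
  qed
  define f where "f u = inverse (norm (K u)) *\<^sub>R K u" for u
  have f: "cinner (f u) (f v) = (if u = v then 1 else 0)" if uv: "u \<in> W" "v \<in> W" for u v
  proof -
    obtain s t where st: "s \<in> F" "t \<in> F" "u \<in> B s" "v \<in> B t"
      using uv unfolding W_def by blast
    have "cinner (K u) (K v) = complex_of_real (t\<^sup>2) * cinner u v"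
      using st B(3) by (intro cinner_sv_eigenspace [OF K(2)]) auto
    also have "\<dots> = complex_of_real (t\<^sup>2) * (if u = v then 1 else 0)"
      using W(2) uv by (simp add: orthonormal_def)
    finally have *: "cinner (K u) (K v) = complex_of_real (t\<^sup>2) * (if u = v then 1 else 0)" .
    show ?thesis
    proof (cases "u = v")
      case True
      then show ?thesis
        using * norm_K [OF st(2,4)] pos [OF st(2)]
        by (simp add: f_def cinner_scaleR_left cinner_scaleR_right scaleR_conv_of_real [where 'a=complex]
            power2_eq_square divide_simps)
    next
      case False
      then show ?thesis
        using * by (simp add: f_def cinner_scaleR_left cinner_scaleR_right)
    qed
  qed
  have f_W: "orthonormal (f ` W)" "inj_on f W"
    using orthonormal_image [of W f] f by simp_all
  obtain h where h: "bij_betw h {..<card W} W"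
    using ex_bij_betw_nat_finite [OF W(1)] by (auto simp: atLeast0LessThan)
  have "bessel (card W) h"
    using W h by (intro bessel_orthonormal [of W]) (auto simp: bij_betw_def)
  moreover have "bessel (card W) (f \<circ> h)"
    using W h f_W by (intro bessel_orthonormal [of "f ` W"]) (auto simp: bij_betw_def intro: comp_inj_on)
  ultimately have "(\<Sum>i<card W. cmod (cinner ((f \<circ> h) i) (K (h i))) powr q) \<le> C powr q"
    by (rule schatten_boundD [OF K(1)])
  also have "(\<Sum>i<card W. cmod (cinner ((f \<circ> h) i) (K (h i))) powr q)
      = (\<Sum>u\<in>W. cmod (cinner (f u) (K u)) powr q)"
    using sum.reindex_bij_betw [OF h, of "\<lambda>u. cmod (cinner (f u) (K u)) powr q"] by simp
  also have "\<dots> = (\<Sum>s\<in>F. \<Sum>u\<in>B s. cmod (cinner (f u) (K u)) powr q)"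
    unfolding W_def
  proof (rule sum.UNION_disjoint [OF F(1)])
    show "\<forall>s\<in>F. \<forall>t\<in>F. s \<noteq> t \<longrightarrow> B s \<inter> B t = {}"
    proof (intro ballI impI equals0I)
      fix s t u assume st: "s \<in> F" "t \<in> F" "s \<noteq> t" and "u \<in> B s \<inter> B t"
      then have "cinner u u = 0" "norm u = 1"
        using orth [OF st, of u u] orthonormal_norm [OF B(2)] by auto
      then show False
        using cinner_self [of u] by simp
    qed
  qed (use B in simp)
  also have "\<dots> = (\<Sum>s\<in>F. real (card (B s)) * s powr q)"
  proof (rule sum.cong [OF refl])
    fix s assume s: "s \<in> F"
    have "cmod (cinner (f u) (K u)) = s" if "u \<in> B s" for u
    proof -
      have "cinner (f u) (K u) = complex_of_real (inverse (norm (K u)) * (norm (K u))\<^sup>2)"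
        by (simp add: f_def cinner_scaleR_left cinner_self scaleR_conv_of_real [where 'a=complex])
      also have "\<dots> = complex_of_real s"
        using norm_K [OF s that] pos [OF s] by (simp add: power2_eq_square)
      finally show ?thesis
        using pos [OF s] by simp
    qed
    then show "(\<Sum>u\<in>B s. cmod (cinner (f u) (K u)) powr q) = real (card (B s)) * s powr q"
      by simp
  qed
  also have "(\<Sum>s\<in>F. real (sv_multiplicity K s) * s powr q) \<le> \<dots>"
    using B(4) by (intro sum_mono mult_right_mono) auto
  finally show ?thesis by simp
qed

proposition schatten_bound_imp_schatten_class:
  assumes K: "schatten_bound q C K" "bounded_clinear K" and "0 \<le> C" "q > 0"
  shows "K \<in> schatten_class q" "schatten_norm q K \<le> C"
proof -
  have "compact_operator K"
  proof (rule compact_operatorI [OF K(2)])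
    show "\<exists>N L. bounded_clinear L \<and> rank_le N L \<and> (\<forall>x. norm (K x - L x) \<le> \<epsilon> * norm x)"
      if "\<epsilon> > 0" for \<epsilon>
      using finite_rank_approximation [OF assms that] by metis
  qed
  moreover have nonneg: "0 \<le> real (sv_multiplicity K s) * s powr q" for s
    by simp
  have summable: "(\<lambda>s. real (sv_multiplicity K s) * s powr q) summable_on singular_values K"
    using schatten_bound_sum_singular_values [OF K]
    by (intro nonneg_bdd_above_summable_on bdd_aboveI2 [where M = "C powr q"]) auto
  ultimately show "K \<in> schatten_class q"
    by (simp add: schatten_class_def)
  have "(\<Sum>\<^sub>\<infinity>s\<in>singular_values K. real (sv_multiplicity K s) * s powr q) \<le> C powr q"
    using schatten_bound_sum_singular_values [OF K] summable
    by (intro infsum_le_finite_sums) auto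
  then have "schatten_norm q K \<le> (C powr q) powr (1 / q)"
    unfolding schatten_norm_def using assms by (intro powr_mono2 infsum_nonneg) auto
  also have "\<dots> = C"
    using assms by (simp add: powr_powr)
  finally show "schatten_norm q K \<le> C" .
qed

subsection \<open>Members of the Schatten class obey the bound\<close>

text \<open>A maximising sequence for \<open>\<parallel>K x\<parallel>\<close> on the unit sphere of an invariant subspace of
  \<open>K\<^sup>*K\<close> is asymptotically an eigenvector sequence for \<open>m\<^sup>2\<close>, where \<open>m\<close> is the supremum; by compactness
  of \<open>K\<close> a subsequence converges.\<close>

lemma singular_vector_exists:
  assumes K: "compact_operator K"
    and W: "closed W" "csubspace W" "\<And>x. x \<in> W \<Longrightarrow> cadjoint K (K x) \<in> W"
    and x0: "x0 \<in> W" "norm (K x0) > \<epsilon> * norm x0" and "\<epsilon> \<ge> 0"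
  obtains u s where "u \<in> W" "norm u = 1" "s > \<epsilon>" "u \<in> sv_eigenspace K s"
proof -
  have lin: "bounded_clinear K" and cpt: "compact (closure (K ` cball 0 1))"
    using K by (simp_all add: compact_operator_def)
  note adj = bounded_clinear_cadjoint [OF lin]
  note scaleR_W = complex_vector.subspace_scale [OF W(2), of _ "complex_of_real _", folded scaleR_eq_scaleC]
  define Y where "Y = {norm (K x) |x. x \<in> W \<and> norm x = 1}"
  define m where "m = Sup Y"
  have "x0 \<noteq> 0"
    using x0(2) bounded_clinear_0 [OF lin] by auto
  define x1 where "x1 = inverse (norm x0) *\<^sub>R x0"
  have x1: "x1 \<in> W" "norm x1 = 1" "norm (K x1) > \<epsilon>"
    using x0 \<open>x0 \<noteq> 0\<close> scaleR_W [OF x0(1)]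
    by (simp_all add: x1_def bounded_clinear_scaleR [OF lin] field_simps)
  obtain M where M: "\<And>x. norm (K x) \<le> M * norm x"
    using bounded_clinear_bound [OF lin] by metis
  have bdd: "bdd_above Y"
  proof (rule bdd_aboveI [of _ M])
    fix y assume "y \<in> Y"
    then obtain x where "y = norm (K x)" "norm x = 1"
      unfolding Y_def by blast
    then show "y \<le> M"
      using M [of x] by simp
  qed
  have in_Y: "norm (K x) \<in> Y" if "x \<in> W" "norm x = 1" for x
    using that unfolding Y_def by blast
  have "m > \<epsilon>"
    using cSup_upper [OF in_Y [OF x1(1,2)] bdd] x1(3) by (simp add: m_def)
  then have "m > 0"
    using \<open>\<epsilon> \<ge> 0\<close> by simp
  have m_bound: "norm (K x) \<le> m * norm x" if "x \<in> W" for x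
  proof (cases "x = 0")
    case False
    then have "norm (K (inverse (norm x) *\<^sub>R x)) \<le> m"
      unfolding m_def by (intro cSup_upper [OF _ bdd] in_Y scaleR_W that) simp
    then show ?thesis
      using False by (simp add: bounded_clinear_scaleR [OF lin] field_simps)
  qed (simp add: bounded_clinear_0 [OF lin])
  have "\<exists>x. x \<in> W \<and> norm x = 1 \<and> norm (K x) > m - inverse (real (Suc n))" for n
  proof -
    have "\<exists>y\<in>Y. m - inverse (real (Suc n)) < y"
      unfolding m_def using in_Y [OF x1(1,2)] by (intro less_cSupD) auto
    then show ?thesis
      unfolding Y_def by blast
  qed
  then obtain x where x: "\<And>n. x n \<in> W" "\<And>n. norm (x n) = 1"
      "\<And>n. norm (K (x n)) > m - inverse (real (Suc n))"
    by metis
  have "\<forall>n. K (x n) \<in> closure (K ` cball 0 1)"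
    using x(2) by (intro allI subsetD [OF closure_subset] imageI) simp
  then obtain l r where r: "strict_mono (r :: nat \<Rightarrow> nat)" "((\<lambda>n. K (x n)) \<circ> r) \<longlonglongrightarrow> l"
    using cpt [unfolded compact_def, THEN spec [of _ "\<lambda>n. K (x n)"]] by blast
  have norm_lim: "(\<lambda>n. norm (K (x n))) \<longlonglongrightarrow> m"
  proof (rule tendsto_sandwich)
    show "(\<lambda>n. m - inverse (real (Suc n))) \<longlonglongrightarrow> m"
      using tendsto_diff [OF tendsto_const LIMSEQ_inverse_real_of_nat, of m] by simp
    show "\<forall>\<^sub>F n in sequentially. m - inverse (real (Suc n)) \<le> norm (K (x n))"
      using x(3) by (intro always_eventually allI less_imp_le)
    show "\<forall>\<^sub>F n in sequentially. norm (K (x n)) \<le> m"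
      using m_bound [OF x(1)] x(2) by (intro always_eventually allI) simp
  qed simp
  have defect: "(norm (cadjoint K (K y) - (m\<^sup>2) *\<^sub>R y))\<^sup>2 \<le> m\<^sup>2 * (m\<^sup>2 - (norm (K y))\<^sup>2)"
    if y: "y \<in> W" "norm y = 1" for y
  proof -
    define z where "z = cadjoint K (K y)"
    have "norm z * norm z = cmod (cinner (K z) (K y))"
      unfolding z_def cinner_cadjoint [OF lin] cinner_self norm_of_real by (simp add: power2_eq_square)
    also have "\<dots> \<le> norm (K z) * norm (K y)"
      by (rule cmod_cinner_le)
    also have "\<dots> \<le> (m * norm z) * norm (K y)"
      unfolding z_def by (intro mult_right_mono m_bound W(3) y) simp
    finally have "norm z \<le> m * norm (K y)"
      using \<open>m > 0\<close> by (cases "norm z = 0") (simp_all add: mult.commute mult.left_commute)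
    then have z: "(norm z)\<^sup>2 \<le> m\<^sup>2 * (norm (K y))\<^sup>2"
      by (metis norm_ge_zero power_mono power_mult_distrib)
    have "cinner z y = complex_of_real ((norm (K y))\<^sup>2)"
      unfolding z_def cinner_cadjoint' [OF lin] cinner_self ..
    then have "inner z y = (norm (K y))\<^sup>2"
      by (simp add: inner_eq_Re_cinner del: of_real_power)
    then have "(norm (z - (m\<^sup>2) *\<^sub>R y))\<^sup>2 = (norm z)\<^sup>2 - 2 * m\<^sup>2 * (norm (K y))\<^sup>2 + m\<^sup>2 * m\<^sup>2"
      using y(2) by (simp add: power2_norm_eq_inner inner_diff_left inner_diff_right inner_commute [of y z]
          norm_eq_1 algebra_simps)
    then show ?thesis
      using z unfolding z_def by (simp add: right_diff_distrib)
  qed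
  have defect_lim: "(\<lambda>n. cadjoint K (K (x n)) - (m\<^sup>2) *\<^sub>R x n) \<longlonglongrightarrow> 0"
  proof -
    have "(\<lambda>n. m\<^sup>2 * (m\<^sup>2 - (norm (K (x n)))\<^sup>2)) \<longlonglongrightarrow> m\<^sup>2 * (m\<^sup>2 - m\<^sup>2)"
      by (intro tendsto_intros norm_lim)
    then have 0: "(\<lambda>n. m\<^sup>2 * (m\<^sup>2 - (norm (K (x n)))\<^sup>2)) \<longlonglongrightarrow> 0"
      by simp
    have "(\<lambda>n. (norm (cadjoint K (K (x n)) - (m\<^sup>2) *\<^sub>R x n))\<^sup>2) \<longlonglongrightarrow> 0"
      by (rule Lim_null_comparison [OF always_eventually 0]) (simp add: defect [OF x(1,2)])
    then have "(\<lambda>n. sqrt ((norm (cadjoint K (K (x n)) - (m\<^sup>2) *\<^sub>R x n))\<^sup>2)) \<longlonglongrightarrow> sqrt 0"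
      by (rule tendsto_real_sqrt)
    then show ?thesis
      by (simp add: tendsto_norm_zero_iff)
  qed
  define u where "u = inverse (m\<^sup>2) *\<^sub>R cadjoint K l"
  have adj_lim: "(\<lambda>n. cadjoint K (K (x (r n)))) \<longlonglongrightarrow> cadjoint K l"
    using bounded_clinear_tendsto [OF adj r(2)] by (simp add: comp_def)
  have x_lim: "(\<lambda>n. x (r n)) \<longlonglongrightarrow> u"
  proof -
    have "(\<lambda>n. cadjoint K (K (x (r n))) - (m\<^sup>2) *\<^sub>R x (r n)) \<longlonglongrightarrow> 0"
      using LIMSEQ_subseq_LIMSEQ [OF defect_lim r(1)] by (simp add: comp_def)
    from tendsto_scaleR [OF tendsto_const tendsto_diff [OF adj_lim this], of "inverse (m\<^sup>2)"]
    show ?thesis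
      using \<open>m > 0\<close> by (simp add: u_def scaleR_diff_right)
  qed
  show thesis
  proof (rule that [of u m])
    show "u \<in> W"
      using closed_sequentially [OF W(1) _ x_lim] x(1) by blast
    show "norm u = 1"
      using tendsto_norm [OF x_lim] x(2) by (simp add: LIMSEQ_const_iff)
    have "(\<lambda>n. cadjoint K (K (x (r n)))) \<longlonglongrightarrow> cadjoint K (K u)"
      by (intro bounded_clinear_tendsto [OF adj] bounded_clinear_tendsto [OF lin] x_lim)
    then have "cadjoint K (K u) = cadjoint K l"
      using adj_lim LIMSEQ_unique by blast
    then show "u \<in> sv_eigenspace K m"
      using \<open>m > 0\<close> by (simp add: sv_eigenspace_iff u_def flip: scaleR_eq_scaleC del: of_real_power)
  qed (fact \<open>m > \<epsilon>\<close>)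
qed

text \<open>Their images are orthogonal vectors of norm at least \<open>\<epsilon>\<close> in a totally bounded set.\<close>

lemma card_singular_vectors_bounded:
  assumes K: "compact_operator K" and "\<epsilon> > 0"
  obtains N where "\<And>U. finite U \<Longrightarrow> orthonormal U \<Longrightarrow> (\<And>u. u \<in> U \<Longrightarrow> \<exists>s\<ge>\<epsilon>. u \<in> sv_eigenspace K s) \<Longrightarrow> card U \<le> N"
proof -
  have lin: "bounded_clinear K" and cpt: "compact (closure (K ` cball 0 1))"
    using K by (simp_all add: compact_operator_def)
  obtain k where k: "finite k" "closure (K ` cball 0 1) \<subseteq> (\<Union>x\<in>k. ball x (\<epsilon>/2))"
    using cpt \<open>\<epsilon> > 0\<close> unfolding compact_eq_totally_bounded by (metis half_gt_zero_iff)
  show thesis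
  proof (rule that [of "card k"])
    fix U :: "'a set"
    assume U: "finite U" "orthonormal U" "\<And>u. u \<in> U \<Longrightarrow> \<exists>s\<ge>\<epsilon>. u \<in> sv_eigenspace K s"
    have "\<exists>c\<in>k. dist c (K u) < \<epsilon>/2" if "u \<in> U" for u
    proof -
      have "K u \<in> K ` cball 0 1"
        using orthonormal_norm [OF U(2) that] by simp
      then show ?thesis
        using k(2) closure_subset [of "K ` cball 0 1"] by fastforce
    qed
    then obtain c where c: "\<And>u. u \<in> U \<Longrightarrow> c u \<in> k" "\<And>u. u \<in> U \<Longrightarrow> dist (c u) (K u) < \<epsilon>/2"
      by metis
    have "inj_on c U"
    proof (rule inj_onI, rule ccontr)
      fix u v assume uv: "u \<in> U" "v \<in> U" "c u = c v" "u \<noteq> v"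
      obtain s t where s: "s \<ge> \<epsilon>" "u \<in> sv_eigenspace K s" and t: "t \<ge> \<epsilon>" "v \<in> sv_eigenspace K t"
        using U(3) uv by metis
      have "cinner (K u) (K v) = 0"
        using U(2) uv unfolding cinner_sv_eigenspace [OF lin t(2)] orthonormal_def by simp
      then have "cinner (K u) (- K v) = 0"
        by (simp add: cinner.minus_right)
      then have "(norm (K u + - K v))\<^sup>2 = (norm (K u))\<^sup>2 + (norm (- K v))\<^sup>2"
        by (rule pythagoras)
      moreover have "norm (K u) \<ge> \<epsilon>"
        using norm_sv_eigenspace [OF lin s(2)] s(1) \<open>\<epsilon> > 0\<close> orthonormal_norm [OF U(2) uv(1)] by simp
      then have "(norm (K u))\<^sup>2 \<ge> \<epsilon>\<^sup>2"
        using \<open>\<epsilon> > 0\<close> by (intro power_mono) auto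
      ultimately have "(dist (K u) (K v))\<^sup>2 \<ge> \<epsilon>\<^sup>2"
        by (simp add: dist_norm add_increasing2)
      then have "dist (K u) (K v) \<ge> \<epsilon>"
        by (rule power2_le_imp_le) simp
      moreover have "dist (K u) (K v) < \<epsilon>"
        using c(2) [OF uv(1)] c(2) [OF uv(2)] dist_triangle3 [of "K u" "K v" "c u"] uv(3) by simp
      ultimately show False by simp
    qed
    then show "card U \<le> card k"
      using c(1) k(1) by (intro card_inj_on_le) auto
  qed
qed

text \<open>The singular vectors with singular value at least \<open>\<epsilon>\<close>: in the orthogonal complement of a maximal
  orthonormal system of them \<open>K\<close> is bounded by \<open>\<epsilon>\<close>, and by maximality the system contains a basis
  of every eigenspace that it meets, so that it counts singular values with multiplicity.\<close>

lemma truncated_singular_system: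
  assumes K: "compact_operator K" and "\<epsilon> > 0"
  obtains U where "finite U" "orthonormal U" "\<And>u. u \<in> U \<Longrightarrow> \<exists>s\<ge>\<epsilon>. u \<in> sv_eigenspace K s"
    "\<And>x. (\<And>u. u \<in> U \<Longrightarrow> cinner u x = 0) \<Longrightarrow> norm (K x) \<le> \<epsilon> * norm x"
    "\<And>s. s \<ge> \<epsilon> \<Longrightarrow> card (U \<inter> sv_eigenspace K s) = sv_multiplicity K s"
proof -
  have lin: "bounded_clinear K"
    using K by (simp add: compact_operator_def)
  define P where "P n \<longleftrightarrow> (\<exists>U. finite U \<and> orthonormal U \<and> (\<forall>u\<in>U. \<exists>s\<ge>\<epsilon>. u \<in> sv_eigenspace K s) \<and> card U = n)"
    for n
  obtain N where N: "\<And>U. finite U \<Longrightarrow> orthonormal U \<Longrightarrow> (\<And>u. u \<in> U \<Longrightarrow> \<exists>s\<ge>\<epsilon>. u \<in> sv_eigenspace K s) \<Longrightarrow> card U \<le> N"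
    using card_singular_vectors_bounded [OF assms] by blast
  have "\<forall>n. P n \<longrightarrow> n \<le> N"
    unfolding P_def using N by metis
  moreover have "P 0"
    unfolding P_def by (intro exI [of _ "{}"]) (simp add: orthonormal_def)
  ultimately obtain n where n: "P n" "\<And>k. P k \<Longrightarrow> k \<le> n"
    by (metis (no_types, lifting) GreatestI_nat Greatest_le_nat)
  obtain U where U: "finite U" "orthonormal U" "\<And>u. u \<in> U \<Longrightarrow> \<exists>s\<ge>\<epsilon>. u \<in> sv_eigenspace K s" "card U = n"
    using n(1) unfolding P_def by metis
  have maximal: False
    if "\<And>u. u \<in> U \<Longrightarrow> cinner u a = 0" "a \<noteq> 0" "a \<in> sv_eigenspace K s" "s \<ge> \<epsilon>" for a s
  proof -
    define b where "b = complex_of_real (inverse (norm a)) *\<^sub>C a"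
    have b: "norm b = 1" "\<And>u. u \<in> U \<Longrightarrow> cinner u b = 0"
      using that by (simp_all add: b_def norm_scaleC norm_inverse cinner_scaleC_right)
    have "b \<in> sv_eigenspace K s"
      unfolding b_def
      by (rule complex_vector.subspace_scale [OF csubspace_sv_eigenspace [OF lin] that(3)])
    then have "P (card (insert b U))"
      unfolding P_def using U b that(4) orthonormal_insert [OF U(2) b]
      by (intro exI [of _ "insert b U"]) auto
    moreover have "b \<notin> U"
    proof
      assume "b \<in> U"
      then have "cinner b b = 0"
        by (rule b)
      then show False
        using b(1) cinner_self [of b] by simp
    qed
    ultimately show False
      using n(2) U(1,4) by fastforce
  qed
  show thesis
  proof (rule that [OF U(1,2)])
    show "\<exists>s\<ge>\<epsilon>. u \<in> sv_eigenspace K s" if "u \<in> U" for u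
      using U(3) that by blast
  next
    fix x assume x: "\<And>u. u \<in> U \<Longrightarrow> cinner u x = 0"
    define W where "W = {x. \<forall>u\<in>U. cinner u x = 0}"
    have "closed W"
    proof -
      have "W = (\<Inter>u\<in>U. (\<lambda>x. cinner u x) -` {0})"
        by (auto simp: W_def)
      also have "closed \<dots>"
        by (intro closed_INT ballI continuous_closed_vimage closed_singleton
            linear_continuous_at cinner.bounded_linear_right)
      finally show ?thesis .
    qed
    moreover have "csubspace W"
      by (rule complex_vector.subspaceI) (simp_all add: W_def cinner_add_right cinner_scaleC_right)
    moreover have "cadjoint K (K y) \<in> W" if "y \<in> W" for y
      unfolding W_def
    proof (intro CollectI ballI)
      fix u assume u: "u \<in> U"
      then obtain s where "u \<in> sv_eigenspace K s"
        using U(3) by blast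
      then have "cadjoint K (K u) = complex_of_real (s\<^sup>2) *\<^sub>C u"
        by (simp only: sv_eigenspace_iff)
      then have "cinner (cadjoint K (K u)) y = 0"
        using that u by (simp add: W_def cinner_scaleC_left)
      then show "cinner u (cadjoint K (K y)) = 0"
        by (simp add: cinner_cadjoint' [OF lin] cinner_cadjoint [OF lin])
    qed
    moreover have "x \<in> W"
      using x by (simp add: W_def)
    ultimately have W: "closed W" "csubspace W" "\<And>y. y \<in> W \<Longrightarrow> cadjoint K (K y) \<in> W" "x \<in> W"
      by blast+
    show "norm (K x) \<le> \<epsilon> * norm x"
    proof (rule ccontr)
      assume "\<not> norm (K x) \<le> \<epsilon> * norm x"
      then obtain u s where u: "u \<in> W" "norm u = 1" "s > \<epsilon>" "u \<in> sv_eigenspace K s"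
        using singular_vector_exists [OF K, of W x \<epsilon>] W \<open>\<epsilon> > 0\<close> by (metis not_le less_imp_le)
      have "u \<noteq> 0"
        using u(2) by auto
      then show False
        using maximal [of u s] u by (simp add: W_def)
    qed
  next
    fix s :: real assume s: "s \<ge> \<epsilon>"
    let ?B = "U \<inter> sv_eigenspace K s"
    have B: "finite ?B" "orthonormal ?B"
      using U by (auto simp: orthonormal_def)
    have "sv_eigenspace K s \<subseteq> complex_vector.span ?B"
    proof
      fix x assume x: "x \<in> sv_eigenspace K s"
      define a where "a = x - oproj ?B x"
      have "oproj ?B x \<in> sv_eigenspace K s"
        using oproj_in_span [OF B] complex_vector.span_minimal [OF _ csubspace_sv_eigenspace [OF lin], of ?B s]
        by blast
      then have a: "a \<in> sv_eigenspace K s"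
        unfolding a_def by (rule complex_vector.subspace_diff [OF csubspace_sv_eigenspace [OF lin] x])
      have "cinner u a = 0" if "u \<in> U" for u
      proof (cases "u \<in> sv_eigenspace K s")
        case True
        then show ?thesis
          unfolding a_def using that by (intro oproj_residual_orthogonal [OF B]) simp
      next
        case False
        obtain t where t: "t \<ge> \<epsilon>" "u \<in> sv_eigenspace K t"
          using U(3) \<open>u \<in> U\<close> by blast
        then show ?thesis
          using False s \<open>\<epsilon> > 0\<close> by (intro sv_eigenspace_orthogonal [OF lin t(2) a]) auto
      qed
      then have "a = 0"
        using maximal [of a s] a s by blast
      then show "x \<in> complex_vector.span ?B"
        using oproj_in_span [OF B, of x] by (simp add: a_def)
    qed
    then show "card ?B = sv_multiplicity K s"
      unfolding sv_multiplicity_def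
      by (intro complex_vector.basis_card_eq_dim orthonormal_independent B) auto
  qed
qed

text \<open>The weights may sum up to less than 1 because the function vanishes at 0.\<close>

lemma jensen_powr:
  fixes p s :: "'b \<Rightarrow> real"
  assumes "q \<ge> 1" "finite U" "\<And>u. u \<in> U \<Longrightarrow> 0 \<le> p u" "\<And>u. u \<in> U \<Longrightarrow> 0 \<le> s u" "(\<Sum>u\<in>U. p u) \<le> 1"
  shows "(\<Sum>u\<in>U. p u * s u) powr q \<le> (\<Sum>u\<in>U. p u * s u powr q)"
proof -
  define b where "b = (\<Sum>u\<in>U. p u * s u)"
  define c where "c = (\<Sum>u\<in>U. p u)"
  have b: "b \<ge> 0"
    unfolding b_def by (intro sum_nonneg mult_nonneg_nonneg assms)
  have "(\<Sum>u\<in>U. p u * (b powr q + q * b powr (q - 1) * (s u - b))) \<le> (\<Sum>u\<in>U. p u * s u powr q)"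
    using assms b by (intro sum_mono mult_left_mono powr_tangent) auto
  also have "(\<Sum>u\<in>U. p u * (b powr q + q * b powr (q - 1) * (s u - b)))
      = c * b powr q + q * b powr (q - 1) * (b - c * b)"
  proof -
    have "(\<Sum>u\<in>U. p u * (b powr q + q * b powr (q - 1) * (s u - b)))
        = (\<Sum>u\<in>U. p u) * b powr q + q * b powr (q - 1) * ((\<Sum>u\<in>U. p u * s u) - (\<Sum>u\<in>U. p u) * b)"
      by (simp add: sum.distrib sum_subtractf sum_distrib_left sum_distrib_right algebra_simps)
    then show ?thesis
      unfolding b_def [symmetric] c_def [symmetric] .
  qed
  also have "q * b powr (q - 1) * (b - c * b) = q * (1 - c) * (b powr (q - 1) * b)"
    by (simp add: algebra_simps)
  finally have le: "c * b powr q + q * (1 - c) * b powr q \<le> (\<Sum>u\<in>U. p u * s u powr q)"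
    by (simp only: powr_minus_one_mult [OF b, of q])
  have "1 * (1 - c) \<le> q * (1 - c)"
    using assms by (intro mult_right_mono) (auto simp: c_def)
  then have "1 * b powr q \<le> (c + q * (1 - c)) * b powr q"
    by (intro mult_right_mono) auto
  then show ?thesis
    using le by (simp add: b_def distrib_right)
qed

text \<open>Up to an error of norm \<open>\<epsilon>\<close>, \<open>K\<close> is \<open>\<Sum> s\<^sub>u \<langle>u, \<cdot>\<rangle> v\<^sub>u\<close> with finitely many singular
  values, and \<open>\<bar>\<langle>f\<^sub>i, K e\<^sub>i\<rangle>\<bar>\<close> is at most \<open>\<Sum> s\<^sub>u p\<^sub>i\<^sub>u\<close> for a matrix \<open>p\<close> whose row and column sums
  are at most 1; the claim is Jensen's inequality in each row.\<close>

proposition schatten_class_imp_schatten_bound: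
  assumes K: "K \<in> schatten_class q" and "q \<ge> 1"
  shows "schatten_bound q (schatten_norm q K) K"
  unfolding schatten_bound_def
proof (intro allI impI)
  fix n and e f :: "nat \<Rightarrow> 'a"
  assume e: "bessel n e" and f: "bessel n f"
  have cpt: "compact_operator K"
    and summable: "(\<lambda>s. real (sv_multiplicity K s) * s powr q) summable_on singular_values K"
    using K by (simp_all add: schatten_class_def)
  have lin: "bounded_clinear K"
    using cpt by (simp add: compact_operator_def)
  define S where "S = (\<Sum>\<^sub>\<infinity>s\<in>singular_values K. real (sv_multiplicity K s) * s powr q)"
  have "S \<ge> 0"
    unfolding S_def by (intro infsum_nonneg) simp
  then have norm_powr: "schatten_norm q K powr q = S"
    unfolding schatten_norm_def S_def [symmetric] using \<open>q \<ge> 1\<close> by (simp add: powr_powr)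
  \<comment> \<open>The terms are truncated by the norm of the remainder, which is removed at the end by \<open>\<epsilon> \<rightarrow> 0\<close>.\<close>
  have truncated: "(\<Sum>i<n. max 0 (cmod (cinner (f i) (K (e i))) - \<epsilon>) powr q) \<le> S" if "\<epsilon> > 0" for \<epsilon>
  proof -
    obtain U where U: "finite U" "orthonormal U" "\<And>u. u \<in> U \<Longrightarrow> \<exists>s\<ge>\<epsilon>. u \<in> sv_eigenspace K s"
        "\<And>x. (\<And>u. u \<in> U \<Longrightarrow> cinner u x = 0) \<Longrightarrow> norm (K x) \<le> \<epsilon> * norm x"
        "\<And>s. s \<ge> \<epsilon> \<Longrightarrow> card (U \<inter> sv_eigenspace K s) = sv_multiplicity K s"
      using truncated_singular_system [OF cpt \<open>\<epsilon> > 0\<close>] by metis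
    define \<sigma> where "\<sigma> u = norm (K u)" for u
    have \<sigma>: "\<sigma> u \<ge> \<epsilon>" "u \<in> sv_eigenspace K (\<sigma> u)" if u: "u \<in> U" for u
    proof -
      obtain s where s: "s \<ge> \<epsilon>" "u \<in> sv_eigenspace K s"
        using U(3) u by blast
      have "\<sigma> u = s"
        using norm_sv_eigenspace [OF lin s(2)] s(1) \<open>\<epsilon> > 0\<close> orthonormal_norm [OF U(2) u]
        by (simp add: \<sigma>_def)
      then show "\<sigma> u \<ge> \<epsilon>" "u \<in> sv_eigenspace K (\<sigma> u)"
        using s by auto
    qed
    have level: "{u \<in> U. \<sigma> u = s} = U \<inter> sv_eigenspace K s" if "s \<ge> \<epsilon>" for s
      using \<sigma>(2) norm_sv_eigenspace [OF lin, of _ s] orthonormal_norm [OF U(2)] that \<open>\<epsilon> > 0\<close>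
      by (auto simp: \<sigma>_def)
    have "(\<Sum>u\<in>U. \<sigma> u powr q) = (\<Sum>s\<in>\<sigma> ` U. \<Sum>u\<in>{u \<in> U. \<sigma> u = s}. \<sigma> u powr q)"
      by (rule sum.image_gen [OF U(1)])
    also have "\<dots> = (\<Sum>s\<in>\<sigma> ` U. real (sv_multiplicity K s) * s powr q)"
    proof (rule sum.cong [OF refl])
      fix s assume "s \<in> \<sigma> ` U"
      then have "s \<ge> \<epsilon>"
        using \<sigma>(1) by blast
      have "(\<Sum>u\<in>{u \<in> U. \<sigma> u = s}. \<sigma> u powr q) = (\<Sum>u\<in>{u \<in> U. \<sigma> u = s}. s powr q)"
        by (intro sum.cong) auto
      then show "(\<Sum>u\<in>{u \<in> U. \<sigma> u = s}. \<sigma> u powr q) = real (sv_multiplicity K s) * s powr q"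
        using U(5) level \<open>s \<ge> \<epsilon>\<close> by simp
    qed
    also have "\<dots> \<le> S"
      unfolding S_def
    proof (rule finite_sum_le_infsum [OF summable])
      show "\<sigma> ` U \<subseteq> singular_values K"
      proof
        fix s assume "s \<in> \<sigma> ` U"
        then obtain u where u: "u \<in> U" "s = \<sigma> u" by blast
        have "u \<noteq> 0"
          using orthonormal_norm [OF U(2) u(1)] by auto
        then show "s \<in> singular_values K"
          using \<sigma> [OF u(1)] u(2) \<open>\<epsilon> > 0\<close> by (auto simp: singular_values_def)
      qed
    qed (use U in auto)
    finally have sum_\<sigma>: "(\<Sum>u\<in>U. \<sigma> u powr q) \<le> S" .
    define v where "v u = inverse (\<sigma> u) *\<^sub>R K u" for u
    have \<sigma>_pos: "\<sigma> u > 0" if "u \<in> U" for u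
      using \<sigma>(1) [OF that] \<open>\<epsilon> > 0\<close> by simp
    have v: "cinner (v u) (v u') = (if u = u' then 1 else 0)" if u: "u \<in> U" "u' \<in> U" for u u'
    proof -
      have "cinner (K u) (K u') = complex_of_real ((\<sigma> u')\<^sup>2) * (if u = u' then 1 else 0)"
        using U(2) u unfolding cinner_sv_eigenspace [OF lin \<sigma>(2) [OF u(2)]] orthonormal_def by simp
      then show ?thesis
        using \<sigma>_pos [OF u(2)]
        by (auto simp: v_def cinner_scaleR_left cinner_scaleR_right scaleR_conv_of_real [where 'a=complex]
            power2_eq_square divide_simps)
    qed
    note orth_v = orthonormal_image(1) [of U v, OF v] and inj_v = orthonormal_image(2) [of U v, OF v]
    define p where "p i u = ((cmod (cinner u (e i)))\<^sup>2 + (cmod (cinner (f i) (v u)))\<^sup>2) / 2" for i u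
    have p_nonneg: "p i u \<ge> 0" for i u
      by (simp add: p_def)
    have row: "(\<Sum>u\<in>U. p i u) \<le> 1" if "i < n" for i
    proof -
      have "(\<Sum>u\<in>U. (cmod (cinner (f i) (v u)))\<^sup>2) = (\<Sum>w\<in>v ` U. (cmod (cinner w (f i)))\<^sup>2)"
        by (simp add: sum.reindex inj_v cmod_cinner_commute [of "f i"])
      also have "\<dots> \<le> (norm (f i))\<^sup>2"
        by (rule bessel_inequality [OF _ orth_v]) (simp add: U)
      also have "\<dots> \<le> 1"
        using bessel_norm_le [OF f that] by (simp add: power_le_one)
      finally have "(\<Sum>u\<in>U. (cmod (cinner (f i) (v u)))\<^sup>2) \<le> 1" .
      moreover have "(\<Sum>u\<in>U. (cmod (cinner u (e i)))\<^sup>2) \<le> 1"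
        using bessel_inequality [OF U(1,2), of "e i"] bessel_norm_le [OF e that]
        by (meson norm_ge_zero order_trans power_le_one)
      ultimately show ?thesis
        by (simp add: p_def sum.distrib flip: sum_divide_distrib)
    qed
    have column: "(\<Sum>i<n. p i u) \<le> 1" if "u \<in> U" for u
    proof -
      have "norm (v u) = 1"
        using \<sigma>_pos [OF that] by (simp add: v_def \<sigma>_def)
      then have "(\<Sum>i<n. (cmod (cinner (f i) (v u)))\<^sup>2) \<le> 1"
        using bessel_sum_le [OF f, of "v u"] by simp
      moreover have "(\<Sum>i<n. (cmod (cinner u (e i)))\<^sup>2) \<le> 1"
        using bessel_sum_le [OF e, of u] orthonormal_norm [OF U(2) that]
        by (simp add: cmod_cinner_commute [of u])
      ultimately show ?thesis
        by (simp add: p_def sum.distrib flip: sum_divide_distrib)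
    qed
    have entry: "max 0 (cmod (cinner (f i) (K (e i))) - \<epsilon>) \<le> (\<Sum>u\<in>U. p i u * \<sigma> u)" if "i < n" for i
    proof -
      define r where "r = e i - oproj U (e i)"
      have "norm (K r) \<le> \<epsilon> * norm r"
        unfolding r_def by (intro U(4) oproj_residual_orthogonal [OF U(1,2)])
      also have "\<dots> \<le> \<epsilon> * 1"
        using norm_oproj_residual_le [OF U(1,2), of "e i"] bessel_norm_le [OF e that] \<open>\<epsilon> > 0\<close>
        unfolding r_def by (intro mult_left_mono) auto
      finally have "norm (K r) \<le> \<epsilon>" by simp
      then have "norm (f i) * norm (K r) \<le> 1 * \<epsilon>"
        using bessel_norm_le [OF f that] by (intro mult_mono) auto
      then have rest: "cmod (cinner (f i) (K r)) \<le> \<epsilon>"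
        using cmod_cinner_le [of "f i" "K r"] by simp
      have "K (oproj U (e i)) = (\<Sum>u\<in>U. cinner u (e i) *\<^sub>C K u)"
        by (simp add: oproj_def bounded_clinear_sum [OF lin] bounded_clinear_scaleC [OF lin])
      also have "\<dots> = (\<Sum>u\<in>U. cinner u (e i) *\<^sub>C (\<sigma> u *\<^sub>R v u))"
      proof (intro sum.cong refl)
        show "cinner u (e i) *\<^sub>C K u = cinner u (e i) *\<^sub>C (\<sigma> u *\<^sub>R v u)" if "u \<in> U" for u
          using \<sigma>_pos [OF that] by (simp add: v_def)
      qed
      finally have "cinner (f i) (K (oproj U (e i))) = (\<Sum>u\<in>U. cinner u (e i) * (\<sigma> u *\<^sub>R cinner (f i) (v u)))"
        by (simp add: cinner.sum_right cinner_scaleC_right cinner_scaleR_right)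
      then have "cmod (cinner (f i) (K (oproj U (e i))))
          \<le> (\<Sum>u\<in>U. cmod (cinner u (e i) * (\<sigma> u *\<^sub>R cinner (f i) (v u))))"
        by (simp only: norm_sum)
      also have "\<dots> \<le> (\<Sum>u\<in>U. p i u * \<sigma> u)"
      proof (rule sum_mono)
        fix u assume u: "u \<in> U"
        have "cmod (cinner u (e i)) * cmod (cinner (f i) (v u)) \<le> p i u"
          using sum_squares_bound [of "cmod (cinner u (e i))" "cmod (cinner (f i) (v u))"]
          by (simp add: p_def)
        from mult_left_mono [OF this, of "\<sigma> u"] \<sigma>_pos [OF u]
        show "cmod (cinner u (e i) * (\<sigma> u *\<^sub>R cinner (f i) (v u))) \<le> p i u * \<sigma> u"
          by (simp add: norm_mult mult_ac)
      qed
      finally have main: "cmod (cinner (f i) (K (oproj U (e i)))) \<le> (\<Sum>u\<in>U. p i u * \<sigma> u)" .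
      have "K (e i) = K (oproj U (e i)) + K r"
        by (simp add: r_def bounded_clinear_diff [OF lin])
      then have "cmod (cinner (f i) (K (e i)))
          \<le> cmod (cinner (f i) (K (oproj U (e i)))) + cmod (cinner (f i) (K r))"
        by (simp add: cinner_add_right norm_triangle_ineq)
      moreover have "0 \<le> (\<Sum>u\<in>U. p i u * \<sigma> u)"
        using p_nonneg by (intro sum_nonneg) (simp add: \<sigma>_def)
      ultimately show ?thesis
        using main rest by simp
    qed
    have "(\<Sum>i<n. max 0 (cmod (cinner (f i) (K (e i))) - \<epsilon>) powr q)
        \<le> (\<Sum>i<n. (\<Sum>u\<in>U. p i u * \<sigma> u) powr q)"
      using entry \<open>q \<ge> 1\<close> by (intro sum_mono powr_mono2) auto
    also have "\<dots> \<le> (\<Sum>i<n. \<Sum>u\<in>U. p i u * \<sigma> u powr q)"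
      using row p_nonneg U(1) \<open>q \<ge> 1\<close> by (intro sum_mono jensen_powr) (auto simp: \<sigma>_def)
    also have "\<dots> = (\<Sum>u\<in>U. (\<Sum>i<n. p i u) * \<sigma> u powr q)"
      by (subst sum.swap) (simp add: sum_distrib_right)
    also have "\<dots> \<le> (\<Sum>u\<in>U. 1 * \<sigma> u powr q)"
      by (intro sum_mono mult_right_mono column) auto
    finally show ?thesis
      using sum_\<sigma> by simp
  qed
  have "((\<lambda>\<epsilon>. \<Sum>i<n. max 0 (cmod (cinner (f i) (K (e i))) - \<epsilon>) powr q)
      \<longlongrightarrow> (\<Sum>i<n. max 0 (cmod (cinner (f i) (K (e i))) - 0) powr q)) (at_right 0)"
    using \<open>q \<ge> 1\<close> by (intro tendsto_intros tendsto_powr') auto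
  then have "(\<Sum>i<n. max 0 (cmod (cinner (f i) (K (e i))) - 0) powr q) \<le> S"
  proof (rule tendsto_upperbound)
    show "\<forall>\<^sub>F \<epsilon> in at_right 0. (\<Sum>i<n. max 0 (cmod (cinner (f i) (K (e i))) - \<epsilon>) powr q) \<le> S"
      using eventually_at_right_less [of 0] by eventually_elim (rule truncated)
  qed simp
  then show "(\<Sum>i<n. cmod (cinner (f i) (K (e i))) powr q) \<le> schatten_norm q K powr q"
    by (simp add: norm_powr)
qed

section \<open>Vector-valued integrals\<close>

text \<open>The integrands below are products with \<open>A S(s)\<close>, which is meaningless at \<open>s = 0\<close>.\<close>

lemma has_integral_norm_le_singular:
  fixes f :: "real \<Rightarrow> 'a::banach" and g :: "real \<Rightarrow> real"
  assumes f: "(f has_integral I) {0..t}" and g: "g integrable_on {0..t}"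
    and fg: "\<And>s. 0 < s \<Longrightarrow> s \<le> t \<Longrightarrow> norm (f s) \<le> g s"
  shows "norm I \<le> integral {0..t} g"
proof -
  define f' g' where "f' s = (if s = 0 then 0 else f s)" and "g' s = (if s = 0 then 0 else g s)" for s
  have spike: "(f' has_integral I) {0..t}" "(g' has_integral integral {0..t} g) {0..t}"
    using has_integral_spike [OF negligible_sing [of 0] _ f, of f']
      has_integral_spike [OF negligible_sing [of 0] _ integrable_integral [OF g], of g']
    by (simp_all add: f'_def g'_def)
  have "norm (integral {0..t} f') \<le> integral {0..t} g'"
    using spike fg by (intro Henstock_Kurzweil_Integration.integral_norm_bound_integral)
      (auto simp: f'_def g'_def)
  then show ?thesis
    using spike by (simp add: integral_unique)
qed

text \<open>Near 0 the function \<open>F\<close> oscillates at most as much as \<open>\<Gamma>\<close>, so it is Cauchy there.\<close>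

lemma extend_to_0:
  fixes F :: "real \<Rightarrow> 'a::complete_space" and \<Gamma> :: "real \<Rightarrow> real"
  assumes "continuous_on {0..t} \<Gamma>" "t > 0"
    and F_dist: "\<And>a b. a \<in> {0<..t} \<Longrightarrow> b \<in> {0<..t} \<Longrightarrow> dist (F b) (F a) \<le> dist (\<Gamma> b) (\<Gamma> a)"
  obtains G where "continuous_on {0..t} G" "\<And>s. s \<in> {0<..t} \<Longrightarrow> F s = G s"
proof -
  have \<Gamma>_cont: "uniformly_continuous_on {0..t} \<Gamma>"
    by (intro compact_uniformly_continuous assms(1) compact_Icc)
  have "uniformly_continuous_on {0<..t} F"
    unfolding uniformly_continuous_on_def
  proof (intro allI impI)
    fix e :: real assume "e > 0"
    then obtain d where d: "d > 0"
        "\<forall>a\<in>{0..t}. \<forall>b\<in>{0..t}. dist b a < d \<longrightarrow> dist (\<Gamma> b) (\<Gamma> a) < e"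
      using \<Gamma>_cont unfolding uniformly_continuous_on_def by meson
    have "dist (F b) (F a) < e" if ab: "a \<in> {0<..t}" "b \<in> {0<..t}" "dist b a < d" for a b
    proof -
      have "dist (\<Gamma> b) (\<Gamma> a) < e"
        using d(2) ab by simp
      then show ?thesis
        using F_dist [OF ab(1,2)] by simp
    qed
    then show "\<exists>d>0. \<forall>a\<in>{0<..t}. \<forall>b\<in>{0<..t}. dist b a < d \<longrightarrow> dist (F b) (F a) < e"
      using d(1) by blast
  qed
  then obtain G where G: "uniformly_continuous_on (closure {0<..t}) G" "\<And>s. s \<in> {0<..t} \<Longrightarrow> F s = G s"
    using uniformly_continuous_on_extension_on_closure by metis
  have "continuous_on {0..t} G"
    using uniformly_continuous_imp_continuous [OF G(1)] \<open>t > 0\<close> by simp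
  then show thesis
    using G(2) that by blast
qed

text \<open>The antiderivative on \<open>(0, t]\<close> extends continuously to 0, because it oscillates at most as much as
  that of the majorant \<open>g\<close>; the fundamental theorem of calculus tolerates the exceptional endpoint.\<close>

lemma integrable_singular:
  fixes f :: "real \<Rightarrow> 'a::banach" and g :: "real \<Rightarrow> real"
  assumes f: "continuous_on {0<..t} f" and g: "g integrable_on {0..t}"
    and fg: "\<And>s. 0 < s \<Longrightarrow> s \<le> t \<Longrightarrow> norm (f s) \<le> g s"
  shows "f integrable_on {0..t}" "norm (integral {0..t} f) \<le> integral {0..t} g"
proof -
  show int: "f integrable_on {0..t}"
  proof (cases "t > 0")
    case True
    define F where "F s = - integral {s..t} f" for s
    define \<Gamma> where "\<Gamma> s = integral {0..s} g" for s
    have f_int: "f integrable_on {a..b}" if "0 < a" "b \<le> t" for a b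
      using that by (intro integrable_continuous_real continuous_on_subset [OF f]) auto
    have g_int: "g integrable_on {a..b}" if "0 \<le> a" "b \<le> t" for a b
      using that by (intro integrable_on_subinterval [OF g]) auto
    have F_diff: "norm (F b - F a) \<le> \<bar>\<Gamma> b - \<Gamma> a\<bar>" if "0 < a" "a \<le> b" "b \<le> t" for a b
    proof -
      have "F b - F a = integral {a..b} f"
        using Henstock_Kurzweil_Integration.integral_combine [of a b t f] f_int [of a t] that
        by (simp add: F_def algebra_simps)
      moreover have "\<Gamma> b - \<Gamma> a = integral {a..b} g"
        using Henstock_Kurzweil_Integration.integral_combine [of 0 a b g] g_int [of 0 b] that
        by (simp add: \<Gamma>_def algebra_simps)
      moreover have "norm (integral {a..b} f) \<le> integral {a..b} g"
        using that f_int g_int fg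
        by (intro Henstock_Kurzweil_Integration.integral_norm_bound_integral) auto
      ultimately show ?thesis by simp
    qed
    then have F_dist: "dist (F b) (F a) \<le> dist (\<Gamma> b) (\<Gamma> a)" if "a \<in> {0<..t}" "b \<in> {0<..t}" for a b
      using that F_diff [of a b] F_diff [of b a]
      by (cases "a \<le> b") (auto simp: dist_norm norm_minus_commute abs_minus_commute)
    have "continuous_on {0..t} \<Gamma>"
      unfolding \<Gamma>_def by (rule indefinite_integral_continuous_1 [OF g])
    from extend_to_0 [OF this True F_dist]
    obtain G where G_cont: "continuous_on {0..t} G" and G: "\<And>s. s \<in> {0<..t} \<Longrightarrow> F s = G s"
      by metis
    have "(f has_integral (G t - G 0)) {0..t}"
    proof (rule fundamental_theorem_of_calculus_interior [OF less_imp_le [OF True] G_cont])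
      fix s assume s: "s \<in> {0<..<t}"
      define a where "a = s / 2"
      have a: "0 < a" "a < s"
        using s by (simp_all add: a_def)
      have "((\<lambda>u. integral {a..u} f) has_vector_derivative f s) (at s within {a..t})"
        using s a by (intro integral_has_vector_derivative continuous_on_subset [OF f]) auto
      then have "((\<lambda>u. integral {a..u} f) has_vector_derivative f s) (at s)"
        using s a by (simp add: at_within_Icc_at)
      then have "((\<lambda>u. integral {a..u} f - integral {a..t} f) has_vector_derivative f s) (at s)"
        by (auto intro!: derivative_eq_intros)
      then show "(G has_vector_derivative f s) (at s)"
      proof (rule has_vector_derivative_transform_within_open)
        show "open {a<..<t}" "s \<in> {a<..<t}"
          using s a by auto
        fix u assume u: "u \<in> {a<..<t}"
        then have "integral {a..u} f - integral {a..t} f = F u"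
          using Henstock_Kurzweil_Integration.integral_combine [of a u t f] f_int [of a t] a
          by (simp add: F_def algebra_simps)
        then show "integral {a..u} f - integral {a..t} f = G u"
          using G [of u] u a by simp
      qed
    qed
    then show ?thesis by blast
  next
    case False
    then show ?thesis
      using integrable_on_refl [of f 0] by (cases "t = 0") auto
  qed
  show "norm (integral {0..t} f) \<le> integral {0..t} g"
    by (rule has_integral_norm_le_singular [OF integrable_integral [OF int] g fg])
qed

text \<open>The supremum of \<open>f\<close> over the remaining interval is monotone, hence measurable, and exceeds \<open>f\<close> by
  a factor of at most \<open>M\<close>.  The integral of \<open>f\<close> itself is a lower integral.\<close>

lemma decreasing_majorant:
  fixes f :: "real \<Rightarrow> real"
  assumes nonneg: "\<And>t. 0 < t \<Longrightarrow> t \<le> 1 \<Longrightarrow> 0 \<le> f t"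
    and quasi: "\<And>s t. 0 < s \<Longrightarrow> s \<le> t \<Longrightarrow> t \<le> 1 \<Longrightarrow> f t \<le> M * f s" and "M > 0"
    and finite: "(\<integral>\<^sup>+t\<in>{0<..1}. ennreal (f t) \<partial>lborel) < \<infinity>"
  obtains g where "\<And>t. 0 < t \<Longrightarrow> t \<le> 1 \<Longrightarrow> f t \<le> g t"
    "\<And>s t. 0 < s \<Longrightarrow> s \<le> t \<Longrightarrow> t \<le> 1 \<Longrightarrow> g t \<le> g s" "g integrable_on {0..1}"
proof -
  define G where "G t = (SUP s\<in>{t..1}. f s)" for t
  have bdd: "bdd_above (f ` {t..1})" if "0 < t" for t
    using quasi [OF that] by (intro bdd_aboveI2 [where M = "M * f t"]) auto
  have f_G: "f t \<le> G t" if "0 < t" "t \<le> 1" for t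
    unfolding G_def using that by (intro cSUP_upper bdd) auto
  have G_f: "G t \<le> M * f t" if "0 < t" "t \<le> 1" for t
    unfolding G_def using that quasi by (intro cSUP_least) auto
  have anti: "G t \<le> G s" if "0 < s" "s \<le> t" "t \<le> 1" for s t
    unfolding G_def using that by (intro cSUP_subset_mono bdd) auto
  define g where "g t = indicator {0<..1} t *\<^sub>R G t" for t :: real
  have G_nonneg: "0 \<le> G t" if "0 < t" "t \<le> 1" for t
    using f_G [OF that] nonneg [OF that] by simp
  have "mono_on {0<..1} (\<lambda>t. - G t)"
    using anti by (auto simp: mono_on_def)
  then have "(\<lambda>t. - G t) \<in> borel_measurable (restrict_space borel {0<..1})"
    by (rule borel_measurable_mono_on_fnc)
  from borel_measurable_uminus [OF this]
  have "G \<in> borel_measurable (restrict_space borel {0<..1})"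
    by simp
  then have g_meas: "g \<in> borel_measurable borel"
    unfolding g_def by (subst (asm) borel_measurable_restrict_space_iff) auto
  have "(\<integral>\<^sup>+t. ennreal (g t) \<partial>lborel) = (\<integral>\<^sup>+t. ennreal M * ennreal (g t / M) \<partial>lborel)"
    using \<open>M > 0\<close> by (simp flip: ennreal_mult')
  also have "\<dots> = ennreal M * (\<integral>\<^sup>+t. ennreal (g t / M) \<partial>lborel)"
    using g_meas by (intro nn_integral_cmult) simp
  also have "\<dots> \<le> ennreal M * (\<integral>\<^sup>+t\<in>{0<..1}. ennreal (f t) \<partial>lborel)"
    using G_f \<open>M > 0\<close>
    by (intro mult_left_mono nn_integral_mono)
      (auto simp: g_def indicator_def pos_divide_le_eq mult.commute intro!: ennreal_leI)
  also have "\<dots> < \<infinity>"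
    using finite by (simp add: ennreal_mult_less_top)
  finally have "integrable lborel g"
    using g_meas G_nonneg by (intro integrableI_nonneg) (auto simp: g_def indicator_def)
  then have "g integrable_on UNIV"
    using has_integral_integral_lborel by blast
  moreover have "g = (\<lambda>t. if t \<in> {0..1} then g t else 0)"
    by (auto simp: g_def indicator_def fun_eq_iff)
  ultimately have "g integrable_on {0..1}"
    by (metis integrable_restrict_UNIV)
  then show thesis
    using that [of g] f_G anti by (simp add: g_def)
qed

lemma average_tendsto_at_right:
  fixes f :: "real \<Rightarrow> 'a::banach"
  assumes f: "continuous_on {a..} f"
  shows "((\<lambda>k. integral {a..a + k} f /\<^sub>R k) \<longlongrightarrow> f a) (at_right 0)"
proof (rule tendstoI)
  fix e :: real
  assume "e > 0"
  then obtain d where d: "d > 0" "\<And>s. s \<in> {a..} \<Longrightarrow> dist s a < d \<Longrightarrow> dist (f s) (f a) < e / 2"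
    using f unfolding continuous_on_iff by (metis atLeast_iff order_refl half_gt_zero)
  have "dist (integral {a..a + k} f /\<^sub>R k) (f a) < e" if k: "0 < k" "k < d" for k
  proof -
    have int: "f integrable_on {a..a + k}"
      by (intro integrable_continuous_real continuous_on_subset [OF f]) auto
    have "integral {a..a + k} f - k *\<^sub>R f a = integral {a..a + k} (\<lambda>s. f s - f a)"
      using Henstock_Kurzweil_Integration.integral_diff [OF int integrable_const_ivl, of "f a"] k by simp
    also have "norm \<dots> \<le> integral {a..a + k} (\<lambda>s. e / 2)"
      using int k d(2) by (intro Henstock_Kurzweil_Integration.integral_norm_bound_integral)
        (auto simp: dist_norm intro!: integrable_diff less_imp_le)
    finally have *: "norm (integral {a..a + k} f - k *\<^sub>R f a) \<le> k * (e / 2)"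
      using k by simp
    have "integral {a..a + k} f /\<^sub>R k - f a = (integral {a..a + k} f - k *\<^sub>R f a) /\<^sub>R k"
      using k by (simp add: scaleR_diff_right)
    then have "norm (integral {a..a + k} f /\<^sub>R k - f a) = norm (integral {a..a + k} f - k *\<^sub>R f a) / k"
      using k by (simp add: divide_inverse mult.commute)
    also have "\<dots> \<le> e / 2"
      using * k by (simp add: pos_divide_le_eq mult.commute)
    finally show ?thesis
      using \<open>e > 0\<close> by (simp add: dist_norm)
  qed
  then show "\<forall>\<^sub>F k in at_right 0. dist (integral {a..a + k} f /\<^sub>R k) (f a) < e"
    using d(1) unfolding eventually_at_right_field by blast
qed

section \<open>Strongly continuous semigroups\<close>

text \<open>By Baire's theorem some sublevel set of \<open>sup\<^sub>n \<parallel>T\<^sub>n x\<parallel>\<close> contains a ball.\<close>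

lemma uniform_boundedness:
  fixes T :: "nat \<Rightarrow> 'a::banach \<Rightarrow> 'b::real_normed_vector"
  assumes T: "\<And>n. bounded_linear (T n)" and bounded: "\<And>x. \<exists>c. \<forall>n. norm (T n x) \<le> c"
  obtains C where "\<And>n x. norm (T n x) \<le> C * norm x"
proof -
  define E where "E k = {x. \<forall>n. norm (T n x) \<le> real k}" for k :: nat
  have closed: "closed (E k)" for k
  proof -
    have "E k = (\<Inter>n. {x. norm (T n x) \<le> real k})"
      by (auto simp: E_def)
    also have "closed \<dots>"
      by (intro closed_INT ballI closed_Collect_le continuous_intros linear_continuous_on T)
    finally show ?thesis .
  qed
  have "x \<in> \<Union>(range E)" for x
  proof -
    obtain c where c: "\<And>n. norm (T n x) \<le> c"
      using bounded by blast
    have "norm (T n x) \<le> real (nat \<lceil>c\<rceil>)" for n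
      using c [of n] real_nat_ceiling_ge [of c] by linarith
    then have "x \<in> E (nat \<lceil>c\<rceil>)"
      by (simp add: E_def)
    then show ?thesis by blast
  qed
  then have "\<Union>(range E) = UNIV"
    by blast
  have "\<exists>k. interior (E k) \<noteq> {}"
  proof (rule ccontr)
    assume "\<not> ?thesis"
    then have "Met_TC.mtopology interior_of \<Union>(range E) = {}"
      using closed by (intro Met_TC.metric_Baire_category_alt) (auto simp: complete_UNIV)
    then show False
      using \<open>\<Union>(range E) = UNIV\<close> by simp
  qed
  then obtain k z r where r: "r > 0" "cball z r \<subseteq> E k"
    by (metis all_not_in_conv mem_interior_cball)
  have small: "norm (T n y) \<le> 2 * real k" if "norm y \<le> r" for n y
  proof -
    interpret bounded_linear "T n" by (rule T)
    have "z + y \<in> E k" "z \<in> E k"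
      using r that by (auto simp: dist_norm subset_iff)
    then have "norm (T n (z + y)) \<le> real k" "norm (T n z) \<le> real k"
      by (simp_all add: E_def)
    then show ?thesis
      using norm_triangle_ineq4 [of "T n (z + y)" "T n z"] by (simp add: add)
  qed
  have "norm (T n x) \<le> 2 * real k / r * norm x" for n x
  proof (cases "x = 0")
    case True
    interpret bounded_linear "T n" by (rule T)
    show ?thesis using True by (simp add: zero)
  next
    case False
    interpret bounded_linear "T n" by (rule T)
    have "norm (T n ((r / norm x) *\<^sub>R x)) \<le> 2 * real k"
      using r False by (intro small) simp
    then show ?thesis
      using r False by (simp add: scaleR field_simps)
  qed
  then show thesis by (rule that)
qed

lemma C0_semigroup_bounded_clinear: "C0_semigroup S \<Longrightarrow> t \<ge> 0 \<Longrightarrow> bounded_clinear (S t)"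
  and C0_semigroup_0: "C0_semigroup S \<Longrightarrow> S 0 x = x"
  and C0_semigroup_add: "C0_semigroup S \<Longrightarrow> s \<ge> 0 \<Longrightarrow> t \<ge> 0 \<Longrightarrow> S (s + t) x = S s (S t x)"
  and C0_semigroup_tendsto: "C0_semigroup S \<Longrightarrow> ((\<lambda>t. S t x) \<longlongrightarrow> x) (at_right 0)"
  unfolding C0_semigroup_def by auto

text \<open>If there were no bound near 0, then \<open>\<parallel>S(t\<^sub>n)\<parallel>\<close> would be unbounded for some \<open>t\<^sub>n \<rightarrow> 0\<close>, against the
  uniform boundedness principle and \<open>S(t\<^sub>n) y \<rightarrow> y\<close>.  The semigroup law then multiplies the bounds.\<close>

lemma C0_semigroup_locally_bounded:
  assumes S: "C0_semigroup S"
  obtains M where "M \<ge> 1" "\<And>t x. 0 \<le> t \<Longrightarrow> t \<le> b \<Longrightarrow> norm (S t x) \<le> M * norm x"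
proof -
  have "\<exists>d>0. \<exists>M. \<forall>t x. 0 \<le> t \<longrightarrow> t \<le> d \<longrightarrow> norm (S t x) \<le> M * norm x"
  proof (rule ccontr)
    assume contr: "\<not> ?thesis"
    have "\<exists>t x. 0 \<le> t \<and> t \<le> inverse (real (Suc n)) \<and> norm (S t x) > real n * norm x" for n
      using contr by (meson inverse_positive_iff_positive not_le of_nat_0_less_iff zero_less_Suc)
    then obtain t x where t: "\<And>n. 0 \<le> t n" "\<And>n. t n \<le> inverse (real (Suc n))"
        "\<And>n. norm (S (t n) (x n)) > real n * norm (x n)"
      by metis
    have "\<exists>c. \<forall>n. norm (S (t n) y) \<le> c" for y
    proof -
      have t_lim: "t \<longlonglongrightarrow> 0"
        by (rule tendsto_sandwich [OF _ _ tendsto_const LIMSEQ_inverse_real_of_nat])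
          (use t in auto)
      have "(\<lambda>n. S (t n) y) \<longlonglongrightarrow> y"
      proof (rule tendstoI)
        fix e :: real assume "e > 0"
        then have "\<forall>\<^sub>F s in at_right 0. dist (S s y) y < e"
          using tendstoD [OF C0_semigroup_tendsto [OF S]] by blast
        then obtain d where d: "d > 0" "\<And>s. 0 < s \<Longrightarrow> s < d \<Longrightarrow> dist (S s y) y < e"
          unfolding eventually_at_right_field by blast
        have "\<forall>\<^sub>F n in sequentially. t n < d"
          using order_tendstoD(2) [OF t_lim d(1)] .
        then show "\<forall>\<^sub>F n in sequentially. dist (S (t n) y) y < e"
        proof eventually_elim
          case (elim n)
          show ?case
          proof (cases "t n = 0")
            case True
            then show ?thesis
              using \<open>e > 0\<close> by (simp add: C0_semigroup_0 [OF S])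
          next
            case False
            then show ?thesis
              using d(2) [of "t n"] t(1) [of n] elim by simp
          qed
        qed
      qed
      then have "Bseq (\<lambda>n. S (t n) y)"
        by (intro convergent_imp_Bseq convergentI)
      then show ?thesis
        unfolding Bseq_def by blast
    qed
    then obtain C where C: "\<And>n x. norm (S (t n) x) \<le> C * norm x"
      using uniform_boundedness [of "\<lambda>n. S (t n)"] t(1) C0_semigroup_bounded_clinear [OF S]
        bounded_clinear_imp_bounded_linear by metis
    obtain n where n: "C \<le> real n"
      using real_arch_simple by blast
    have "real n * norm (x n) < C * norm (x n)"
      using t(3) [of n] C [of n "x n"] by linarith
    then show False
      using mult_right_mono [OF n norm_ge_zero [of "x n"]] by linarith
  qed
  then obtain d M0 where d: "d > 0" "\<And>t x. 0 \<le> t \<Longrightarrow> t \<le> d \<Longrightarrow> norm (S t x) \<le> M0 * norm x"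
    by blast
  define M where "M = max 1 M0"
  have M: "norm (S t x) \<le> M * norm x" if "0 \<le> t" "t \<le> d" for t x
    using d(2) [OF that, of x] mult_right_mono [of M0 M "norm x"] by (simp add: M_def)
  have "M \<ge> 1" by (simp add: M_def)
  have multiple: "norm (S t x) \<le> M ^ n * norm x" if "0 \<le> t" "t \<le> real n * d" for n t x
    using that
  proof (induction n arbitrary: t x)
    case 0
    then show ?case by (simp add: C0_semigroup_0 [OF S])
  next
    case (Suc n)
    show ?case
    proof (cases "t \<le> d")
      case True
      have "norm (S t x) \<le> M * norm x"
        by (rule M [OF Suc.prems(1) True])
      also have "\<dots> \<le> M ^ Suc n * norm x"
        using \<open>M \<ge> 1\<close> by (intro mult_right_mono self_le_power) auto
      finally show ?thesis .
    next
      case False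
      then have "norm (S (t - d) x) \<le> M ^ n * norm x"
        using Suc.prems d(1) by (intro Suc.IH) (auto simp: algebra_simps)
      then have "M * norm (S (t - d) x) \<le> M * (M ^ n * norm x)"
        using \<open>M \<ge> 1\<close> by (intro mult_left_mono) auto
      moreover have "S t x = S d (S (t - d) x)"
        using C0_semigroup_add [OF S, of d "t - d" x] False d(1) by simp
      ultimately show ?thesis
        using M [of d "S (t - d) x"] d(1) by (simp add: mult.assoc)
    qed
  qed
  obtain n where "b / d \<le> real n"
    using real_arch_simple by blast
  then have "b \<le> real n * d"
    using d(1) by (simp add: pos_divide_le_eq)
  then show thesis
    using that [of "M ^ n"] multiple \<open>M \<ge> 1\<close> by (meson one_le_power order_trans)
qed

text \<open>Right continuity at \<open>t\<close> is that at 0; left continuity needs the local bound in addition.  Both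
  are covered by \<open>S(b) x - S(a) x = S(a) (S(b - a) x - x)\<close>.\<close>

lemma C0_semigroup_continuous_on:
  assumes S: "C0_semigroup S"
  shows "continuous_on {0..} (\<lambda>t. S t x)"
  unfolding continuous_on_iff
proof (intro ballI allI impI)
  fix t e :: real
  assume t: "t \<in> {0..}" and "e > 0"
  obtain M where M: "M \<ge> 1" "\<And>s y. 0 \<le> s \<Longrightarrow> s \<le> t + 1 \<Longrightarrow> norm (S s y) \<le> M * norm y"
    using C0_semigroup_locally_bounded [OF S, of "t + 1"] by blast
  have "\<forall>\<^sub>F h in at_right 0. dist (S h x) x < e / M"
    using tendstoD [OF C0_semigroup_tendsto [OF S]] \<open>e > 0\<close> M(1) by simp
  then obtain d where d: "d > 0" "\<And>h. 0 < h \<Longrightarrow> h < d \<Longrightarrow> dist (S h x) x < e / M"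
    unfolding eventually_at_right_field by blast
  have key: "dist (S b x) (S a x) < e" if ab: "0 \<le> a" "a \<le> b" "b \<le> t + 1" "b - a < d" for a b
  proof (cases "a = b")
    case False
    have "S b x - S a x = S a (S (b - a) x - x)"
      using C0_semigroup_add [OF S, of a "b - a" x] ab
      by (simp add: bounded_clinear_diff [OF C0_semigroup_bounded_clinear [OF S]])
    then have "dist (S b x) (S a x) \<le> M * norm (S (b - a) x - x)"
      using M(2) [of a] ab by (simp add: dist_norm)
    also have "\<dots> < M * (e / M)"
      using d(2) [of "b - a"] ab False M(1) by (intro mult_strict_left_mono) (auto simp: dist_norm)
    finally show ?thesis
      using M(1) by simp
  qed (use \<open>e > 0\<close> in simp)
  show "\<exists>d>0. \<forall>t'\<in>{0..}. dist t' t < d \<longrightarrow> dist (S t' x) (S t x) < e"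
  proof (intro exI [of _ "min d 1"] conjI ballI impI)
    fix t' assume t': "t' \<in> {0..}" "dist t' t < min d 1"
    show "dist (S t' x) (S t x) < e"
    proof (cases "t \<le> t'")
      case True
      then show ?thesis
        using t t' by (intro key) (auto simp: dist_real_def)
    next
      case False
      then have "dist (S t x) (S t' x) < e"
        using t t' by (intro key) (auto simp: dist_real_def)
      then show ?thesis
        by (simp add: dist_commute)
    qed
  qed (use d in simp)
qed

lemma C0_semigroup_integrable:
  "C0_semigroup S \<Longrightarrow> 0 \<le> a \<Longrightarrow> (\<lambda>t. S t x) integrable_on {a..b}"
  by (intro integrable_continuous_real continuous_on_subset [OF C0_semigroup_continuous_on]) auto

lemma bounded_linear_integral:
  fixes f :: "real \<Rightarrow> 'a::banach" and L :: "'a \<Rightarrow> 'b::banach"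
  assumes "bounded_linear L" "f integrable_on {a..b}"
  shows "L (integral {a..b} f) = integral {a..b} (\<lambda>t. L (f t))"
  using integral_linear [OF assms(2,1)] by (simp add: comp_def)

text \<open>The difference quotient is the difference of the averages of the orbit over \<open>[h, h + k]\<close> and
  \<open>[0, k]\<close>.\<close>

lemma C0_semigroup_generator_integral:
  assumes S: "C0_semigroup S" and "h \<ge> 0"
  shows "((\<lambda>k. (S k (integral {0..h} (\<lambda>r. S r x)) - integral {0..h} (\<lambda>r. S r x)) /\<^sub>R k)
    \<longlongrightarrow> S h x - x) (at_right 0)"
proof -
  let ?f = "\<lambda>r. S r x"
  note cont = C0_semigroup_continuous_on [OF S, of x]
  have "((\<lambda>k. integral {h..h + k} ?f /\<^sub>R k - integral {0..0 + k} ?f /\<^sub>R k) \<longlongrightarrow> S h x - S 0 x) (at_right 0)"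
    using \<open>h \<ge> 0\<close> by (intro tendsto_diff average_tendsto_at_right continuous_on_subset [OF cont]) auto
  moreover have "\<forall>\<^sub>F k in at_right 0. integral {h..h + k} ?f /\<^sub>R k - integral {0..0 + k} ?f /\<^sub>R k
      = (S k (integral {0..h} ?f) - integral {0..h} ?f) /\<^sub>R k"
    unfolding eventually_at_right_field
  proof (intro exI [of _ 1] conjI allI impI)
    fix k :: real assume k: "0 < k"
    have "S k (integral {0..h} ?f) = integral {0..h} (\<lambda>r. S k (S r x))"
      using k by (intro bounded_linear_integral bounded_clinear_imp_bounded_linear
          C0_semigroup_bounded_clinear [OF S] C0_semigroup_integrable [OF S]) auto
    also have "\<dots> = integral {0..h} (\<lambda>r. S (r + k) x)"
      using k C0_semigroup_add [OF S, of k _ x]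
      by (intro Henstock_Kurzweil_Integration.integral_cong) (simp add: add.commute)
    also have "\<dots> = integral {k..h + k} ?f"
    proof -
      have "(?f has_integral integral {k..h + k} ?f) {k..h + k}"
        using k by (intro integrable_integral C0_semigroup_integrable [OF S]) simp
      from integral_unique [OF has_integral_shift_real_ivl [OF this, of k]] show ?thesis
        by simp
    qed
    finally have "S k (integral {0..h} ?f) = integral {k..h + k} ?f" .
    moreover have "integral {0..k} ?f + integral {k..h + k} ?f = integral {0..h + k} ?f"
      using k \<open>h \<ge> 0\<close> C0_semigroup_integrable [OF S]
      by (intro Henstock_Kurzweil_Integration.integral_combine) auto
    moreover have "integral {0..h} ?f + integral {h..h + k} ?f = integral {0..h + k} ?f"
      using k \<open>h \<ge> 0\<close> C0_semigroup_integrable [OF S]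
      by (intro Henstock_Kurzweil_Integration.integral_combine) auto
    ultimately have "S k (integral {0..h} ?f) - integral {0..h} ?f = integral {h..h + k} ?f - integral {0..k} ?f"
      by (metis (no_types, lifting) add_diff_cancel_left diff_add_cancel diff_diff_eq2 add.commute)
    then show "integral {h..h + k} ?f /\<^sub>R k - integral {0..0 + k} ?f /\<^sub>R k
        = (S k (integral {0..h} ?f) - integral {0..h} ?f) /\<^sub>R k"
      by (simp add: scaleR_diff_right)
  qed simp
  ultimately have "((\<lambda>k. (S k (integral {0..h} ?f) - integral {0..h} ?f) /\<^sub>R k) \<longlongrightarrow> S h x - S 0 x)
      (at_right 0)"
    by (rule Lim_transform_eventually)
  then show ?thesis
    by (simp add: C0_semigroup_0 [OF S])
qed

text \<open>Commuting \<open>(S(k) - 1)/k\<close> with the integral reduces this to the preceding lemma.\<close>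

lemma C0_semigroup_integral_generator:
  assumes S: "C0_semigroup S" and "h \<ge> 0"
    and G: "((\<lambda>k. (S k x - x) /\<^sub>R k) \<longlongrightarrow> y) (at_right 0)"
  shows "S h x - x = integral {0..h} (\<lambda>r. S r y)"
proof -
  obtain M where M: "M \<ge> 1" "\<And>t z. 0 \<le> t \<Longrightarrow> t \<le> h \<Longrightarrow> norm (S t z) \<le> M * norm z"
    using C0_semigroup_locally_bounded [OF S] by blast
  define Q where "Q k = (S k x - x) /\<^sub>R k" for k
  have commute: "(S k (integral {0..h} (\<lambda>r. S r x)) - integral {0..h} (\<lambda>r. S r x)) /\<^sub>R k
      = integral {0..h} (\<lambda>r. S r (Q k))" if "k > 0" for k
  proof -
    have "S k (integral {0..h} (\<lambda>r. S r x)) = integral {0..h} (\<lambda>r. S k (S r x))"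
      using that by (intro bounded_linear_integral bounded_clinear_imp_bounded_linear
          C0_semigroup_bounded_clinear [OF S] C0_semigroup_integrable [OF S]) auto
    also have "\<dots> = integral {0..h} (\<lambda>r. S r (S k x))"
      using that C0_semigroup_add [OF S] by (intro Henstock_Kurzweil_Integration.integral_cong) (metis add.commute atLeastAtMost_iff less_imp_le)
    finally have "S k (integral {0..h} (\<lambda>r. S r x)) - integral {0..h} (\<lambda>r. S r x)
        = integral {0..h} (\<lambda>r. S r (S k x) - S r x)"
      by (simp add: Henstock_Kurzweil_Integration.integral_diff C0_semigroup_integrable [OF S])
    also have "\<dots> = integral {0..h} (\<lambda>r. k *\<^sub>R S r (Q k))"
      using that by (intro Henstock_Kurzweil_Integration.integral_cong)
        (simp add: Q_def bounded_clinear_diff bounded_clinear_scaleR C0_semigroup_bounded_clinear [OF S])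
    finally show ?thesis
      using that by simp
  qed
  have "((\<lambda>k. integral {0..h} (\<lambda>r. S r (Q k))) \<longlongrightarrow> integral {0..h} (\<lambda>r. S r y)) (at_right 0)"
  proof -
    have null: "((\<lambda>k. h * (M * norm (Q k - y))) \<longlongrightarrow> 0) (at_right 0)"
      using G by (intro tendsto_mult_right_zero tendsto_norm_zero) (simp add: Q_def LIM_zero)
    have "norm (integral {0..h} (\<lambda>r. S r (Q k)) - integral {0..h} (\<lambda>r. S r y)) \<le> h * (M * norm (Q k - y))" for k
    proof -
      have "integral {0..h} (\<lambda>r. S r (Q k)) - integral {0..h} (\<lambda>r. S r y) = integral {0..h} (\<lambda>r. S r (Q k) - S r y)"
        by (simp add: Henstock_Kurzweil_Integration.integral_diff C0_semigroup_integrable [OF S])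
      also have "\<dots> = integral {0..h} (\<lambda>r. S r (Q k - y))"
        by (intro Henstock_Kurzweil_Integration.integral_cong) (simp add: bounded_clinear_diff C0_semigroup_bounded_clinear [OF S])
      also have "norm \<dots> \<le> integral {0..h} (\<lambda>r. M * norm (Q k - y))"
        using M(2) by (intro Henstock_Kurzweil_Integration.integral_norm_bound_integral
            C0_semigroup_integrable [OF S]) auto
      finally show ?thesis
        using \<open>h \<ge> 0\<close> by (simp add: mult_ac)
    qed
    then show ?thesis
      by (intro LIM_zero_cancel [OF Lim_null_comparison [OF always_eventually null]] allI)
  qed
  moreover have "((\<lambda>k. integral {0..h} (\<lambda>r. S r (Q k))) \<longlongrightarrow> S h x - x) (at_right 0)"
  proof (rule Lim_transform_eventually [OF C0_semigroup_generator_integral [OF S \<open>h \<ge> 0\<close>]])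
    show "\<forall>\<^sub>F k in at_right 0. (S k (integral {0..h} (\<lambda>r. S r x)) - integral {0..h} (\<lambda>r. S r x)) /\<^sub>R k
        = integral {0..h} (\<lambda>r. S r (Q k))"
      using eventually_at_right_less [of 0] by eventually_elim (rule commute)
  qed
  ultimately show ?thesis
    using tendsto_unique trivial_limit_at_right_real by metis
qed

lemma C0_semigroup_rescale:
  assumes S: "C0_semigroup S"
  shows "C0_semigroup (\<lambda>t x. exp (- \<omega> * t) *\<^sub>R S t x)"
  unfolding C0_semigroup_def
proof (intro conjI allI impI)
  show "bounded_clinear (\<lambda>x. exp (- \<omega> * t) *\<^sub>R S t x)" if "0 \<le> t" for t
    unfolding scaleR_eq_scaleC
    by (rule bounded_clinear_cscale [OF C0_semigroup_bounded_clinear [OF S that]])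
  show "(\<lambda>x. exp (- \<omega> * 0) *\<^sub>R S 0 x) = id"
    by (simp add: fun_eq_iff C0_semigroup_0 [OF S])
  show "(\<lambda>x. exp (- \<omega> * (s + t)) *\<^sub>R S (s + t) x)
      = (\<lambda>x. exp (- \<omega> * s) *\<^sub>R S s x) \<circ> (\<lambda>x. exp (- \<omega> * t) *\<^sub>R S t x)" if "0 \<le> s" "0 \<le> t" for s t
  proof -
    have "exp (- \<omega> * (s + t)) = exp (- \<omega> * s) * exp (- \<omega> * t)"
      by (simp add: distrib_left flip: exp_add)
    then show ?thesis
      using that by (simp add: fun_eq_iff C0_semigroup_add [OF S]
          bounded_clinear_scaleR [OF C0_semigroup_bounded_clinear [OF S]])
  qed
  have "((\<lambda>t. exp (- \<omega> * t) *\<^sub>R S t x) \<longlongrightarrow> exp (- \<omega> * 0) *\<^sub>R x) (at_right 0)" for x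
    by (intro tendsto_intros C0_semigroup_tendsto [OF S])
  then show "((\<lambda>t. exp (- \<omega> * t) *\<^sub>R S t x) \<longlongrightarrow> x) (at_right 0)" for x
    by simp
qed

lemma generator_rescale:
  fixes S :: "real \<Rightarrow> 'a::real_normed_vector \<Rightarrow> 'a"
  assumes S: "((\<lambda>k. (S k x - x) /\<^sub>R k) \<longlongrightarrow> y) (at_right 0)"
  shows "((\<lambda>k. (exp (- \<omega> * k) *\<^sub>R S k x - x) /\<^sub>R k) \<longlongrightarrow> y - \<omega> *\<^sub>R x) (at_right 0)"
proof -
  have "((\<lambda>k. exp (- \<omega> * k)) has_real_derivative - \<omega>) (at 0)"
    by (auto intro!: derivative_eq_intros)
  then have "((\<lambda>k. (exp (- \<omega> * k) - 1) / k) \<longlongrightarrow> - \<omega>) (at 0)"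
    by (simp add: has_field_derivative_iff)
  then have exp: "((\<lambda>k. (exp (- \<omega> * k) - 1) / k) \<longlongrightarrow> - \<omega>) (at_right 0)"
    by (rule tendsto_within_subset) simp
  have "((\<lambda>k. exp (- \<omega> * k) *\<^sub>R ((S k x - x) /\<^sub>R k) + ((exp (- \<omega> * k) - 1) / k) *\<^sub>R x)
      \<longlongrightarrow> exp (- \<omega> * 0) *\<^sub>R y + (- \<omega>) *\<^sub>R x) (at_right 0)"
    by (intro tendsto_intros S exp)
  moreover have "exp (- \<omega> * k) *\<^sub>R ((S k x - x) /\<^sub>R k) + ((exp (- \<omega> * k) - 1) / k) *\<^sub>R x
      = (exp (- \<omega> * k) *\<^sub>R S k x - x) /\<^sub>R k" for k
    by (simp add: divide_inverse algebra_simps)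
  ultimately show ?thesis
    by simp
qed

section \<open>Perturbation of a semigroup on a short time interval\<close>

text \<open>The family \<open>B s\<close> stands for \<open>A S(s)\<close>, which may be singular at \<open>s = 0\<close> but has an integrable
  majorant \<open>g\<close>.  The constant \<open>1/4\<close> makes the Volterra operator \<open>U \<mapsto> \<integral> U(t - s) B(s) ds\<close> a
  contraction; it is achieved by taking \<open>\<tau>\<close> small.\<close>

locale perturbation =
  fixes S B :: "real \<Rightarrow> 'a::chilbert_space \<Rightarrow> 'a" and g :: "real \<Rightarrow> real" and \<tau> M :: real
  assumes S: "C0_semigroup S"
    and \<tau>_pos: "0 < \<tau>"
    and S_bound: "0 \<le> t \<Longrightarrow> t \<le> \<tau> \<Longrightarrow> norm (S t x) \<le> M * norm x"
    and M_ge: "M \<ge> 1"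
    and B_lin: "0 < s \<Longrightarrow> s \<le> \<tau> \<Longrightarrow> bounded_clinear (B s)"
    and B_S: "0 < s \<Longrightarrow> 0 \<le> r \<Longrightarrow> s + r \<le> \<tau> \<Longrightarrow> B (s + r) x = B s (S r x)"
    and B_bound: "0 < s \<Longrightarrow> s \<le> \<tau> \<Longrightarrow> norm (B s x) \<le> g s * norm x"
    and g_nonneg: "0 < s \<Longrightarrow> s \<le> \<tau> \<Longrightarrow> 0 \<le> g s"
    and g_int: "g integrable_on {0..\<tau>}"
    and g_small: "integral {0..\<tau>} g \<le> 1 / 4"
begin

lemma g_int_sub: "0 \<le> a \<Longrightarrow> b \<le> \<tau> \<Longrightarrow> g integrable_on {a..b}"
  by (rule integrable_on_subinterval [OF g_int]) auto

lemma integral_g_mono: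
  assumes "0 \<le> a" "a \<le> b" "b \<le> \<tau>"
  shows "integral {0..a} g \<le> integral {0..b} g"
proof -
  have "norm (0::real) \<le> integral {0..b - a} (\<lambda>s. g (s + a))"
  proof (rule has_integral_norm_le_singular)
    show "(\<lambda>s. g (s + a)) integrable_on {0..b - a}"
      using integrable_integral [OF g_int_sub [of a b]] has_integral_shift_real_ivl [of g _ a b a] assms
      by (auto simp: integrable_on_def)
    show "norm (0::real) \<le> g (s + a)" if "0 < s" "s \<le> b - a" for s
      using that assms by (simp add: g_nonneg)
  qed (rule has_integral_0)
  also have "\<dots> = integral {a..b} g"
    using has_integral_shift_real_ivl [OF integrable_integral [OF g_int_sub [of a b]], of a] assms
    by (simp add: integral_unique)
  finally show ?thesis
    using Henstock_Kurzweil_Integration.integral_combine [OF assms(1,2), of g] g_int_sub [of 0 b] assms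
    by simp
qed

lemma B_continuous_on: "continuous_on {0<..\<tau>} (\<lambda>s. B s x)"
  unfolding continuous_on_eq_continuous_within
proof
  fix s assume s: "s \<in> {0<..\<tau>}"
  define a where "a = s / 2"
  have a: "0 < a" "a < s" "a \<le> \<tau>"
    using s by (simp_all add: a_def)
  have "continuous_on {a..\<tau>} (\<lambda>u. B a (S (u - a) x))"
  proof (rule continuous_on_compose2 [OF bounded_clinear_continuous_on [OF B_lin [OF a(1,3)]]])
    show "continuous_on {a..\<tau>} (\<lambda>u. S (u - a) x)"
      by (rule continuous_on_compose2 [OF C0_semigroup_continuous_on [OF S]])
        (auto intro!: continuous_intros)
  qed auto
  moreover have "B a (S (u - a) x) = B u x" if "u \<in> {a..\<tau>}" for u
    using B_S [of a "u - a" x] a that by simp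
  ultimately have "continuous_on {a..\<tau>} (\<lambda>u. B u x)"
    by (rule continuous_on_eq)
  then have "continuous (at s within {a..\<tau>}) (\<lambda>u. B u x)"
    using s a by (simp add: continuous_on_eq_continuous_within)
  moreover have "at s within {a..\<tau>} = at s within {0<..\<tau>}"
    using a by (intro at_within_nhd [of _ "{a<..}"]) auto
  ultimately show "continuous (at s within {0<..\<tau>}) (\<lambda>s. B s x)"
    by simp
qed

subsection \<open>Strongly continuous families and their convolution with \<open>B\<close>\<close>

definition family :: "real \<Rightarrow> (real \<Rightarrow> 'a \<Rightarrow> 'a) \<Rightarrow> bool"
  where "family c U \<longleftrightarrow> 0 \<le> c \<and> (\<forall>t\<in>{0..\<tau>}. bounded_clinear (U t) \<and> (\<forall>x. norm (U t x) \<le> c * norm x)) \<and>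
    (\<forall>x. continuous_on {0..\<tau>} (\<lambda>t. U t x))"

definition conv :: "(real \<Rightarrow> 'a \<Rightarrow> 'a) \<Rightarrow> real \<Rightarrow> 'a \<Rightarrow> 'a"
  where "conv U t x = integral {0..t} (\<lambda>s. U (t - s) (B s x))"

lemma family_lin: "family c U \<Longrightarrow> t \<in> {0..\<tau>} \<Longrightarrow> bounded_clinear (U t)"
  and family_bound: "family c U \<Longrightarrow> t \<in> {0..\<tau>} \<Longrightarrow> norm (U t x) \<le> c * norm x"
  and family_cont: "family c U \<Longrightarrow> continuous_on {0..\<tau>} (\<lambda>t. U t x)"
  and family_nonneg: "family c U \<Longrightarrow> 0 \<le> c"
  by (auto simp: family_def)

lemma family_S: "family M S"
  using S_bound C0_semigroup_bounded_clinear [OF S] M_ge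
    continuous_on_subset [OF C0_semigroup_continuous_on [OF S]]
  by (auto simp: family_def)

lemma family_plus:
  assumes U: "family c U" and V: "family d V"
  shows "family (c + d) (\<lambda>t x. U t x + V t x)"
  unfolding family_def
proof (intro conjI ballI allI)
  show "0 \<le> c + d"
    using family_nonneg [OF U] family_nonneg [OF V] by simp
  fix t assume t: "t \<in> {0..\<tau>}"
  show "bounded_clinear (\<lambda>x. U t x + V t x)"
    by (intro bounded_clinear_plus family_lin [OF U t] family_lin [OF V t])
  show "norm (U t x + V t x) \<le> (c + d) * norm x" for x
    using norm_triangle_ineq [of "U t x" "V t x"] family_bound [OF U t, of x] family_bound [OF V t, of x]
    by (simp add: distrib_right)
next
  show "continuous_on {0..\<tau>} (\<lambda>t. U t x + V t x)" for x
    by (intro continuous_intros family_cont [OF U] family_cont [OF V])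
qed

lemma family_uminus:
  assumes U: "family c U"
  shows "family c (\<lambda>t x. - U t x)"
  unfolding family_def
proof (intro conjI ballI allI)
  show "0 \<le> c"
    by (rule family_nonneg [OF U])
  fix t assume t: "t \<in> {0..\<tau>}"
  show "bounded_clinear (\<lambda>x. - U t x)"
    using bounded_clinear_cscale [OF family_lin [OF U t], of "-1"] by simp
  show "norm (- U t x) \<le> c * norm x" for x
    using family_bound [OF U t] by simp
next
  show "continuous_on {0..\<tau>} (\<lambda>t. - U t x)" for x
    by (intro continuous_intros family_cont [OF U])
qed

lemma family_continuous_on_compose:
  assumes U: "family c U" and \<phi>: "continuous_on X \<phi>" "\<phi> ` X \<subseteq> {0..\<tau>}" and f: "continuous_on X f"
  shows "continuous_on X (\<lambda>s. U (\<phi> s) (f s))"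
  unfolding continuous_on_def
proof
  fix z assume z: "z \<in> X"
  have "((\<lambda>s. U (\<phi> s) (f z)) \<longlongrightarrow> U (\<phi> z) (f z)) (at z within X)"
    using continuous_on_compose2 [OF family_cont [OF U, of "f z"] \<phi>] z
    by (simp add: continuous_on_def)
  moreover have "((\<lambda>s. U (\<phi> s) (f s) - U (\<phi> s) (f z)) \<longlongrightarrow> 0) (at z within X)"
  proof (rule Lim_null_comparison)
    have "(f \<longlongrightarrow> f z) (at z within X)"
      using f z by (simp add: continuous_on_def)
    then show "((\<lambda>s. c * norm (f s - f z)) \<longlongrightarrow> 0) (at z within X)"
      by (intro tendsto_mult_right_zero tendsto_norm_zero) (simp add: LIM_zero)
    have "norm (U (\<phi> s) (f s) - U (\<phi> s) (f z)) \<le> c * norm (f s - f z)" if "s \<in> X" for s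
    proof -
      have s: "\<phi> s \<in> {0..\<tau>}"
        using \<phi>(2) that by blast
      show ?thesis
        using family_bound [OF U s, of "f s - f z"] by (simp add: bounded_clinear_diff [OF family_lin [OF U s]])
    qed
    then show "\<forall>\<^sub>F s in at z within X. norm (U (\<phi> s) (f s) - U (\<phi> s) (f z)) \<le> c * norm (f s - f z)"
      by (simp add: eventually_at_filter)
  qed
  ultimately have "((\<lambda>s. U (\<phi> s) (f s) - U (\<phi> s) (f z) + U (\<phi> s) (f z)) \<longlongrightarrow> 0 + U (\<phi> z) (f z)) (at z within X)"
    by (intro tendsto_add)
  then show "((\<lambda>s. U (\<phi> s) (f s)) \<longlongrightarrow> U (\<phi> z) (f z)) (at z within X)"
    by simp
qed

context
  fixes U c
  assumes U: "family c U"
begin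

lemma conv_integrand_bound:
  assumes "0 < s" "s \<le> t" "t \<le> \<tau>"
  shows "norm (U (t - s) (B s x)) \<le> (c * norm x) * g s"
proof -
  have "norm (U (t - s) (B s x)) \<le> c * norm (B s x)"
    using assms by (intro family_bound [OF U]) auto
  also have "\<dots> \<le> c * (g s * norm x)"
    using assms by (intro mult_left_mono B_bound family_nonneg [OF U]) auto
  finally show ?thesis
    by (simp add: mult_ac)
qed

lemma conv_integrable:
  assumes "0 \<le> t" "t \<le> \<tau>"
  shows "(\<lambda>s. U (t - s) (B s x)) integrable_on {0..t}"
    and "norm (conv U t x) \<le> c * norm x * integral {0..t} g"
proof -
  have cont: "continuous_on {0<..t} (\<lambda>s. U (t - s) (B s x))"
    using assms by (intro family_continuous_on_compose [OF U] continuous_on_subset [OF B_continuous_on])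
      (auto intro!: continuous_intros)
  have int: "(\<lambda>s. (c * norm x) * g s) integrable_on {0..t}"
    using g_int_sub [of 0 t] assms by (intro integrable_on_mult_right) auto
  show "(\<lambda>s. U (t - s) (B s x)) integrable_on {0..t}"
    using integrable_singular(1) [OF cont int] conv_integrand_bound assms by blast
  show "norm (conv U t x) \<le> c * norm x * integral {0..t} g"
    using integrable_singular(2) [OF cont int] conv_integrand_bound assms unfolding conv_def by simp
qed

lemma conv_has_integral:
  "0 \<le> t \<Longrightarrow> t \<le> \<tau> \<Longrightarrow> ((\<lambda>s. U (t - s) (B s x)) has_integral conv U t x) {0..t}"
  unfolding conv_def by (intro integrable_integral conv_integrable)

lemma conv_bound:
  assumes "0 \<le> t" "t \<le> \<tau>"
  shows "norm (conv U t x) \<le> c / 4 * norm x"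
proof -
  have "norm (conv U t x) \<le> c * norm x * integral {0..t} g"
    by (rule conv_integrable [OF assms])
  also have "\<dots> \<le> c * norm x * (1 / 4)"
    using integral_g_mono [of t \<tau>] g_small assms family_nonneg [OF U] by (intro mult_left_mono) auto
  finally show ?thesis
    by simp
qed

lemma conv_lin:
  assumes "0 \<le> t" "t \<le> \<tau>"
  shows "bounded_clinear (conv U t)"
proof (rule bounded_clinearI [OF _ _ conv_bound [OF assms]])
  have lin: "U (t - s) (B s (x + y)) = U (t - s) (B s x) + U (t - s) (B s y)"
    "U (t - s) (B s (a *\<^sub>C x)) = a *\<^sub>C U (t - s) (B s x)" if "s \<in> {0..t} - {0}" for s x y a
    using that assms B_lin [of s] family_lin [OF U, of "t - s"]
    by (simp_all add: bounded_clinear_add bounded_clinear_scaleC)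
  show "conv U t (x + y) = conv U t x + conv U t y" for x y
  proof -
    have "conv U t (x + y) = integral {0..t} (\<lambda>s. U (t - s) (B s x) + U (t - s) (B s y))"
      unfolding conv_def by (rule integral_spike [OF negligible_sing [of 0]]) (simp add: lin)
    then show ?thesis
      by (simp add: conv_def Henstock_Kurzweil_Integration.integral_add conv_integrable assms)
  qed
  show "conv U t (a *\<^sub>C x) = a *\<^sub>C conv U t x" for a x
  proof -
    have "conv U t (a *\<^sub>C x) = integral {0..t} (\<lambda>s. a *\<^sub>C U (t - s) (B s x))"
      unfolding conv_def by (rule integral_spike [OF negligible_sing [of 0]]) (simp add: lin)
    also have "\<dots> = a *\<^sub>C conv U t x"
      unfolding conv_def
      by (intro bounded_linear_integral [symmetric] scaleC.bounded_linear_right conv_integrable assms)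
    finally show ?thesis .
  qed
qed

text \<open>The part of the integral over \<open>[\<delta>, t]\<close> depends continuously on \<open>t\<close>, because clamping the
  time argument of \<open>U\<close> at 0 turns it into a difference of two integrals with a fixed range and a
  fixed integrand, respectively; the rest is small uniformly in \<open>t\<close>.\<close>

lemma conv_continuous_on: "continuous_on {0..\<tau>} (\<lambda>t. conv U t x)"
proof -
  define h where "h t s = U (max 0 (t - s)) (B s x)" for t s
  define J where "J \<delta> t = integral {\<delta>..\<tau>} (h t) - integral {max \<delta> t..\<tau>} (\<lambda>s. U 0 (B s x))" for \<delta> t
  have J_cont: "continuous_on {0..\<tau>} (J \<delta>)" if \<delta>: "0 < \<delta>" "\<delta> < \<tau>" for \<delta>
  proof -
    have "continuous_on ({0..\<tau>} \<times> cbox \<delta> \<tau>) (\<lambda>p. U (max 0 (fst p - snd p)) (B (snd p) x))"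
    proof (rule family_continuous_on_compose [OF U])
      show "continuous_on ({0..\<tau>} \<times> cbox \<delta> \<tau>) (\<lambda>p. B (snd p) x)"
        using \<delta> by (intro continuous_on_compose2 [OF B_continuous_on continuous_on_snd [OF continuous_on_id]]) auto
    qed (use \<delta> in \<open>auto intro!: continuous_intros\<close>)
    then have 1: "continuous_on {0..\<tau>} (\<lambda>t. integral (cbox \<delta> \<tau>) (h t))"
      unfolding h_def by (intro integral_continuous_on_param) (simp add: case_prod_beta)
    have "continuous_on {\<delta>..\<tau>} (\<lambda>s. U 0 (B s x))"
      using \<delta> \<tau>_pos by (intro family_continuous_on_compose [OF U] continuous_on_subset [OF B_continuous_on])
        (auto intro!: continuous_intros)
    then have "continuous_on {\<delta>..\<tau>} (\<lambda>u. integral {u..\<tau>} (\<lambda>s. U 0 (B s x)))"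
      by (intro indefinite_integral_continuous_1' integrable_continuous_real)
    then have 2: "continuous_on {0..\<tau>} (\<lambda>t. integral {max \<delta> t..\<tau>} (\<lambda>s. U 0 (B s x)))"
      by (rule continuous_on_compose2) (use \<delta> in \<open>auto intro!: continuous_intros\<close>)
    show ?thesis
      unfolding J_def using 1 2 by (intro continuous_on_diff) simp_all
  qed
  have J_eq: "conv U t x - J \<delta> t = integral {0..min \<delta> t} (\<lambda>s. U (t - s) (B s x))"
    if \<delta>: "0 < \<delta>" "\<delta> < \<tau>" and t: "t \<in> {0..\<tau>}" for \<delta> t
  proof -
    have h_int: "h t integrable_on {\<delta>..\<tau>}"
      unfolding h_def using \<delta> t
      by (intro integrable_continuous_real family_continuous_on_compose [OF U]
          continuous_on_subset [OF B_continuous_on]) (auto intro!: continuous_intros)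
    have tail: "integral {max \<delta> t..\<tau>} (h t) = integral {max \<delta> t..\<tau>} (\<lambda>s. U 0 (B s x))"
    proof (rule Henstock_Kurzweil_Integration.integral_cong)
      fix s assume "s \<in> {max \<delta> t..\<tau>}"
      then have "max 0 (t - s) = 0"
        by auto
      then show "h t s = U 0 (B s x)"
        by (simp add: h_def)
    qed
    have "integral {\<delta>..max \<delta> t} (h t) + integral {max \<delta> t..\<tau>} (h t) = integral {\<delta>..\<tau>} (h t)"
      using \<delta> t h_int by (intro Henstock_Kurzweil_Integration.integral_combine) auto
    then have J: "J \<delta> t = integral {\<delta>..max \<delta> t} (h t)"
      unfolding J_def tail by (metis add_diff_cancel_right')
    show ?thesis
    proof (cases "t \<le> \<delta>")
      case True
      then show ?thesis
        by (simp add: J conv_def max_def min_def)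
    next
      case False
      have "integral {\<delta>..t} (h t) = integral {\<delta>..t} (\<lambda>s. U (t - s) (B s x))"
        by (intro Henstock_Kurzweil_Integration.integral_cong) (simp add: h_def max_def)
      moreover have "integral {0..\<delta>} (\<lambda>s. U (t - s) (B s x)) + integral {\<delta>..t} (\<lambda>s. U (t - s) (B s x))
          = conv U t x"
        unfolding conv_def using \<delta> t False
        by (intro Henstock_Kurzweil_Integration.integral_combine conv_integrable) auto
      ultimately show ?thesis
        using False by (simp add: J max_def min_def algebra_simps)
    qed
  qed
  have dist_le: "dist (J \<delta> t) (conv U t x) \<le> c * norm x * integral {0..\<delta>} g"
    if \<delta>: "0 < \<delta>" "\<delta> < \<tau>" and t: "t \<in> {0..\<tau>}" for \<delta> t
  proof -
    have "dist (J \<delta> t) (conv U t x) = norm (integral {0..min \<delta> t} (\<lambda>s. U (t - s) (B s x)))"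
      unfolding J_eq [OF that, symmetric] by (simp add: dist_norm norm_minus_commute)
    also have "\<dots> \<le> integral {0..min \<delta> t} (\<lambda>s. (c * norm x) * g s)"
    proof (rule has_integral_norm_le_singular)
      have "(\<lambda>s. U (t - s) (B s x)) integrable_on {0..t}"
        using t by (intro conv_integrable) auto
      then have "(\<lambda>s. U (t - s) (B s x)) integrable_on {0..min \<delta> t}"
        by (rule integrable_on_subinterval) auto
      then show "((\<lambda>s. U (t - s) (B s x)) has_integral integral {0..min \<delta> t} (\<lambda>s. U (t - s) (B s x))) {0..min \<delta> t}"
        by (rule integrable_integral)
      show "(\<lambda>s. (c * norm x) * g s) integrable_on {0..min \<delta> t}"
        using g_int_sub [of 0 "min \<delta> t"] \<delta> t by (intro integrable_on_mult_right) auto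
      show "norm (U (t - s) (B s x)) \<le> (c * norm x) * g s" if "0 < s" "s \<le> min \<delta> t" for s
        using that t by (intro conv_integrand_bound) auto
    qed
    also have "\<dots> = c * norm x * integral {0..min \<delta> t} g"
      by simp
    also have "\<dots> \<le> c * norm x * integral {0..\<delta>} g"
      using \<delta> t family_nonneg [OF U] by (intro mult_left_mono integral_g_mono) auto
    finally show ?thesis .
  qed
  have "uniform_limit {0..\<tau>} J (\<lambda>t. conv U t x) (at_right 0)"
    unfolding uniform_limit_iff
  proof (intro allI impI)
    fix e :: real assume "e > 0"
    have "continuous_on {0..\<tau>} (\<lambda>\<delta>. integral {0..\<delta>} g)"
      by (rule indefinite_integral_continuous_1 [OF g_int])
    then have "((\<lambda>\<delta>. integral {0..\<delta>} g) \<longlongrightarrow> integral {0..0} g) (at 0 within {0..\<tau>})"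
      unfolding continuous_on_def by (rule bspec) (use \<tau>_pos in simp)
    moreover have "at 0 within {0..\<tau>} = at_right 0"
      using \<tau>_pos by (simp add: at_within_Icc_at_right)
    ultimately have "((\<lambda>\<delta>. c * norm x * integral {0..\<delta>} g) \<longlongrightarrow> 0) (at_right 0)"
      by (intro tendsto_mult_right_zero) simp
    then have "\<forall>\<^sub>F \<delta> in at_right 0. c * norm x * integral {0..\<delta>} g < e"
      using \<open>e > 0\<close> by (rule order_tendstoD)
    moreover have "\<forall>\<^sub>F \<delta> in at_right 0. 0 < \<delta> \<and> \<delta> < \<tau>"
      using eventually_at_right_real [OF \<tau>_pos] by eventually_elim simp
    ultimately show "\<forall>\<^sub>F \<delta> in at_right 0. \<forall>t\<in>{0..\<tau>}. dist (J \<delta> t) (conv U t x) < e"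
      by eventually_elim (meson dist_le le_less_trans)
  qed
  moreover have "\<forall>\<^sub>F \<delta> in at_right 0. continuous_on {0..\<tau>} (J \<delta>)"
    using eventually_at_right_real [OF \<tau>_pos] by eventually_elim (simp add: J_cont)
  ultimately show ?thesis
    by (intro uniform_limit_theorem [where f = J and F = "at_right 0"]) simp_all
qed

lemma family_conv: "family (c / 4) (conv U)"
  unfolding family_def using conv_lin conv_bound conv_continuous_on family_nonneg [OF U] by auto

end

lemma conv_plus:
  assumes U: "family c U" and V: "family d V" and "0 \<le> t" "t \<le> \<tau>"
  shows "conv (\<lambda>t x. U t x + V t x) t x = conv U t x + conv V t x"
  unfolding conv_def
  by (intro Henstock_Kurzweil_Integration.integral_add conv_integrable [OF U] conv_integrable [OF V] assms)

text \<open>Each application of the homogeneous equation divides a bound by 4.\<close>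

lemma conv_unique:
  assumes D: "\<And>r x. 0 \<le> r \<Longrightarrow> r \<le> b \<Longrightarrow> norm (D r x) \<le> c * norm x" and "b \<le> \<tau>"
    and eq: "\<And>r x. 0 \<le> r \<Longrightarrow> r \<le> b \<Longrightarrow> ((\<lambda>s. D (r - s) (B s x)) has_integral - D r x) {0..r}"
    and r: "0 \<le> r" "r \<le> b"
  shows "D r x = (0::'a)"
proof -
  have c_nonneg: "c * norm (y::'a) \<ge> 0" for y
    using order_trans [OF norm_ge_zero D [OF r, of y]] .
  then have nonneg: "c / 4 ^ n * norm (y::'a) \<ge> 0" for n y
    by simp
  have bound: "norm (D r x) \<le> c / 4 ^ n * norm x" if "0 \<le> r" "r \<le> b" for n r x
    using that
  proof (induction n arbitrary: r x)
    case 0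
    then show ?case using D by simp
  next
    case (Suc n)
    have "norm (- D r x) \<le> integral {0..r} (\<lambda>s. (c / 4 ^ n * norm x) * g s)"
    proof (rule has_integral_norm_le_singular [OF eq [OF Suc.prems]])
      show "(\<lambda>s. (c / 4 ^ n * norm x) * g s) integrable_on {0..r}"
        using g_int_sub [of 0 r] Suc.prems \<open>b \<le> \<tau>\<close> by (intro integrable_on_mult_right) auto
      fix s assume s: "0 < s" "s \<le> r"
      have "norm (D (r - s) (B s x)) \<le> c / 4 ^ n * norm (B s x)"
        using s Suc.prems by (intro Suc.IH) auto
      also have "\<dots> \<le> c / 4 ^ n * (g s * norm x)"
      proof (cases "B s x = 0")
        case True
        then show ?thesis
          using nonneg [of n x] g_nonneg [of s] s Suc.prems \<open>b \<le> \<tau>\<close>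
          by (simp add: mult.left_commute [of _ "g s"] del: times_divide_eq_left)
      next
        case False
        then have "0 \<le> c / 4 ^ n"
          using c_nonneg [of "B s x"] by (simp add: zero_le_mult_iff)
        then show ?thesis
          using s Suc.prems \<open>b \<le> \<tau>\<close> by (intro mult_left_mono B_bound) auto
      qed
      finally show "norm (D (r - s) (B s x)) \<le> (c / 4 ^ n * norm x) * g s"
        by (simp add: mult_ac)
    qed
    also have "\<dots> = c / 4 ^ n * norm x * integral {0..r} g"
      by simp
    also have "\<dots> \<le> c / 4 ^ n * norm x * (1 / 4)"
      using integral_g_mono [of r \<tau>] g_small Suc.prems \<open>b \<le> \<tau>\<close> nonneg by (intro mult_left_mono) auto
    finally show ?case
      by simp
  qed
  have "(\<lambda>n. (c * norm x) * (1 / 4) ^ n) \<longlonglongrightarrow> 0"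
    by (intro tendsto_mult_right_zero LIMSEQ_realpow_zero) auto
  then have "norm (D r x) \<le> 0"
    using bound [OF r] by (intro LIMSEQ_le_const) (auto simp: power_divide)
  then show ?thesis
    by simp
qed

subsection \<open>The Dyson series\<close>

text \<open>The Neumann series of the equation \<open>U = S - conv U\<close>.\<close>

fun dyson :: "nat \<Rightarrow> real \<Rightarrow> 'a \<Rightarrow> 'a"
  where "dyson 0 = S"
  | "dyson (Suc n) = (\<lambda>t x. - conv (dyson n) t x)"

definition perturbed :: "real \<Rightarrow> 'a \<Rightarrow> 'a"
  where "perturbed t x = (\<Sum>n. dyson n t x)"

lemma family_dyson: "family (M * (1 / 4) ^ n) (dyson n)"
proof (induction n)
  case 0
  then show ?case by (simp add: family_S)
next
  case (Suc n)
  then show ?case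
    using family_uminus [OF family_conv [OF Suc]] by simp
qed

lemma family_dyson_partial: "\<exists>c. family c (\<lambda>t x. \<Sum>i<N. dyson i t x)"
proof (induction N)
  case 0
  have "family 0 (\<lambda>t x. 0)"
    using family_plus [OF family_S family_uminus [OF family_S]]
    by (simp add: family_def)
  then show ?case by auto
next
  case (Suc N)
  then show ?case
    using family_plus [OF _ family_dyson [of N]] by auto
qed

lemma geometric_sums: "(\<lambda>n. M * (1 / 4) ^ n * norm x) sums (4 / 3 * M * norm x)"
  using sums_mult2 [OF sums_mult [OF geometric_sums [of "1 / 4 :: real"], of M], of "norm x"]
  by (simp add: field_simps)

lemma dyson_summable: "t \<in> {0..\<tau>} \<Longrightarrow> summable (\<lambda>n. dyson n t x)"
  by (rule summable_comparison_test' [OF sums_summable [OF geometric_sums]])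
    (rule family_bound [OF family_dyson])

lemma dyson_tail:
  assumes "t \<in> {0..\<tau>}"
  shows "norm (perturbed t x - (\<Sum>i<N. dyson i t x)) \<le> (2 * M * (1 / 4) ^ N) * norm x"
proof -
  have "perturbed t x - (\<Sum>i<N. dyson i t x) = (\<Sum>n. dyson (n + N) t x)"
    unfolding perturbed_def by (rule suminf_minus_initial_segment [OF dyson_summable [OF assms], symmetric])
  also have "norm \<dots> \<le> (\<Sum>n. (1 / 4) ^ N * (M * (1 / 4) ^ n * norm x))"
  proof (rule norm_suminf_le)
    show "norm (dyson (n + N) t x) \<le> (1 / 4) ^ N * (M * (1 / 4) ^ n * norm x)" for n
      using family_bound [OF family_dyson assms, of "n + N" x] by (simp add: power_add mult_ac)
  qed (intro summable_mult sums_summable [OF geometric_sums])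
  also have "\<dots> = (1 / 4) ^ N * (4 / 3 * M * norm x)"
    using sums_unique [OF sums_mult [OF geometric_sums [of x], of "(1 / 4) ^ N"]] by simp
  also have "\<dots> \<le> (1 / 4) ^ N * (2 * M * norm x)"
    using M_ge by (intro mult_left_mono mult_right_mono) auto
  finally show ?thesis
    by (simp add: mult_ac)
qed

lemma family_perturbed: "family (2 * M) perturbed"
  unfolding family_def
proof (intro conjI ballI allI)
  show "0 \<le> 2 * M"
    using M_ge by simp
  fix t assume t: "t \<in> {0..\<tau>}"
  show bound: "norm (perturbed t x) \<le> 2 * M * norm x" for x
    using dyson_tail [OF t, of x 0] by simp
  show "bounded_clinear (perturbed t)"
  proof (rule bounded_clinearI [OF _ _ bound])
    show "perturbed t (x + y) = perturbed t x + perturbed t y" for x y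
      unfolding perturbed_def bounded_clinear_add [OF family_lin [OF family_dyson t]]
      by (intro suminf_add [symmetric] dyson_summable t)
    show "perturbed t (a *\<^sub>C x) = a *\<^sub>C perturbed t x" for a x
      unfolding perturbed_def bounded_clinear_scaleC [OF family_lin [OF family_dyson t]]
      by (intro bounded_linear.suminf [symmetric] scaleC.bounded_linear_right dyson_summable t)
  qed
next
  fix x
  have "uniform_limit {0..\<tau>} (\<lambda>N t. \<Sum>i<N. dyson i t x) (\<lambda>t. \<Sum>n. dyson n t x) sequentially"
    by (rule Weierstrass_m_test [OF _ sums_summable [OF geometric_sums]])
      (rule family_bound [OF family_dyson])
  then show "continuous_on {0..\<tau>} (\<lambda>t. perturbed t x)"
    unfolding perturbed_def
    by (rule uniform_limit_theorem [rotated])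
      (auto intro!: always_eventually continuous_on_sum family_cont [OF family_dyson])
qed

lemma family_tail: "family (2 * M * (1 / 4) ^ N) (\<lambda>t x. perturbed t x + - (\<Sum>i<N. dyson i t x))"
proof -
  obtain c where "family c (\<lambda>t x. \<Sum>i<N. dyson i t x)"
    using family_dyson_partial by blast
  from family_plus [OF family_perturbed family_uminus [OF this]]
  show ?thesis
    using dyson_tail M_ge unfolding family_def by simp
qed

text \<open>The convolution is continuous in the bound of a family, so it may be applied to the series term by
  term.\<close>

lemma perturbed_equation:
  assumes t: "0 \<le> t" "t \<le> \<tau>"
  shows "perturbed t x = S t x - conv perturbed t x"
proof -
  have partial: "conv perturbed t x - (\<Sum>i<N. conv (dyson i) t x)
      = conv (\<lambda>t x. perturbed t x + - (\<Sum>i<N. dyson i t x)) t x" for N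
  proof -
    obtain c where c: "family c (\<lambda>t x. \<Sum>i<N. dyson i t x)"
      using family_dyson_partial by blast
    have sum: "conv (\<lambda>t x. \<Sum>i<N. dyson i t x) t x = (\<Sum>i<N. conv (dyson i) t x)"
      unfolding conv_def
      by (intro Henstock_Kurzweil_Integration.integral_sum conv_integrable [OF family_dyson] t) simp
    have "conv (\<lambda>t x. - (\<Sum>i<N. dyson i t x)) t x = - conv (\<lambda>t x. \<Sum>i<N. dyson i t x) t x"
      unfolding conv_def by (rule Henstock_Kurzweil_Integration.integral_neg)
    then show ?thesis
      using conv_plus [OF family_perturbed family_uminus [OF c] t, of x] sum by simp
  qed
  have "(\<lambda>N. conv perturbed t x - (\<Sum>i<N. conv (dyson i) t x)) \<longlonglongrightarrow> 0"
  proof (rule Lim_null_comparison)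
    show "\<forall>\<^sub>F N in sequentially. norm (conv perturbed t x - (\<Sum>i<N. conv (dyson i) t x))
        \<le> (M / 2 * norm x) * (1 / 4) ^ N"
      using conv_bound [OF family_tail t, of _ x] unfolding partial
      by (intro always_eventually allI) (simp add: mult_ac)
    show "(\<lambda>N. (M / 2 * norm x) * (1 / 4) ^ N) \<longlonglongrightarrow> 0"
      by (intro tendsto_mult_right_zero LIMSEQ_realpow_zero) auto
  qed
  then have "(\<lambda>N. conv perturbed t x - (conv perturbed t x - (\<Sum>i<N. conv (dyson i) t x)))
      \<longlonglongrightarrow> conv perturbed t x - 0"
    by (intro tendsto_intros)
  then have "(\<lambda>i. conv (dyson i) t x) sums conv perturbed t x"
    by (simp add: sums_def)
  from sums_minus [OF this] have "(\<lambda>i. dyson (Suc i) t x) sums (- conv perturbed t x)"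
    by simp
  then have "(\<lambda>i. dyson i t x) sums (- conv perturbed t x + dyson 0 t x)"
    by (rule sums_Suc)
  then show ?thesis
    by (simp add: perturbed_def sums_unique [symmetric])
qed

text \<open>Splitting the integral for \<open>U(t + r)\<close> at \<open>r\<close> and using \<open>B(s + r) = B(s) S(r)\<close> shows that
  \<open>U(t + r) - U(t) U(r)\<close>, as a function of \<open>r\<close>, solves the homogeneous equation.\<close>

lemma perturbed_add:
  assumes t: "0 \<le> t" and r: "0 \<le> r" "t + r \<le> \<tau>"
  shows "perturbed (t + r) x = perturbed t (perturbed r x)"
proof -
  define D where "D r x = perturbed (t + r) x - perturbed t (perturbed r x)" for r x
  note U = family_perturbed
  have t': "t \<in> {0..\<tau>}"
    using t r by simp
  have "D r x = 0"
  proof (rule conv_unique [where D = D and b = "\<tau> - t"])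
    show "0 \<le> r" "r \<le> \<tau> - t" "\<tau> - t \<le> \<tau>"
      using t r by auto
    show "norm (D r x) \<le> (2 * M + 2 * M * (2 * M)) * norm x" if "0 \<le> r" "r \<le> \<tau> - t" for r x
    proof -
      have "norm (perturbed t (perturbed r x)) \<le> 2 * M * norm (perturbed r x)"
        by (rule family_bound [OF U t'])
      also have "\<dots> \<le> 2 * M * (2 * M * norm x)"
        using M_ge t that by (intro mult_left_mono family_bound [OF U]) auto
      finally show ?thesis
        using norm_triangle_ineq4 [of "perturbed (t + r) x" "perturbed t (perturbed r x)"]
          family_bound [OF U, of "t + r" x] t that
        unfolding D_def by (simp add: distrib_right)
    qed
    fix r x assume r: "0 \<le> r" "r \<le> \<tau> - t"
    let ?f = "\<lambda>s. perturbed (t + r - s) (B s x)"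
    have f_int: "?f integrable_on {0..t + r}"
      using t r by (intro conv_integrable [OF U]) auto
    have f_int_r: "?f integrable_on {0..r}"
      by (rule integrable_on_subinterval [OF f_int]) (use t in auto)
    have "((\<lambda>s. ?f (s + r)) has_integral integral {r..t + r} ?f) {r - r..t + r - r}"
      by (intro has_integral_shift_real_ivl integrable_integral integrable_on_subinterval [OF f_int])
        (use t r in auto)
    then have shifted: "((\<lambda>s. ?f (s + r)) has_integral integral {r..t + r} ?f) {0..t}"
      by simp
    have "((\<lambda>s. perturbed (t - s) (B s (S r x))) has_integral integral {r..t + r} ?f) {0..t}"
    proof (rule has_integral_spike [OF negligible_sing [of 0] _ shifted])
      show "perturbed (t - s) (B s (S r x)) = ?f (s + r)" if "s \<in> {0..t} - {0}" for s
        using B_S [of s r x] that r t by (simp add: algebra_simps)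
    qed
    then have tail: "integral {r..t + r} ?f = S t (S r x) - perturbed t (S r x)"
      using perturbed_equation [OF t, of "S r x"] t' by (simp add: conv_def integral_unique)
    have "integral {0..r} ?f + integral {r..t + r} ?f = conv perturbed (t + r) x"
      unfolding conv_def using t r f_int by (intro Henstock_Kurzweil_Integration.integral_combine) auto
    then have "perturbed (t + r) x = S t (S r x) - (integral {0..r} ?f + integral {r..t + r} ?f)"
      using perturbed_equation [of "t + r" x] t r C0_semigroup_add [OF S, of t r x] by simp
    then have 1: "perturbed (t + r) x = perturbed t (S r x) - integral {0..r} ?f"
      unfolding tail by simp
    have "perturbed r x = S r x - conv perturbed r x"
      using r t by (intro perturbed_equation) auto
    then have "perturbed t (perturbed r x) = perturbed t (S r x) - perturbed t (conv perturbed r x)"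
      by (simp add: bounded_clinear_diff [OF family_lin [OF U t']])
    then have D_eq: "- D r x = integral {0..r} ?f - perturbed t (conv perturbed r x)"
      using 1 by (simp add: D_def)
    have "((\<lambda>s. perturbed (r - s) (B s x)) has_integral conv perturbed r x) {0..r}"
      using r t by (intro conv_has_integral [OF U]) auto
    from has_integral_linear [OF this bounded_clinear_imp_bounded_linear [OF family_lin [OF U t']]]
    have "((\<lambda>s. perturbed t (perturbed (r - s) (B s x))) has_integral perturbed t (conv perturbed r x)) {0..r}"
      by (simp add: comp_def)
    from has_integral_diff [OF integrable_integral [OF f_int_r] this]
    show "((\<lambda>s. D (r - s) (B s x)) has_integral - D r x) {0..r}"
      unfolding D_eq by (simp add: D_def algebra_simps)
  qed
  then show ?thesis
    by (simp add: D_def)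
qed

lemma perturbed_0: "perturbed 0 x = x"
  using perturbed_equation [of 0 x] \<tau>_pos by (simp add: conv_def C0_semigroup_0 [OF S])

end

subsection \<open>Extending a semigroup from an interval\<close>

lemma funpow_comp_commute:
  assumes "\<And>x. f (g x) = g (f x)"
  shows "((\<lambda>x. f (g x)) ^^ n) x = (f ^^ n) ((g ^^ n) x)"
proof -
  have "(f ^^ n) (g y) = g ((f ^^ n) y)" for n y
    by (induction n) (simp_all add: assms)
  then show ?thesis
    by (induction n) simp_all
qed

text \<open>The power \<open>U(t/n)\<^sup>n\<close> is the same for all \<open>n\<close> with \<open>t/n \<le> \<tau>\<close>, by comparison with
  \<open>U(t/(n m))\<^bsup>n m\<^esup>\<close>.  For the semigroup law take the same \<open>n\<close> for all three times.\<close>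

lemma C0_semigroup_extend:
  fixes U :: "real \<Rightarrow> 'a::chilbert_space \<Rightarrow> 'a"
  assumes "\<tau> > 0" and lin: "\<And>t. 0 \<le> t \<Longrightarrow> t \<le> \<tau> \<Longrightarrow> bounded_clinear (U t)"
    and U_0: "\<And>x. U 0 x = x"
    and U_add: "\<And>s t x. 0 \<le> s \<Longrightarrow> 0 \<le> t \<Longrightarrow> s + t \<le> \<tau> \<Longrightarrow> U (s + t) x = U s (U t x)"
    and U_lim: "\<And>x. ((\<lambda>t. U t x) \<longlongrightarrow> x) (at_right 0)"
  obtains V where "C0_semigroup V" "\<And>t. 0 \<le> t \<Longrightarrow> t \<le> \<tau> \<Longrightarrow> V t = U t"
    "\<And>t n. 0 \<le> t \<Longrightarrow> 0 < n \<Longrightarrow> t / real n \<le> \<tau> \<Longrightarrow> V t = U (t / real n) ^^ n"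
proof -
  have multiple: "U (real m * r) = U r ^^ m" if "0 \<le> r" "real m * r \<le> \<tau>" for m r
    using that
  proof (induction m)
    case 0
    then show ?case by (simp add: fun_eq_iff U_0)
  next
    case (Suc m)
    have le: "r + real m * r \<le> \<tau>"
      using Suc.prems by (simp add: algebra_simps)
    then have "U (real m * r) = U r ^^ m"
      using Suc by simp
    moreover have "U (r + real m * r) = U r \<circ> U (real m * r)"
      using U_add [OF _ _ le] Suc.prems by (simp add: fun_eq_iff)
    ultimately show ?case
      by (simp add: algebra_simps)
  qed
  have indep: "U (t / real n) ^^ n = U (t / real m) ^^ m"
    if "0 \<le> t" "0 < n" "0 < m" "t / real n \<le> \<tau>" "t / real m \<le> \<tau>" for t n m
  proof -
    have "U (t / real n) = U (t / real (n * m)) ^^ m" "U (t / real m) = U (t / real (n * m)) ^^ n"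
      using multiple [of "t / real (n * m)" m] multiple [of "t / real (n * m)" n] that by simp_all
    then show ?thesis
      by (simp add: funpow_mult mult.commute)
  qed
  define N where "N t = Suc (nat \<lceil>t / \<tau>\<rceil>)" for t
  have N: "0 < N t" "t / real (N t) \<le> \<tau>" if "0 \<le> t" for t
  proof -
    have "t / \<tau> \<le> real (N t)"
      unfolding N_def using real_nat_ceiling_ge [of "t / \<tau>"] by simp
    then show "t / real (N t) \<le> \<tau>" "0 < N t"
      using \<open>\<tau> > 0\<close> by (simp_all add: N_def field_simps)
  qed
  define V where "V t = U (t / real (N t)) ^^ N t" for t
  have V: "V t = U (t / real n) ^^ n" if "0 \<le> t" "0 < n" "t / real n \<le> \<tau>" for t n
    unfolding V_def using that N by (intro indep) auto
  have V_U: "V t = U t" if "0 \<le> t" "t \<le> \<tau>" for t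
    using V [of t 1] that by simp
  have "C0_semigroup V"
    unfolding C0_semigroup_def
  proof (intro conjI allI impI)
    show "bounded_clinear (V t)" if "0 \<le> t" for t
      unfolding V_def using N [OF that] that by (intro bounded_clinear_funpow lin) auto
    show "V 0 = id"
      using V_U [of 0] \<open>\<tau> > 0\<close> by (simp add: fun_eq_iff U_0)
    show "V (s + t) = V s \<circ> V t" if "0 \<le> s" "0 \<le> t" for s t
    proof -
      define n where "n = N (s + t)"
      have n: "0 < n" "(s + t) / real n \<le> \<tau>"
        using N [of "s + t"] that by (simp_all add: n_def)
      have le: "s / real n \<le> \<tau>" "t / real n \<le> \<tau>"
        using n(2) divide_right_mono [of s "s + t" "real n"] divide_right_mono [of t "s + t" "real n"] that
        by linarith+
      have pos: "0 \<le> s / real n" "0 \<le> t / real n"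
        using that by auto
      have sum: "s / real n + t / real n \<le> \<tau>"
        using n by (simp add: add_divide_distrib)
      have "U ((s + t) / real n) = (\<lambda>x. U (s / real n) (U (t / real n) x))"
        using U_add [OF pos sum] by (simp add: add_divide_distrib fun_eq_iff)
      then have "V (s + t) x = ((\<lambda>x. U (s / real n) (U (t / real n) x)) ^^ n) x" for x
        using V [of "s + t" n] n that by simp
      moreover have "((\<lambda>x. U (s / real n) (U (t / real n) x)) ^^ n) x
          = (U (s / real n) ^^ n) ((U (t / real n) ^^ n) x)" for x
        using U_add [OF pos sum] U_add [OF pos(2,1)] sum
        by (intro funpow_comp_commute) (metis add.commute)
      moreover have "V s = U (s / real n) ^^ n" "V t = U (t / real n) ^^ n"
        using V n le that by auto
      ultimately show ?thesis
        by (simp add: fun_eq_iff)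
    qed
    show "((\<lambda>t. V t x) \<longlongrightarrow> x) (at_right 0)" for x
    proof (rule Lim_transform_eventually [OF U_lim])
      show "\<forall>\<^sub>F t in at_right 0. U t x = V t x"
        using eventually_at_right_real [OF \<open>\<tau> > 0\<close>] by eventually_elim (simp add: V_U)
    qed
  qed
  then show thesis
    using that V V_U by blast
qed

subsection \<open>The derivative of the perturbed orbits at 0\<close>

context perturbation
begin

text \<open>The difference is \<open>\<integral>\<^sub>0\<^sup>k U(k - s) B(s) x ds\<close> with an integrand close to \<open>a\<close> for small \<open>k\<close>.\<close>

lemma quotient_tendsto_perturbed:
  assumes a: "((\<lambda>s. B s x) \<longlongrightarrow> a) (at_right 0)"
  shows "((\<lambda>k. (S k x - perturbed k x) /\<^sub>R k) \<longlongrightarrow> a) (at_right 0)"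
proof (rule tendstoI)
  fix e :: real assume "e > 0"
  define e1 where "e1 = e / (2 * (2 * M + 1))"
  have e1: "e1 > 0" "2 * M * e1 + e1 < e"
  proof -
    have "2 * M + 1 > 0"
      using M_ge by simp
    then have "(2 * M + 1) * e1 = e / 2"
      by (simp add: e1_def field_simps)
    then show "2 * M * e1 + e1 < e"
      using \<open>e > 0\<close> by (simp add: distrib_right)
    show "e1 > 0"
      using \<open>e > 0\<close> \<open>2 * M + 1 > 0\<close> by (simp add: e1_def)
  qed
  have "\<forall>\<^sub>F s in at_right 0. dist (B s x) a < e1"
    using a e1(1) by (rule tendstoD)
  then obtain d1 where d1: "d1 > 0" "\<And>s. 0 < s \<Longrightarrow> s < d1 \<Longrightarrow> dist (B s x) a < e1"
    unfolding eventually_at_right_field by blast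
  obtain d2 where d2: "d2 > 0" "\<And>r. r \<in> {0..\<tau>} \<Longrightarrow> dist r 0 < d2 \<Longrightarrow> dist (perturbed r a) (perturbed 0 a) < e1"
    using family_cont [OF family_perturbed, of a] e1(1) \<tau>_pos unfolding continuous_on_iff
    by (metis atLeastAtMost_iff order_refl less_imp_le)
  have "dist ((S k x - perturbed k x) /\<^sub>R k) a < e" if k: "0 < k" "k < min \<tau> (min d1 d2)" for k
  proof -
    have "S k x - perturbed k x = conv perturbed k x"
      using perturbed_equation [of k x] k by simp
    then have "((\<lambda>s. perturbed (k - s) (B s x)) has_integral S k x - perturbed k x) {0..k}"
      using conv_has_integral [OF family_perturbed, of k x] k by simp
    from has_integral_diff [OF this has_integral_const_real [of a 0 k]]
    have int: "((\<lambda>s. perturbed (k - s) (B s x) - a) has_integral S k x - perturbed k x - k *\<^sub>R a) {0..k}"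
      using k by simp
    have "norm (S k x - perturbed k x - k *\<^sub>R a) \<le> integral {0..k} (\<lambda>s. 2 * M * e1 + e1)"
    proof (rule has_integral_norm_le_singular [OF int])
      fix s assume s: "0 < s" "s \<le> k"
      have ks: "k - s \<in> {0..\<tau>}"
        using s k by auto
      have "norm (perturbed (k - s) (B s x - a)) \<le> 2 * M * norm (B s x - a)"
        by (rule family_bound [OF family_perturbed ks])
      also have "\<dots> \<le> 2 * M * e1"
        using d1(2) [of s] s k M_ge by (intro mult_left_mono) (auto simp: dist_norm)
      finally have "norm (perturbed (k - s) (B s x) - perturbed (k - s) a) \<le> 2 * M * e1"
        by (simp add: bounded_clinear_diff [OF family_lin [OF family_perturbed ks]])
      moreover have "norm (perturbed (k - s) a - a) \<le> e1"
        using d2(2) [OF ks] s k by (simp add: dist_norm perturbed_0)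
      ultimately show "norm (perturbed (k - s) (B s x) - a) \<le> 2 * M * e1 + e1"
        using norm_triangle_ineq [of "perturbed (k - s) (B s x) - perturbed (k - s) a" "perturbed (k - s) a - a"]
        by simp
    qed (rule integrable_const_ivl)
    then have *: "norm (S k x - perturbed k x - k *\<^sub>R a) \<le> k * (2 * M * e1 + e1)"
      using k by simp
    have "(S k x - perturbed k x) /\<^sub>R k - a = (S k x - perturbed k x - k *\<^sub>R a) /\<^sub>R k"
      using k by (simp add: scaleR_diff_right)
    then have "norm ((S k x - perturbed k x) /\<^sub>R k - a) = norm (S k x - perturbed k x - k *\<^sub>R a) / k"
      using k by (simp add: divide_inverse mult.commute)
    also have "\<dots> \<le> 2 * M * e1 + e1"
      using * k by (simp add: pos_divide_le_eq mult.commute)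
    finally show ?thesis
      using e1(2) by (simp add: dist_norm)
  qed
  moreover have "min \<tau> (min d1 d2) > 0"
    using \<tau>_pos d1(1) d2(1) by simp
  ultimately show "\<forall>\<^sub>F k in at_right 0. dist ((S k x - perturbed k x) /\<^sub>R k) a < e"
    unfolding eventually_at_right_field by blast
qed

end

section \<open>The generator of the perturbed semigroup\<close>

locale closed_perturbation = perturbation S "\<lambda>s x. A (S s x)" g \<tau> M
  for S :: "real \<Rightarrow> 'a::chilbert_space \<Rightarrow> 'a" and A g \<tau> M +
  fixes DA :: "'a set"
  assumes A_closed: "closed_operator DA A"
    and S_DA: "0 < t \<Longrightarrow> S t x \<in> DA"
    and g_antimono: "0 < s \<Longrightarrow> s \<le> t \<Longrightarrow> t \<le> \<tau> \<Longrightarrow> g t \<le> g s"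
begin

lemma A_diff:
  assumes "x \<in> DA" "y \<in> DA"
  shows "A (x - y) = A x - A y"
proof -
  have lin: "linear_operator_on DA A"
    using A_closed by (simp add: closed_operator_def)
  have "(-1) *\<^sub>C y \<in> DA"
    using lin assms(2) unfolding linear_operator_on_def by (blast intro: complex_vector.subspace_scale)
  then have "A (x + (-1) *\<^sub>C y) = A x + (-1) *\<^sub>C A y"
    using lin assms unfolding linear_operator_on_def by metis
  then show ?thesis by simp
qed

lemma A_graph_limit:
  assumes "(f \<longlongrightarrow> x) F" "((\<lambda>s. A (f s)) \<longlongrightarrow> y) F" "\<forall>\<^sub>F s in F. f s \<in> DA" "F \<noteq> bot"
  shows "x \<in> DA" "A x = y"
proof -
  have "closed {(x, A x) |x. x \<in> DA}"
    using A_closed by (simp add: closed_operator_def)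
  moreover have "\<forall>\<^sub>F s in F. (f s, A (f s)) \<in> {(x, A x) |x. x \<in> DA}"
    using assms(3) by eventually_elim auto
  moreover have "((\<lambda>s. (f s, A (f s))) \<longlongrightarrow> (x, y)) F"
    by (intro tendsto_Pair assms)
  ultimately have "(x, y) \<in> {(x, A x) |x. x \<in> DA}"
    using assms(4) by (intro Lim_in_closed_set [where F = F])
  then show "x \<in> DA" "A x = y"
    by auto
qed

text \<open>For \<open>x\<close> in the domain of the generator, \<open>A S(b) x - A S(a) x\<close> is the integral of
  \<open>A S(r) y\<close> over \<open>[a, b]\<close>, where \<open>y\<close> is the derivative of the orbit at 0.  So \<open>A S(s) x\<close> is Cauchy as
  \<open>s \<rightarrow> 0\<close>, and closedness of \<open>A\<close> identifies the limit.\<close>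

lemma generator_domain_subset:
  assumes y: "((\<lambda>k. (S k x - x) /\<^sub>R k) \<longlongrightarrow> y) (at_right 0)"
  shows "x \<in> DA" "((\<lambda>s. A (S s x)) \<longlongrightarrow> A x) (at_right 0)"
proof -
  define \<Gamma> where "\<Gamma> s = norm y * integral {0..s} g" for s
  have ordered: "norm (A (S b x) - A (S a x)) \<le> \<Gamma> b - \<Gamma> a" if ab: "0 < a" "a \<le> b" "b \<le> \<tau>" for a b
  proof -
    have lin: "bounded_clinear (\<lambda>x. A (S a x))"
      using ab by (intro B_lin) auto
    have "A (S b x) - A (S a x) = A (S a (S (b - a) x - x))"
      using B_S [of a "b - a" x] ab by (simp add: bounded_clinear_diff [OF lin])
    also have "\<dots> = A (S a (integral {0..b - a} (\<lambda>r. S r y)))"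
      using C0_semigroup_integral_generator [OF S _ y, of "b - a"] ab by simp
    also have "\<dots> = integral {0..b - a} (\<lambda>r. A (S a (S r y)))"
      by (intro bounded_linear_integral bounded_clinear_imp_bounded_linear [OF lin]
          C0_semigroup_integrable [OF S]) simp
    also have "norm \<dots> \<le> integral {0..b - a} (\<lambda>r. norm y * g (r + a))"
    proof (rule Henstock_Kurzweil_Integration.integral_norm_bound_integral)
      show "(\<lambda>r. A (S a (S r y))) integrable_on {0..b - a}"
        using integrable_linear [OF C0_semigroup_integrable [OF S, of 0 y "b - a"]
            bounded_clinear_imp_bounded_linear [OF lin]] by (simp add: comp_def)
      have "(\<lambda>r. g (r + a)) integrable_on {0..b - a}"
        using has_integral_shift_real_ivl [OF integrable_integral [OF g_int_sub [of a b]], of a] ab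
        by (auto simp: integrable_on_def)
      then show "(\<lambda>r. norm y * g (r + a)) integrable_on {0..b - a}"
        by (rule integrable_on_mult_right)
      fix r assume r: "r \<in> {0..b - a}"
      have "A (S a (S r y)) = A (S (r + a) y)"
        using B_S [of a r y] r ab by (simp add: add.commute)
      then show "norm (A (S a (S r y))) \<le> norm y * g (r + a)"
        using B_bound [of "r + a" y] r ab by (simp add: mult.commute)
    qed
    also have "\<dots> = norm y * integral {a..b} g"
      using has_integral_shift_real_ivl [OF integrable_integral [OF g_int_sub [of a b]], of a] ab
      by (simp add: integral_unique)
    also have "integral {a..b} g = integral {0..b} g - integral {0..a} g"
      using Henstock_Kurzweil_Integration.integral_combine [of 0 a b g] g_int_sub [of 0 b] ab by simp
    finally show ?thesis
      by (simp add: \<Gamma>_def right_diff_distrib)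
  qed
  have "continuous_on {0..\<tau>} \<Gamma>"
    unfolding \<Gamma>_def by (intro continuous_intros indefinite_integral_continuous_1 g_int)
  moreover have "dist (A (S b x)) (A (S a x)) \<le> dist (\<Gamma> b) (\<Gamma> a)" if "a \<in> {0<..\<tau>}" "b \<in> {0<..\<tau>}" for a b
    using ordered [of a b] ordered [of b a] that
    by (cases "a \<le> b") (auto simp: dist_norm norm_minus_commute)
  ultimately obtain G where G: "continuous_on {0..\<tau>} G" "\<And>s. s \<in> {0<..\<tau>} \<Longrightarrow> A (S s x) = G s"
    using extend_to_0 [of \<tau> \<Gamma> "\<lambda>s. A (S s x)"] \<tau>_pos by metis
  have "(G \<longlongrightarrow> G 0) (at 0 within {0..\<tau>})"
    using G(1) unfolding continuous_on_def by (rule bspec) (use \<tau>_pos in simp)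
  then have "(G \<longlongrightarrow> G 0) (at_right 0)"
    using \<tau>_pos by (simp add: at_within_Icc_at_right)
  moreover have "\<forall>\<^sub>F s in at_right 0. G s = A (S s x)"
    using eventually_at_right_real [OF \<tau>_pos] by eventually_elim (simp add: G(2))
  ultimately have lim: "((\<lambda>s. A (S s x)) \<longlongrightarrow> G 0) (at_right 0)"
    by (rule Lim_transform_eventually)
  have "\<forall>\<^sub>F s in at_right 0. S s x \<in> DA"
    using eventually_at_right_less [of 0] by eventually_elim (rule S_DA)
  note A_graph_limit [OF C0_semigroup_tendsto [OF S] lim this trivial_limit_at_right_real]
  then show "x \<in> DA" "((\<lambda>s. A (S s x)) \<longlongrightarrow> A x) (at_right 0)"
    using lim by simp_all
qed

text \<open>The truncated Laplace transform \<open>R y = \<integral>\<^sub>0\<^sup>h e\<^bsup>-\<omega>s\<^esup> S(s) y ds\<close> is an approximate resolvent: it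
  maps into the domain of the generator, and \<open>(\<omega> + T + A) R\<close> differs from the identity by an
  operator of norm at most \<open>1/2\<close>, so that \<open>\<omega> + T + A\<close> is onto.\<close>

lemma perturbed_resolvent_onto:
  assumes \<omega>: "exp (- \<omega> * (\<tau> / 2)) * M \<le> 1 / 4"
  obtains w v where "((\<lambda>k. (S k w - w) /\<^sub>R k) \<longlongrightarrow> v) (at_right 0)" "\<omega> *\<^sub>R w - v + A w = z"
proof -
  \<comment> \<open>Half the interval, so that \<open>s + r \<le> \<tau>\<close> for \<open>s, r \<le> h\<close>.\<close>
  define h where "h = \<tau> / 2"
  have h: "0 < h" "h \<le> \<tau>" "\<tau> = h + h"
    using \<tau>_pos by (simp_all add: h_def)
  define W where "W t x = exp (- \<omega> * t) *\<^sub>R S t x" for t x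
  have W: "C0_semigroup W"
    unfolding W_def by (rule C0_semigroup_rescale [OF S])
  define R where "R y = integral {0..h} (\<lambda>s. W s y)" for y
  have R_diff: "R (y - y') = R y - R y'" for y y'
  proof -
    have "R (y - y') = integral {0..h} (\<lambda>s. W s y - W s y')"
      unfolding R_def
      by (intro Henstock_Kurzweil_Integration.integral_cong)
        (simp add: bounded_clinear_diff [OF C0_semigroup_bounded_clinear [OF W]])
    then show ?thesis
      by (simp add: R_def Henstock_Kurzweil_Integration.integral_diff C0_semigroup_integrable [OF W])
  qed
  have gen: "((\<lambda>k. (S k (R y) - R y) /\<^sub>R k) \<longlongrightarrow> W h y - y + \<omega> *\<^sub>R R y) (at_right 0)" for y
  proof -
    have "((\<lambda>k. (W k (R y) - R y) /\<^sub>R k) \<longlongrightarrow> W h y - y) (at_right 0)"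
      unfolding R_def by (rule C0_semigroup_generator_integral [OF W less_imp_le [OF h(1)]])
    from generator_rescale [where S = W and x = "R y" and \<omega> = "- \<omega>", OF this]
    show ?thesis
      by (simp add: W_def flip: exp_add)
  qed
  note R_DA = generator_domain_subset [OF gen]
  have AR_bound: "norm (A (R y)) \<le> 1 / 4 * norm y" for y
  proof (rule tendsto_upperbound [OF tendsto_norm [OF R_DA(2)]])
    have "norm (A (S s (R y))) \<le> 1 / 4 * norm y" if s: "0 < s" "s < h" for s
    proof -
      have lin: "bounded_clinear (\<lambda>x. A (S s x))"
        using s h by (intro B_lin) auto
      have "((\<lambda>r. A (S s (W r y))) has_integral A (S s (R y))) {0..h}"
        using has_integral_linear [OF integrable_integral [OF C0_semigroup_integrable [OF W]]
            bounded_clinear_imp_bounded_linear [OF lin], of 0 y h] by (simp add: comp_def R_def)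
      then have "norm (A (S s (R y))) \<le> integral {0..h} (\<lambda>r. norm y * g r)"
      proof (rule has_integral_norm_le_singular)
        show "(\<lambda>r. norm y * g r) integrable_on {0..h}"
          using g_int_sub [of 0 h] h by (intro integrable_on_mult_right) auto
        fix r assume r: "0 < r" "r \<le> h"
        have "exp (- \<omega> * r) \<le> 1"
        proof -
          have "\<omega> \<ge> 0"
          proof (rule ccontr)
            assume "\<not> \<omega> \<ge> 0"
            then have "1 \<le> exp (- \<omega> * (\<tau> / 2))"
              using \<tau>_pos by (simp add: mult_nonpos_nonneg)
            then have "1 * 1 \<le> exp (- \<omega> * (\<tau> / 2)) * M"
              using M_ge by (intro mult_mono) auto
            then show False
              using \<omega> by simp
          qed
          then show ?thesis
            using r by simp
        qed
        moreover have "A (S s (W r y)) = exp (- \<omega> * r) *\<^sub>R A (S (s + r) y)"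
          using B_S [of s r y] s r h by (simp add: W_def bounded_clinear_scaleR [OF lin])
        ultimately have "norm (A (S s (W r y))) \<le> 1 * norm (A (S (s + r) y))"
          by (simp add: mult_left_le_one_le)
        also have "\<dots> \<le> g (s + r) * norm y"
          using B_bound [of "s + r" y] s r h by simp
        also have "\<dots> \<le> g r * norm y"
          using g_antimono [of r "s + r"] s r h by (intro mult_right_mono) auto
        finally show "norm (A (S s (W r y))) \<le> norm y * g r"
          by (simp add: mult.commute)
      qed
      also have "\<dots> = norm y * integral {0..h} g"
        by simp
      also have "\<dots> \<le> norm y * (1 / 4)"
        using integral_g_mono [of h \<tau>] g_small h by (intro mult_left_mono) auto
      finally show ?thesis
        by simp
    qed
    then show "\<forall>\<^sub>F s in at_right 0. norm (A (S s (R y))) \<le> 1 / 4 * norm y"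
      using h(1) unfolding eventually_at_right_field by blast
  qed simp
  define E where "E y = W h y - A (R y)" for y
  have E_bound: "norm (E y) \<le> 1 / 2 * norm y" for y
  proof -
    have "norm (W h y) = exp (- \<omega> * (\<tau> / 2)) * norm (S h y)"
      by (simp add: W_def h_def)
    also have "\<dots> \<le> exp (- \<omega> * (\<tau> / 2)) * (M * norm y)"
      using S_bound [of h y] h by (intro mult_left_mono) auto
    also have "\<dots> \<le> 1 / 4 * norm y"
      using mult_right_mono [OF \<omega>, of "norm y"] by (simp add: mult.assoc)
    finally show ?thesis
      using AR_bound [of y] norm_triangle_ineq4 [of "W h y" "A (R y)"] by (simp add: E_def)
  qed
  have E_diff: "E y - E y' = E (y - y')" for y y'
    using bounded_clinear_diff [OF C0_semigroup_bounded_clinear [OF W less_imp_le [OF h(1)]], of y y']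
      A_diff [OF R_DA(1) R_DA(1), of y y']
    by (simp add: E_def R_diff)
  have "\<exists>!y. z + E y = y"
  proof (rule banach_fix_type [of "1 / 2"])
    show "\<forall>y y'. dist (z + E y) (z + E y') \<le> 1 / 2 * dist y y'"
      using E_bound by (simp add: dist_norm E_diff)
  qed auto
  then obtain y where y: "z + E y = y"
    by blast
  show thesis
  proof (rule that [OF gen [of y]])
    show "\<omega> *\<^sub>R R y - (W h y - y + \<omega> *\<^sub>R R y) + A (R y) = z"
      using y by (simp add: E_def algebra_simps)
  qed
qed

text \<open>The perturbed semigroup cannot have a larger domain, since \<open>\<omega>\<close> minus its generator is injective
  while the restriction to the domain of the unperturbed generator is already onto.\<close>

proposition perturbed_generator:
  assumes gen: "has_infinitesimal_generator S D (\<lambda>x. - T x)"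
    and V: "C0_semigroup V" "\<And>t. 0 \<le> t \<Longrightarrow> t \<le> \<tau> \<Longrightarrow> V t = perturbed t"
  shows "D \<subseteq> DA" "has_infinitesimal_generator V D (\<lambda>x. - (T x + A x))"
proof -
  have D: "x \<in> D \<longleftrightarrow> (\<exists>y. ((\<lambda>k. (S k x - x) /\<^sub>R k) \<longlongrightarrow> y) (at_right 0))" for x
    using gen by (auto simp: has_infinitesimal_generator_def)
  show "D \<subseteq> DA"
    using D generator_domain_subset(1) by blast
  have V_gen: "((\<lambda>k. (V k x - x) /\<^sub>R k) \<longlongrightarrow> y - A x) (at_right 0)"
    if y: "((\<lambda>k. (S k x - x) /\<^sub>R k) \<longlongrightarrow> y) (at_right 0)" for x y
  proof -
    have "((\<lambda>k. (S k x - x) /\<^sub>R k - (S k x - perturbed k x) /\<^sub>R k) \<longlongrightarrow> y - A x) (at_right 0)"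
      by (intro tendsto_diff y quotient_tendsto_perturbed generator_domain_subset(2) [OF y])
    moreover have "\<forall>\<^sub>F k in at_right 0. (S k x - x) /\<^sub>R k - (S k x - perturbed k x) /\<^sub>R k = (V k x - x) /\<^sub>R k"
      using eventually_at_right_real [OF \<tau>_pos]
      by eventually_elim (simp add: V scaleR_diff_right)
    ultimately show ?thesis
      by (rule Lim_transform_eventually)
  qed
  have V_domain: "x \<in> D" if v: "((\<lambda>k. (V k x - x) /\<^sub>R k) \<longlongrightarrow> v) (at_right 0)" for x v
  proof -
    define h where "h = \<tau> / 2"
    \<comment> \<open>This makes both \<open>e\<^bsup>-\<omega>h\<^esup> M\<close> and \<open>e\<^bsup>-\<omega>h\<^esup> 2 M\<close>, which belong to \<open>S\<close> and \<open>V\<close>, at most \<open>1/4\<close>.\<close>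
    define \<omega> where "\<omega> = ln (8 * M) / h"
    have h: "0 < h" "h \<le> \<tau>"
      using \<tau>_pos by (simp_all add: h_def)
    have exp_\<omega>: "exp (- \<omega> * h) * M = 1 / 8"
      using M_ge h(1) by (simp add: \<omega>_def exp_minus)
    then obtain w v' where w: "((\<lambda>k. (S k w - w) /\<^sub>R k) \<longlongrightarrow> v') (at_right 0)"
        "\<omega> *\<^sub>R w - v' + A w = \<omega> *\<^sub>R x - v"
      using perturbed_resolvent_onto [of \<omega> "\<omega> *\<^sub>R x - v"] by (auto simp: h_def)
    define u where "u = x - w"
    have "v - (v' - A w) = \<omega> *\<^sub>R u"
      using w(2) by (simp add: u_def algebra_simps)
    then have "((\<lambda>k. (V k x - x) /\<^sub>R k - (V k w - w) /\<^sub>R k) \<longlongrightarrow> \<omega> *\<^sub>R u) (at_right 0)"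
      using tendsto_diff [OF v V_gen [OF w(1)]] by simp
    moreover have "\<forall>\<^sub>F k in at_right 0. (V k x - x) /\<^sub>R k - (V k w - w) /\<^sub>R k = (V k u - u) /\<^sub>R k"
      using eventually_at_right_less [of 0]
      by eventually_elim
        (simp add: u_def bounded_clinear_diff [OF C0_semigroup_bounded_clinear [OF V(1)]] algebra_simps)
    ultimately have "((\<lambda>k. (V k u - u) /\<^sub>R k) \<longlongrightarrow> \<omega> *\<^sub>R u) (at_right 0)"
      by (rule Lim_transform_eventually)
    from generator_rescale [where S = V and x = u, OF this, of \<omega>]
    have "((\<lambda>k. (exp (- \<omega> * k) *\<^sub>R V k u - u) /\<^sub>R k) \<longlongrightarrow> 0) (at_right 0)"
      by simp
    from C0_semigroup_integral_generator [OF C0_semigroup_rescale [OF V(1)] less_imp_le [OF h(1)] this]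
    have "exp (- \<omega> * h) *\<^sub>R V h u - u = integral {0..h} (\<lambda>r. exp (- \<omega> * r) *\<^sub>R V r 0)" .
    also have "\<dots> = integral {0..h} (\<lambda>r. 0)"
      by (intro Henstock_Kurzweil_Integration.integral_cong)
        (simp add: bounded_clinear_0 [OF C0_semigroup_bounded_clinear [OF V(1)]])
    finally have "u = exp (- \<omega> * h) *\<^sub>R V h u"
      by simp
    then have "norm u = exp (- \<omega> * h) * norm (perturbed h u)"
      using V(2) [of h] h by (metis abs_exp_cancel less_imp_le norm_scaleR)
    also have "\<dots> \<le> exp (- \<omega> * h) * (2 * M * norm u)"
      using family_bound [OF family_perturbed, of h u] h by (intro mult_left_mono) auto
    also have "\<dots> = 1 / 4 * norm u"
      using exp_\<omega> by (simp add: mult_ac)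
    finally have "u = 0"
      by simp
    then show "x \<in> D"
      using w(1) D by (auto simp: u_def)
  qed
  show "has_infinitesimal_generator V D (\<lambda>x. - (T x + A x))"
    unfolding has_infinitesimal_generator_def
  proof (intro conjI ballI)
    show limit: "((\<lambda>k. (V k x - x) /\<^sub>R k) \<longlongrightarrow> - (T x + A x)) (at_right 0)" if "x \<in> D" for x
      using V_gen [of x "- T x"] gen that by (simp add: has_infinitesimal_generator_def)
    show "D = {x. \<exists>y. ((\<lambda>k. (V k x - x) /\<^sub>R k) \<longlongrightarrow> y) (at_right 0)}"
      using limit V_domain by blast
  qed
qed

end

section \<open>Schatten norms of the perturbed semigroup\<close>

lemma schatten_norm_nonneg: "0 \<le> schatten_norm q K"
  by (simp add: schatten_norm_def)

lemma schatten_class_bounded_clinear: "K \<in> schatten_class q \<Longrightarrow> bounded_clinear K"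
  by (simp add: schatten_class_def compact_operator_def)

lemma schatten_bound_uminus: "schatten_bound q C K \<Longrightarrow> schatten_bound q C (\<lambda>x. - K x)"
  by (simp add: schatten_bound_def cinner.minus_right)

lemma schatten_class_1_subset:
  assumes "K \<in> schatten_class 1" "q \<ge> 1"
  shows "K \<in> schatten_class q"
proof -
  have lin: "bounded_clinear K"
    by (rule schatten_class_bounded_clinear [OF assms(1)])
  have "schatten_bound q (schatten_norm 1 K) K"
    by (rule schatten_bound_exponent_mono [OF schatten_class_imp_schatten_bound [OF assms(1) order_refl]
        lin assms(2) schatten_norm_nonneg])
  from schatten_bound_imp_schatten_class(1) [OF this lin schatten_norm_nonneg] show ?thesis
    using assms(2) by simp
qed

text \<open>Write \<open>V(t) = V(t/n)\<^sup>n\<close> with \<open>n > q\<close> so large that the bound is available at \<open>t/n\<close>.\<close>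

lemma semigroup_trace_class:
  assumes V: "C0_semigroup V" and "\<tau> > 0" "q \<ge> 1"
    and bound: "\<And>t. 0 < t \<Longrightarrow> t \<le> \<tau> \<Longrightarrow> \<exists>C\<ge>0. schatten_bound q C (V t)"
    and power: "\<And>t n. 0 \<le> t \<Longrightarrow> 0 < n \<Longrightarrow> t / real n \<le> \<tau> \<Longrightarrow> V t = V (t / real n) ^^ n"
    and "t > 0"
  shows "V t \<in> schatten_class 1"
proof -
  obtain n where n: "real n > max q (t / \<tau>)"
    using reals_Archimedean2 by blast
  have "0 < n"
    using n \<open>q \<ge> 1\<close> by (cases n) auto
  have le: "t / real n \<le> \<tau>" "0 < t / real n"
    using n \<open>\<tau> > 0\<close> \<open>t > 0\<close> \<open>0 < n\<close> by (auto simp: field_simps)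
  obtain C where C: "C \<ge> 0" "schatten_bound q C (V (t / real n))"
    using bound [OF le(2,1)] by blast
  have lin: "bounded_clinear (V (t / real n))"
    using le by (intro C0_semigroup_bounded_clinear [OF V]) simp
  obtain C' where "0 \<le> C'" "schatten_bound 1 C' (V (t / real n) ^^ n)"
    using schatten_bound_funpow [OF C(2) lin C(1)] n \<open>q \<ge> 1\<close> by auto
  moreover have "V t = V (t / real n) ^^ n"
    using \<open>t > 0\<close> \<open>0 < n\<close> le by (intro power) auto
  ultimately show ?thesis
    using C0_semigroup_bounded_clinear [OF V, of t] \<open>t > 0\<close>
    by (intro schatten_bound_imp_schatten_class [of _ C']) auto
qed

theorem lemma1:
  fixes T A :: "'a::chilbert_space \<Rightarrow> 'a"
    and DT DA :: "'a set"
    and S :: "real \<Rightarrow> 'a \<Rightarrow> 'a"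
    and q :: real
  assumes "generates_C0_semigroup DT T S"
    and "\<And>t. t > 0 \<Longrightarrow> S t \<in> schatten_class 1"
    and "closed_operator DA A"
    and "(\<Union>t\<in>{0<..}. range (S t)) \<subseteq> DA"
    and "q \<ge> 1"
    and "\<And>t. 0 < t \<Longrightarrow> t \<le> 1 \<Longrightarrow> A \<circ> S t \<in> schatten_class q"
    and "(\<integral>\<^sup>+t\<in>{0<..1}. ennreal (schatten_norm q (A \<circ> S t)) \<partial>lborel) < \<infinity>"
  shows "DT \<subseteq> DA \<and>
    (\<exists>U. generates_C0_semigroup DT (\<lambda>x. T x + A x) U \<and>
      (\<forall>t>0. U t \<in> schatten_class 1) \<and>
      (\<lambda>t. schatten_norm q (U t)) \<in> O[at_right 0](\<lambda>t. schatten_norm q (S t)))"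
proof -
  have S: "C0_semigroup S" and gen: "has_infinitesimal_generator S DT (\<lambda>x. - T x)"
    using assms(1) by (simp_all add: generates_C0_semigroup_def)
  obtain M where M: "M \<ge> 1" "\<And>t x. 0 \<le> t \<Longrightarrow> t \<le> 1 \<Longrightarrow> norm (S t x) \<le> M * norm x"
    using C0_semigroup_locally_bounded [OF S, of 1] by blast
  define f where "f t = schatten_norm q (A \<circ> S t)" for t
  have f_nonneg: "0 \<le> f t" for t
    by (simp add: f_def schatten_norm_nonneg)
  have AS_lin: "bounded_clinear (\<lambda>x. A (S t x))" if "0 < t" "t \<le> 1" for t
    using schatten_class_bounded_clinear [OF assms(6) [OF that]] by (simp add: comp_def)
  have AS_bound: "schatten_bound q (f t) (\<lambda>x. A (S t x))" if "0 < t" "t \<le> 1" for t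
    using schatten_class_imp_schatten_bound [OF assms(6) [OF that] \<open>q \<ge> 1\<close>] by (simp add: f_def comp_def)
  have f_quasi: "f t \<le> M * f s" if st: "0 < s" "s \<le> t" "t \<le> 1" for s t
  proof -
    have "schatten_bound q (M * f s) (\<lambda>x. A (S s (S (t - s) x)))"
      using st M
      by (intro schatten_bound_compose_right [of q "f s" "\<lambda>x. A (S s x)"] AS_bound AS_lin
          C0_semigroup_bounded_clinear [OF S] f_nonneg) auto
    moreover have "(\<lambda>x. A (S s (S (t - s) x))) = (\<lambda>x. A (S t x))"
      using C0_semigroup_add [OF S, of s "t - s"] st by (simp add: fun_eq_iff)
    ultimately show ?thesis
      unfolding f_def comp_def using st M f_nonneg [of s] \<open>q \<ge> 1\<close>
      by (intro schatten_bound_imp_schatten_class AS_lin) (auto simp: f_def comp_def)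
  qed
  obtain g where g: "\<And>t. 0 < t \<Longrightarrow> t \<le> 1 \<Longrightarrow> f t \<le> g t"
      "\<And>s t. 0 < s \<Longrightarrow> s \<le> t \<Longrightarrow> t \<le> 1 \<Longrightarrow> g t \<le> g s" "g integrable_on {0..1}"
    using decreasing_majorant [of f M] f_nonneg f_quasi M(1) assms(7) unfolding f_def by force
  obtain \<tau> where \<tau>: "0 < \<tau>" "\<tau> \<le> 1" "integral {0..\<tau>} g \<le> 1 / 4"
  proof -
    have "continuous_on {0..1} (\<lambda>s. integral {0..s} g)"
      by (rule indefinite_integral_continuous_1 [OF g(3)])
    then obtain d where d: "d > 0"
        "\<And>s. s \<in> {0..1} \<Longrightarrow> dist s 0 < d \<Longrightarrow> dist (integral {0..s} g) (integral {0..0} g) < 1 / 4"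
      unfolding continuous_on_iff by (metis atLeastAtMost_iff order_refl zero_le_one divide_pos_pos zero_less_one zero_less_numeral)
    define \<tau> where "\<tau> = min 1 (d / 2)"
    have "dist (integral {0..\<tau>} g) (integral {0..0} g) < 1 / 4"
      using d(1) by (intro d(2)) (auto simp: \<tau>_def)
    then have "integral {0..\<tau>} g \<le> 1 / 4"
      by (simp add: dist_norm)
    then show thesis
      using d(1) by (intro that [of \<tau>]) (auto simp: \<tau>_def)
  qed
  interpret closed_perturbation S A g \<tau> M DA
  proof
    fix s r t :: real and x
    show "C0_semigroup S" "0 < \<tau>" "M \<ge> 1" "closed_operator DA A" "integral {0..\<tau>} g \<le> 1 / 4"
      using S \<tau> M assms by auto
    show "norm (S t x) \<le> M * norm x" if "0 \<le> t" "t \<le> \<tau>"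
      using that \<tau> by (intro M) auto
    show "bounded_clinear (\<lambda>x. A (S s x))" if "0 < s" "s \<le> \<tau>"
      using that \<tau> by (intro AS_lin) auto
    show "A (S (s + r) x) = A (S s (S r x))" if "0 < s" "0 \<le> r" "s + r \<le> \<tau>"
      using that by (simp add: C0_semigroup_add [OF S])
    show "norm (A (S s x)) \<le> g s * norm x" if "0 < s" "s \<le> \<tau>"
    proof -
      have "norm (A (S s x)) \<le> f s * norm x"
        using that \<tau> \<open>q \<ge> 1\<close> by (intro schatten_bound_norm_le [OF AS_bound AS_lin] f_nonneg) auto
      also have "\<dots> \<le> g s * norm x"
        using that \<tau> by (intro mult_right_mono g) auto
      finally show ?thesis .
    qed
    show "0 \<le> g s" if "0 < s" "s \<le> \<tau>"
      using g(1) [of s] f_nonneg [of s] that \<tau> by simp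
    show "g integrable_on {0..\<tau>}"
      by (rule integrable_on_subinterval [OF g(3)]) (use \<tau> in auto)
    show "S t x \<in> DA" if "0 < t"
      using assms(4) that by blast
    show "g t \<le> g s" if "0 < s" "s \<le> t" "t \<le> \<tau>"
      using that \<tau> by (intro g) auto
  qed
  note U = family_perturbed
  have U_lim: "((\<lambda>t. perturbed t x) \<longlongrightarrow> x) (at_right 0)" for x
  proof -
    have "((\<lambda>t. perturbed t x) \<longlongrightarrow> perturbed 0 x) (at 0 within {0..\<tau>})"
      using family_cont [OF U] unfolding continuous_on_def by (rule bspec) (use \<tau> in simp)
    then show ?thesis
      using \<tau>(1) by (simp add: at_within_Icc_at_right perturbed_0)
  qed
  obtain V where V: "C0_semigroup V" "\<And>t. 0 \<le> t \<Longrightarrow> t \<le> \<tau> \<Longrightarrow> V t = perturbed t"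
    "\<And>t n. 0 \<le> t \<Longrightarrow> 0 < n \<Longrightarrow> t / real n \<le> \<tau> \<Longrightarrow> V t = perturbed (t / real n) ^^ n"
  proof (rule C0_semigroup_extend [of \<tau> perturbed])
    show "bounded_clinear (perturbed t)" if "0 \<le> t" "t \<le> \<tau>" for t
      using that by (intro family_lin [OF U]) simp
    show "perturbed (s + t) x = perturbed s (perturbed t x)" if "0 \<le> s" "0 \<le> t" "s + t \<le> \<tau>" for s t x
      using that by (rule perturbed_add)
  qed (simp_all add: \<tau> perturbed_0 U_lim that)
  note V_gen = perturbed_generator [OF gen V(1,2)]
  have S_class: "S t \<in> schatten_class q" if "t > 0" for t
    using schatten_class_1_subset [OF assms(2) [OF that] \<open>q \<ge> 1\<close>] .
  have S_bound_q: "schatten_bound q (schatten_norm q (S t)) (S t)" if "t > 0" for t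
    by (rule schatten_class_imp_schatten_bound [OF S_class [OF that] \<open>q \<ge> 1\<close>])
  \<comment> \<open>Duhamel's equation; the integral of \<open>2 M g\<close> over \<open>[0, t]\<close> is at most \<open>M/2\<close>.\<close>
  have difference: "schatten_bound q M (\<lambda>x. S t x - V t x)" if t: "0 < t" "t \<le> \<tau>" for t
  proof (rule schatten_bound_integral [where P = "\<lambda>s x. perturbed (t - s) (A (S s x))" and g = "\<lambda>s. 2 * M * g s"])
    show "schatten_bound q (2 * M * g s) (\<lambda>x. perturbed (t - s) (A (S s x)))" if s: "0 < s" "s \<le> t" for s
    proof (rule schatten_bound_compose_left [where L = "perturbed (t - s)" and K = "\<lambda>x. A (S s x)"])
      show "schatten_bound q (g s) (\<lambda>x. A (S s x))"
        by (rule schatten_bound_mono [OF AS_bound f_nonneg g(1)]) (use s t \<tau> \<open>q \<ge> 1\<close> in auto)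
      show "bounded_clinear (perturbed (t - s))"
        using s t by (intro family_lin [OF U]) auto
      show "norm (perturbed (t - s) x) \<le> 2 * M * norm x" for x
        using s t by (intro family_bound [OF U]) auto
    qed (use M s t g_nonneg in auto)
    show "0 \<le> 2 * M * g s" if "0 < s" "s \<le> t" for s
      using that t M g_nonneg [of s] by simp
    show "((\<lambda>s. 2 * M * g s) has_integral 2 * M * integral {0..t} g) {0..t}"
      using t by (intro has_integral_mult_right integrable_integral g_int_sub) auto
    have "2 * M * integral {0..t} g \<le> 2 * M * (1 / 4)"
      using integral_g_mono [of t \<tau>] g_small t M by (intro mult_left_mono) auto
    then show "2 * M * integral {0..t} g \<le> M"
      using M by simp
    show "((\<lambda>s. perturbed (t - s) (A (S s x))) has_integral S t x - V t x) {0..t}" for x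
      using conv_has_integral [OF U, of t x] perturbed_equation [of t x] V(2) [of t] t by simp
  qed (use M \<open>q \<ge> 1\<close> in auto)
  have V_bound: "schatten_bound q (4 * (schatten_norm q (S t) + M)) (V t)" if t: "0 < t" "t \<le> \<tau>" for t
    using schatten_bound_plus [OF S_bound_q [OF t(1)] schatten_bound_uminus [OF difference [OF t]] \<open>q \<ge> 1\<close>]
      schatten_norm_nonneg [of q "S t"] M(1) by simp
  have V_trace: "V t \<in> schatten_class 1" if "t > 0" for t
  proof (rule semigroup_trace_class [OF V(1) \<tau>(1) \<open>q \<ge> 1\<close> _ _ that])
    show "\<exists>C\<ge>0. schatten_bound q C (V t)" if "0 < t" "t \<le> \<tau>" for t
      using V_bound [OF that] schatten_norm_nonneg [of q "S t"] M(1)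
      by (intro exI [of _ "4 * (schatten_norm q (S t) + M)"]) simp
    show "V t = V (t / real n) ^^ n" if "0 \<le> t" "0 < n" "t / real n \<le> \<tau>" for t n
      using V(3) [OF that] V(2) [of "t / real n"] that by simp
  qed
  have "(\<lambda>t. schatten_norm q (V t)) \<in> O[at_right 0](\<lambda>t. schatten_norm q (S t))"
  \<comment> \<open>The norms of \<open>S t\<close> are bounded below by \<open>1/2\<close> for small \<open>t\<close>, unless the space is trivial.\<close>
  proof (cases "\<exists>x::'a. x \<noteq> 0")
    case False
    then have "V t = S t" for t
      by (metis ext)
    then show ?thesis by simp
  next
    case True
    then obtain x :: 'a where x: "x \<noteq> 0" by blast
    have "((\<lambda>t. norm (S t x)) \<longlongrightarrow> norm x) (at_right 0)"
      by (intro tendsto_norm C0_semigroup_tendsto [OF S])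
    then have "\<forall>\<^sub>F t in at_right 0. norm (S t x) > norm x / 2"
      using x by (intro order_tendstoD) auto
    moreover have "\<forall>\<^sub>F t in at_right 0. t \<in> {0<..<\<tau>}"
      by (rule eventually_at_right_real [OF \<tau>(1)])
    ultimately have "\<forall>\<^sub>F t in at_right 0. norm (schatten_norm q (V t)) \<le> (4 + 8 * M) * norm (schatten_norm q (S t))"
    proof eventually_elim
      case (elim t)
      then have t: "0 < t" "t \<le> \<tau>"
        by auto
      have "norm (S t x) \<le> schatten_norm q (S t) * norm x"
        using \<open>q \<ge> 1\<close> t by (intro schatten_bound_norm_le [OF S_bound_q]
            C0_semigroup_bounded_clinear [OF S] schatten_norm_nonneg) auto
      then have "1 / 2 * norm x < schatten_norm q (S t) * norm x"
        using elim(1) by simp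
      then have "1 / 2 < schatten_norm q (S t)"
        using x by simp
      then have "M * (1 / 2) \<le> M * schatten_norm q (S t)"
        using M(1) by (intro mult_left_mono) auto
      moreover have "schatten_norm q (V t) \<le> 4 * (schatten_norm q (S t) + M)"
        using V_bound [OF t] t M(1) schatten_norm_nonneg [of q "S t"] \<open>q \<ge> 1\<close>
        by (intro schatten_bound_imp_schatten_class C0_semigroup_bounded_clinear [OF V(1)]) auto
      ultimately show ?case
        using schatten_norm_nonneg [of q "S t"] schatten_norm_nonneg [of q "V t"]
        by (simp add: distrib_right)
    qed
    then show ?thesis
      by (rule bigoI)
  qed
  then show ?thesis
    using V_gen V(1) V_trace by (auto simp: generates_C0_semigroup_def)
qed

end
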